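(* Let $\lambda$ be a dominant integral weight and $w\in W$. Then in the $K$-theoretic nilHecke ring $\mathbb{K}$, $$T_w\,e^{\lambda}=\sum_{z\le w}\ \sum_{p\in\mathcal{P}^{\uparrow,\lambda}_{w,z}} e^{p(1)}\,T_z,$$ where $\mathcal{P}^{\uparrow,\lambda}_{w,z}=\{p\in\mathbb{T}^\lambda:\ \phi(p)\ge zW_\lambda \text{ and } \mathrm{up}(z,p)=w\}$, and $$T_w\,e^{-\lambda}=\sum_{\substack{p\in\mathbb{T}^\lambda\\ \iota(p)\le wW_\lambda}}(-1)^{\ell(w)-\ell(\mathrm{down}(w,p))}\,e^{-p(1)}\,T_{\mathrm{down}(w,p)}.$$
   Context: $\mathfrak{g}$ is a symmetrizable Kac-Moody algebra with Dynkin node set $I$, weight lattice $\Lambda$, simple roots $\alpha_i$, simple coroots $\alpha_i^\vee\in\Lambda^*$, Weyl group $W$ (Bruhat order $\le$, length $\ell$). Positive real coroots are the $W$-conjugates of simple coroots that are nonnegative combinations of simple coroots; for a positive real coroot $\alpha$, $s_\alpha\in W$ is the corresponding reflection. $R(T)=\mathbb{Z}[\Lambda]$ with basis $e^\mu$. $T_i=(1-e^{\alpha_i})^{-1}(s_i-1)$ acting on $\mathrm{Frac}(R(T))$, $T_w=T_{i_1}\cdots T_{i_N}$ for a reduced word; $\mathbb{K}=\bigoplus_w R(T)T_w$ is the smash product with $T_ie^\mu=(T_i\cdot e^\mu)+e^{s_i\mu}T_i$. Coset notions: for $J\subseteq I$, $W_J=\langle s_i:i\in J\rangle$, the Bruhat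 order on $W/W_J$ is transported from the minimal length coset representatives. Deodhar lifts: if $vW_J\le\tau$, the set $\{w\in W: v\le w,\ wW_J=\tau\}$ has a Bruhat minimum $\mathrm{up}(v,\tau)$; if $wW_J\ge\tau$, the set $\{v\in W: v\le w,\ vW_J=\tau\}$ has a Bruhat maximum $\mathrm{down}(w,\tau)$. LS paths: $\lambda$ dominant, $W_\lambda$ its stabilizer ($=W_J$ with $J=\{i: s_i\lambda=\lambda\}$). For $b\in\mathbb{Q}$ and cosets $\sigma<\tau$ in $W/W_\lambda$ with minimal representatives $\sigma',\tau'$, write $\sigma<_b\tau$ if there is a saturated Bruhat chain $\sigma'=x_0\lessdot x_1\lessdot\cdots\lessdot x_r=\tau'$ in $W$ with $x_k=x_{k-1}s_{\beta_k}$, $\beta_k$ positive real coroots, and $b\langle\beta_k,\lambda\rangle\in\mathbb{Z}$ for all $k$. An LS path $p$ of shape $\lambda$ is a pair of sequences $0=b_1<b_2<\cdots<b_m<b_{m+1}=1$ of rationals and $\sigma_1<_{b_2}\sigma_2<_{b_3}\cdots<_{b_m}\sigma_m$ in $W/W_\lambda$; $\mathbb{T}^\lambda$ is the set of these. Its endpoint is $p(1)=\sum_{j=1}^m(b_{j+1}-b_j)\sigma_j\lambda\in\Lambda$, its final direction $\phi(p)=\sigma_1$, its initial direction $\iota(p)=\sigma_m$. If $zW_\lambda\le\sigma_1$, set $z_0=z$, $z_j=\mathrm{up}(z_{j-1},\sigma_j)$ for $j=1,\dots,m$, and $\mathrm{up}(z,p)=z_m$. If $\sigma_m\le wW_\lambda$,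 set $y_{m+1}=w$, $y_j=\mathrm{down}(y_{j+1},\sigma_j)$ for $j=m,\dots,1$, and $\mathrm{down}(w,p)=y_1$. *)

theory Defs
  imports
    Complex_Main
    "HOL-Algebra.Ring"
    "HOL-Library.Poly_Mapping"
    "HOL-Computational_Algebra.Fraction_Field"
begin

section \<open>Kac-Moody data\<close>

text \<open>
  The weight lattice is the free abelian group on a finite type of coordinates.  The coordinates
  are linearly ordered only so that the library recognises the group algebra of the lattice as an
  integral domain (it then has a type of fractions); nothing else depends on the order.
\<close>

type_synonym 'n weight = "'n \<Rightarrow>\<^sub>0 int"

record ('i, 'n) root_datum =
  nodes :: "'i set"
  simple_root :: "'i \<Rightarrow> 'n weight"
  simple_coroot :: "'i \<Rightarrow> 'n weight \<Rightarrow> int"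

text \<open>
  A realization of a symmetrizable generalized Cartan matrix in a lattice and its dual: as usual,
  the simple roots are linearly independent, and so are the simple coroots.
\<close>

locale kac_moody_datum =
  fixes D :: "('i, 'n::{finite,linorder}) root_datum"
  assumes finite_nodes: "finite (nodes D)"
    and coroot_additive:
      "\<lbrakk>i \<in> nodes D\<rbrakk> \<Longrightarrow> simple_coroot D i (\<mu> + \<nu>) = simple_coroot D i \<mu> + simple_coroot D i \<nu>"
    and cartan_diag: "\<lbrakk>i \<in> nodes D\<rbrakk> \<Longrightarrow> simple_coroot D i (simple_root D i) = 2"
    and cartan_nonpos:
      "\<lbrakk>i \<in> nodes D; j \<in> nodes D; i \<noteq> j\<rbrakk> \<Longrightarrow> simple_coroot D i (simple_root D j) \<le> 0"
    and cartan_zero: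
      "\<lbrakk>i \<in> nodes D; j \<in> nodes D; simple_coroot D i (simple_root D j) = 0\<rbrakk> \<Longrightarrow> simple_coroot D j (simple_root D i) = 0"
    and symmetrizable:
      "\<exists>d :: 'i \<Rightarrow> rat. (\<forall>i\<in>nodes D. d i > 0) \<and>
         (\<forall>i\<in>nodes D. \<forall>j\<in>nodes D.
            d i * of_int (simple_coroot D i (simple_root D j)) = d j * of_int (simple_coroot D j (simple_root D i)))"
    and roots_independent:
      "\<lbrakk>(\<Sum>i\<in>nodes D. frag_cmul (c i) (simple_root D i)) = 0; i \<in> nodes D\<rbrakk> \<Longrightarrow> c i = 0"
    and coroots_independent:
      "\<lbrakk>\<And>\<mu>. (\<Sum>i\<in>nodes D. c i * simple_coroot D i \<mu>) = 0; i \<in> nodes D\<rbrakk> \<Longrightarrow> c i = 0"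

definition dominant :: "('i, 'n) root_datum \<Rightarrow> 'n weight \<Rightarrow> bool" where
  "dominant D lam \<longleftrightarrow> (\<forall>i\<in>nodes D. simple_coroot D i lam \<ge> 0)"


section \<open>Weyl group and Bruhat order\<close>

text \<open>
  The Weyl group is realized faithfully on the weight lattice.  Since the simple reflections are
  involutions, the group they generate consists of the products of words.
\<close>

definition srefl :: "('i, 'n) root_datum \<Rightarrow> 'i \<Rightarrow> 'n weight \<Rightarrow> 'n weight" where
  "srefl D i \<mu> = \<mu> - frag_cmul (simple_coroot D i \<mu>) (simple_root D i)"

definition word_prod :: "('i, 'n) root_datum \<Rightarrow> 'i list \<Rightarrow> 'n weight \<Rightarrow> 'n weight" where
  "word_prod D u = foldr (\<lambda>i x. srefl D i \<circ> x) u id"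

definition weyl :: "('i, 'n) root_datum \<Rightarrow> ('n weight \<Rightarrow> 'n weight) set" where
  "weyl D = {word_prod D u |u. set u \<subseteq> nodes D}"

definition len :: "('i, 'n) root_datum \<Rightarrow> ('n weight \<Rightarrow> 'n weight) \<Rightarrow> nat" where
  "len D w = (LEAST k. \<exists>u. set u \<subseteq> nodes D \<and> word_prod D u = w \<and> length u = k)"

definition reduced_word ::
    "('i, 'n) root_datum \<Rightarrow> 'i list \<Rightarrow> ('n weight \<Rightarrow> 'n weight) \<Rightarrow> bool" where
  "reduced_word D u w \<longleftrightarrow> set u \<subseteq> nodes D \<and> word_prod D u = w \<and> length u = len D w"

text \<open>
  \<open>coroot_refl D \<beta> s\<close>: \<open>\<beta>\<close> is a real coroot and \<open>s\<close> is its reflection, that is,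
  \<open>\<beta> = w \<alpha>\<^sub>i\<^sup>\<or>\<close> (for the action of the Weyl group on the dual lattice) and \<open>s\<close> is the conjugate of
  \<open>s\<^sub>i\<close> by \<open>w\<close>.
\<close>

definition coroot_refl ::
    "('i, 'n) root_datum \<Rightarrow> ('n weight \<Rightarrow> int) \<Rightarrow> ('n weight \<Rightarrow> 'n weight) \<Rightarrow> bool" where
  "coroot_refl D \<beta> s \<longleftrightarrow> (\<exists>w\<in>weyl D. \<exists>i\<in>nodes D.
     \<beta> = simple_coroot D i \<circ> inv_into UNIV w \<and> s = w \<circ> srefl D i \<circ> inv_into UNIV w)"

definition pos_real_coroot :: "('i, 'n) root_datum \<Rightarrow> ('n weight \<Rightarrow> int) \<Rightarrow> bool" where
  "pos_real_coroot D \<beta> \<longleftrightarrow> (\<exists>w\<in>weyl D. \<exists>i\<in>nodes D. \<beta> = simple_coroot D i \<circ> inv_into UNIV w) \<and>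
     (\<exists>c :: 'i \<Rightarrow> nat. \<forall>\<mu>. \<beta> \<mu> = (\<Sum>i\<in>nodes D. int (c i) * simple_coroot D i \<mu>))"

definition bruhat_le ::
    "('i, 'n) root_datum \<Rightarrow> ('n weight \<Rightarrow> 'n weight) \<Rightarrow> ('n weight \<Rightarrow> 'n weight) \<Rightarrow> bool" where
  "bruhat_le D v w \<longleftrightarrow> v \<in> weyl D \<and> w \<in> weyl D \<and>
     (v, w) \<in> {(x, x \<circ> t) |x t. x \<in> weyl D \<and> (\<exists>\<beta>. coroot_refl D \<beta> t) \<and> len D x < len D (x \<circ> t)}\<^sup>*"

definition bruhat_cover ::
    "('i, 'n) root_datum \<Rightarrow> ('n weight \<Rightarrow> 'n weight) \<Rightarrow> ('n weight \<Rightarrow> 'n weight) \<Rightarrow> bool" where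
  "bruhat_cover D x y \<longleftrightarrow> bruhat_le D x y \<and> x \<noteq> y \<and>
     \<not> (\<exists>z. bruhat_le D x z \<and> bruhat_le D z y \<and> z \<noteq> x \<and> z \<noteq> y)"


section \<open>Cosets of the stabilizer of a dominant weight\<close>

definition stab :: "('i, 'n) root_datum \<Rightarrow> 'n weight \<Rightarrow> ('n weight \<Rightarrow> 'n weight) set" where
  "stab D lam = {w \<in> weyl D. w lam = lam}"

definition coset ::
    "('i, 'n) root_datum \<Rightarrow> 'n weight \<Rightarrow> ('n weight \<Rightarrow> 'n weight) \<Rightarrow> ('n weight \<Rightarrow> 'n weight) set" where
  "coset D lam w = {w \<circ> u |u. u \<in> stab D lam}"

definition minrep ::
    "('i, 'n) root_datum \<Rightarrow> ('n weight \<Rightarrow> 'n weight) set \<Rightarrow> 'n weight \<Rightarrow> 'n weight" where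
  "minrep D \<sigma> = arg_min_on (len D) \<sigma>"

definition coset_le ::
    "('i, 'n) root_datum \<Rightarrow> ('n weight \<Rightarrow> 'n weight) set \<Rightarrow> ('n weight \<Rightarrow> 'n weight) set \<Rightarrow> bool" where
  "coset_le D \<sigma> \<tau> \<longleftrightarrow> bruhat_le D (minrep D \<sigma>) (minrep D \<tau>)"

text \<open>The two Deodhar lifts.\<close>

definition up ::
    "('i, 'n) root_datum \<Rightarrow> 'n weight \<Rightarrow> ('n weight \<Rightarrow> 'n weight) \<Rightarrow> ('n weight \<Rightarrow> 'n weight) set
      \<Rightarrow> 'n weight \<Rightarrow> 'n weight" where
  "up D lam v \<tau> =
     (let A = {w \<in> weyl D. bruhat_le D v w \<and> coset D lam w = \<tau>}
      in THE w. w \<in> A \<and> (\<forall>x\<in>A. bruhat_le D w x))"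

definition down ::
    "('i, 'n) root_datum \<Rightarrow> 'n weight \<Rightarrow> ('n weight \<Rightarrow> 'n weight) \<Rightarrow> ('n weight \<Rightarrow> 'n weight) set
      \<Rightarrow> 'n weight \<Rightarrow> 'n weight" where
  "down D lam w \<tau> =
     (let A = {v \<in> weyl D. bruhat_le D v w \<and> coset D lam v = \<tau>}
      in THE v. v \<in> A \<and> (\<forall>x\<in>A. bruhat_le D x v))"


section \<open>LS paths\<close>

definition b_less ::
    "('i, 'n) root_datum \<Rightarrow> 'n weight \<Rightarrow> rat
      \<Rightarrow> ('n weight \<Rightarrow> 'n weight) set \<Rightarrow> ('n weight \<Rightarrow> 'n weight) set \<Rightarrow> bool" where
  "b_less D lam b \<sigma> \<tau> \<longleftrightarrow>
     \<sigma> \<in> coset D lam ` weyl D \<and> \<tau> \<in> coset D lam ` weyl D \<and> coset_le D \<sigma> \<tau> \<and> \<sigma> \<noteq> \<tau> \<and>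
     (minrep D \<sigma>, minrep D \<tau>) \<in>
       {(x, x \<circ> s) |x s. bruhat_cover D x (x \<circ> s) \<and>
          (\<exists>\<beta>. coroot_refl D \<beta> s \<and> pos_real_coroot D \<beta> \<and> b * of_int (\<beta> lam) \<in> \<int>)}\<^sup>*"

text \<open>
  A path is the pair of lists \<open>[b\<^sub>1, \<dots>, b\<^sub>m\<^sub>+\<^sub>1]\<close> and \<open>[\<sigma>\<^sub>1, \<dots>, \<sigma>\<^sub>m]\<close>; list positions start at \<open>0\<close>.
\<close>

type_synonym 'n path = "rat list \<times> ('n weight \<Rightarrow> 'n weight) set list"

definition ls_paths :: "('i, 'n) root_datum \<Rightarrow> 'n weight \<Rightarrow> 'n path set" where
  "ls_paths D lam = {(bs, \<sigma>s).
     length bs = length \<sigma>s + 1 \<and> bs ! 0 = 0 \<and> bs ! length \<sigma>s = 1 \<and> sorted_wrt (<) bs \<and>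
     set \<sigma>s \<subseteq> coset D lam ` weyl D \<and>
     (\<forall>j. 0 < j \<and> j < length \<sigma>s \<longrightarrow> b_less D lam (bs ! j) (\<sigma>s ! (j - 1)) (\<sigma>s ! j))}"

text \<open>
  The endpoint is the lattice element whose coordinates are those of the rational combination
  \<open>\<Sum>\<^sub>j (b\<^sub>j\<^sub>+\<^sub>1 - b\<^sub>j) \<sigma>\<^sub>j lam\<close>; this combination is integral for LS paths.
\<close>

definition endpoint :: "('i, 'n) root_datum \<Rightarrow> 'n weight \<Rightarrow> 'n path \<Rightarrow> 'n weight" where
  "endpoint D lam p = (case p of (bs, \<sigma>s) \<Rightarrow>
     (THE \<mu>. \<forall>n. (of_int (Poly_Mapping.lookup \<mu> n) :: rat) =
        (\<Sum>j<length \<sigma>s. (bs ! (j + 1) - bs ! j) *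
           of_int (Poly_Mapping.lookup (minrep D (\<sigma>s ! j) lam) n))))"

definition final_dir :: "'n path \<Rightarrow> ('n weight \<Rightarrow> 'n weight) set" where
  "final_dir p = hd (snd p)"

definition initial_dir :: "'n path \<Rightarrow> ('n weight \<Rightarrow> 'n weight) set" where
  "initial_dir p = last (snd p)"

definition up_path ::
    "('i, 'n) root_datum \<Rightarrow> 'n weight \<Rightarrow> ('n weight \<Rightarrow> 'n weight) \<Rightarrow> 'n path
      \<Rightarrow> 'n weight \<Rightarrow> 'n weight" where
  "up_path D lam z p = foldl (\<lambda>y \<sigma>. up D lam y \<sigma>) z (snd p)"

definition down_path ::
    "('i, 'n) root_datum \<Rightarrow> 'n weight \<Rightarrow> ('n weight \<Rightarrow> 'n weight) \<Rightarrow> 'n path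
      \<Rightarrow> 'n weight \<Rightarrow> 'n weight" where
  "down_path D lam w p = foldr (\<lambda>\<sigma> y. down D lam y \<sigma>) (snd p) w"

definition up_paths ::
    "('i, 'n) root_datum \<Rightarrow> 'n weight \<Rightarrow> ('n weight \<Rightarrow> 'n weight) \<Rightarrow> ('n weight \<Rightarrow> 'n weight)
      \<Rightarrow> 'n path set" where
  "up_paths D lam w z =
     {p \<in> ls_paths D lam. coset_le D (coset D lam z) (final_dir p) \<and> up_path D lam z p = w}"

definition down_paths ::
    "('i, 'n) root_datum \<Rightarrow> 'n weight \<Rightarrow> ('n weight \<Rightarrow> 'n weight) \<Rightarrow> 'n path set" where
  "down_paths D lam w = {p \<in> ls_paths D lam. coset_le D (initial_dir p) (coset D lam w)}"


section \<open>The K-theoretic nilHecke ring\<close>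

text \<open>\<open>R(T) = \<int>[\<Lambda>]\<close> and its field of fractions.\<close>

type_synonym 'n RT = "'n weight \<Rightarrow>\<^sub>0 int"
type_synonym 'n FT = "'n RT fract"

definition ex :: "'n weight \<Rightarrow> 'n::{finite,linorder} RT" where
  "ex \<mu> = Poly_Mapping.single \<mu> 1"

definition act_RT ::
    "('n weight \<Rightarrow> 'n weight) \<Rightarrow> 'n::{finite,linorder} RT \<Rightarrow> 'n RT" where
  "act_RT w f = (\<Sum>\<mu>\<in>Poly_Mapping.keys f. Poly_Mapping.single (w \<mu>) (Poly_Mapping.lookup f \<mu>))"

text \<open>
  This describes a unique fraction \<open>r\<close> when \<open>w\<close> is an automorphism of the lattice, in particular
  for \<open>w\<close> in the Weyl group.
\<close>

definition act_FT ::
    "('n weight \<Rightarrow> 'n weight) \<Rightarrow> 'n::{finite,linorder} FT \<Rightarrow> 'n FT" where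
  "act_FT w q =
     (THE r. \<exists>a b. b \<noteq> 0 \<and> q = Fract a b \<and> r = Fract (act_RT w a) (act_RT w b))"

text \<open>
  The ambient ring is the smash product of the field of fractions with the Weyl group: a finite
  left-linear combination of group elements \<open>v\<close> is a finitely supported function, and
  \<open>(f v) (g w) = (f (v \<cdot> g)) (v w)\<close>.  It acts on the field of fractions, and the formula
  \<open>T\<^sub>i = (1 - e\<^bsup>\<alpha>\<^sub>i\<^esup>)\<^sup>-\<^sup>1 (s\<^sub>i - 1)\<close> is an element of it.  The relation
  \<open>T\<^sub>i e\<^sup>\<mu> = (T\<^sub>i \<cdot> e\<^sup>\<mu>) + e\<^bsup>s\<^sub>i \<mu>\<^esup> T\<^sub>i\<close> then holds for this product, and the \<open>T\<^sub>w\<close> are left linearly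
  independent because each is a combination of the group elements \<open>v \<le> w\<close> in which \<open>w\<close> has
  nonzero coefficient.
\<close>

type_synonym 'n smash = "('n weight \<Rightarrow> 'n weight) \<Rightarrow>\<^sub>0 'n FT"

definition smash_mult ::
    "'n::{finite,linorder} smash \<Rightarrow> 'n smash \<Rightarrow> 'n smash" where
  "smash_mult x y = (\<Sum>v\<in>Poly_Mapping.keys x. \<Sum>w\<in>Poly_Mapping.keys y.
     Poly_Mapping.single (v \<circ> w) (Poly_Mapping.lookup x v * act_FT v (Poly_Mapping.lookup y w)))"

definition smash_one :: "'n::{finite,linorder} smash" where
  "smash_one = Poly_Mapping.single id 1"

definition of_RT :: "'n::{finite,linorder} RT \<Rightarrow> 'n smash" where
  "of_RT f = Poly_Mapping.single id (Fract f 1)"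

definition T_simple :: "('i, 'n::{finite,linorder}) root_datum \<Rightarrow> 'i \<Rightarrow> 'n smash" where
  "T_simple D i = smash_mult
     (Poly_Mapping.single id (inverse (Fract (1 - ex (simple_root D i)) 1)))
     (Poly_Mapping.single (srefl D i) 1 - smash_one)"

text \<open>By the braid relations the choice of reduced word is immaterial.\<close>

definition T_elt ::
    "('i, 'n::{finite,linorder}) root_datum \<Rightarrow> ('n weight \<Rightarrow> 'n weight) \<Rightarrow> 'n smash" where
  "T_elt D w =
     foldr (\<lambda>i x. smash_mult (T_simple D i) x) (SOME u. reduced_word D u w) smash_one"

definition nilhecke :: "('i, 'n::{finite,linorder}) root_datum \<Rightarrow> 'n smash ring" where
  "nilhecke D =
     \<lparr>carrier = {\<Sum>w\<in>F. smash_mult (of_RT (f w)) (T_elt D w) |F f. finite F \<and> F \<subseteq> weyl D},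
      mult = smash_mult, one = smash_one, zero = 0, add = (+)\<rparr>"

end

theory Submission imports Defs
begin

text \<open>
  Write \<open>T\<^sub>w e\<^sup>\<lambda> = \<Sum>\<^sub>z X\<^sub>w\<^sub>z T\<^sub>z\<close>.  Since \<open>T\<^sub>i\<close> is a divided difference, it is enough to show, for
  \<open>y < s\<^sub>i y\<close>, that applying \<open>s\<^sub>i\<close> to the row \<open>\<Sum>\<^sub>z X\<^sub>y\<^sub>z T\<^sub>z\<close> gives
  \<open>\<Sum>\<^sub>z (X\<^sub>y\<^sub>z + (1 - e\<^bsup>\<alpha>\<^sub>i\<^esup>) X'\<^sub>z) T\<^sub>z\<close>, where \<open>X'\<close> is the row of \<open>s\<^sub>i y\<close>, and multiplies the row \<open>X'\<close>
  by \<open>e\<^bsup>\<alpha>\<^sub>i\<^esup>\<close>.  Choose \<open>N\<close> divisible by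
  enough integers that all breakpoints of the paths below \<open>w\<close> lie in \<open>(1/N)\<int>\<close>, and rescale weights
  by \<open>N\<close>.  The path sums \<open>X\<close> then become entries of a product of matrices over \<open>W\<close>, alternating
  between the diagonal matrix of the weights \<open>y\<lambda>\<close> and the zero-one (or signed) matrix of the
  relation ``Deodhar lift and \<open>\<le>\<^bsub>k/N\<^esub>\<close>''.  Partial products satisfy the same pair of equations twisted
  by \<open>e\<^bsup>(N - T)\<alpha>\<^sub>i\<^esup>\<close> and \<open>e\<^bsup>T\<alpha>\<^sub>i\<^esup>\<close>: a diagonal factor shifts \<open>T\<close> by \<open>\<langle>y\<lambda>, \<alpha>\<^sub>i\<^sup>\<or>\<rangle>\<close>, and a jump at time
  \<open>k/N\<close> changes \<open>T\<close> only modulo \<open>N\<close>, which is checked on the two-by-two blocks with rows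
  \<open>y, s\<^sub>i y\<close> and columns \<open>z, s\<^sub>i z\<close>.
\<close>

text \<open>The obstacle is that a path cut off at an intermediate time has a position that may pair
  non-integrally with a simple coroot, so its sums satisfy no untwisted relation with
  \<open>s i\<close>. The parameter T records this defect as N times a fractional part. It returns
  to N once a path is complete, and at T = N the twisted equations become the two equations for full
  rows. The dominant and antidominant formulas differ in orientation: one lifts z into the first
  direction, a jump at time 0, the other lifts w into the last direction, a jump at time 1. At both
  times the integrality condition is void, so these lifts belong to the same family of matrices. N
  depends on w because W may be infinite, while only finitely many elements lie below w.
  Independence of \<open>T_elt\<close> from the reduced word comes from the path sums: the column of
  the identity gives the action on dominant exponentials, and these separate the elements of the
  smash product supported on W. Length and Bruhat order are controlled through the sign theorem for
  roots and coroots.\<close>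

lemma word_prod_Nil [simp]: "word_prod D [] = id"
  by (simp add: word_prod_def)

lemma word_prod_Cons [simp]: "word_prod D (i # u) = srefl D i \<circ> word_prod D u"
  by (simp add: word_prod_def)

lemma word_prod_append [simp]: "word_prod D (u @ v) = word_prod D u \<circ> word_prod D v"
  by (induction u) (auto simp: fun_eq_iff)

context kac_moody_datum
begin

abbreviation s where "s \<equiv> srefl D"
abbreviation W where "W \<equiv> weyl D"
abbreviation ell ("\<ell>") where "\<ell> \<equiv> len D"
abbreviation iv where "iv \<equiv> inv_into UNIV"
abbreviation I where "I \<equiv> nodes D"
abbreviation cr where "cr \<equiv> simple_coroot D"
abbreviation rt where "rt \<equiv> simple_root D"

section \<open>Weyl group elements as linear automorphisms of the weight lattice\<close>

lemma cr_0: assumes "i \<in> I" shows "cr i 0 = 0"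
  using coroot_additive[OF assms, of 0 0] by simp

lemma cr_uminus: assumes "i \<in> I" shows "cr i (- \<mu>) = - cr i \<mu>"
  using coroot_additive[OF assms, of \<mu> "- \<mu>"] cr_0[OF assms] by simp

lemma cr_diff: assumes "i \<in> I" shows "cr i (\<mu> - \<nu>) = cr i \<mu> - cr i \<nu>"
  using coroot_additive[OF assms, of \<mu> "- \<nu>"] cr_uminus[OF assms] by simp

text \<open>The scalar action \<open>g\<close> is left abstract so that one induction covers simple
  coroots, which take integer values, and Weyl group elements, which take weight values.\<close>

lemma additive_frag_cmul:
  fixes f :: "'n weight \<Rightarrow> 'a :: ab_group_add"
  assumes add: "\<And>\<mu> \<nu>. f (\<mu> + \<nu>) = f \<mu> + f \<nu>" and g: "\<And>c d x. g (c + d) x = g c x + g d x"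
    and g1: "\<And>x. g 1 x = x"
  shows "f (frag_cmul c \<mu>) = (g :: int \<Rightarrow> 'a \<Rightarrow> 'a) c (f \<mu>)"
proof (induction c rule: int_induct[where k=0])
  case base
  have "f 0 = 0" using add[of 0 0] by simp
  moreover have "g 0 (f \<mu>) = 0" using g[of 0 0] by simp
  ultimately show ?case by simp
next
  case (step1 i)
  have "f (frag_cmul (i + 1) \<mu>) = f (frag_cmul i \<mu>) + f \<mu>"
    by (simp add: frag_cmul_distrib add)
  then show ?case using step1 by (simp add: g g1)
next
  case (step2 i)
  have "f (frag_cmul (i - 1) \<mu>) + f \<mu> = f (frag_cmul i \<mu>)"
    using add[of "frag_cmul (i - 1) \<mu>" \<mu>] frag_cmul_distrib[of "i - 1" 1 \<mu>] by simp
  moreover have "g (i - 1) (f \<mu>) + f \<mu> = g i (f \<mu>)" using g[of "i - 1" 1] g1 by simp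
  ultimately show ?case using step2 by (metis add_right_imp_eq)
qed

lemma cr_cmul: "i \<in> I \<Longrightarrow> cr i (frag_cmul c \<mu>) = c * cr i \<mu>"
  by (rule additive_frag_cmul) (auto simp: coroot_additive algebra_simps)

lemmas cr_simps = cr_0 cr_uminus cr_diff cr_cmul coroot_additive cartan_diag

lemma srefl_add: "i \<in> I \<Longrightarrow> s i (\<mu> + \<nu>) = s i \<mu> + s i \<nu>"
  by (simp add: srefl_def cr_simps frag_cmul_distrib)

lemma srefl_srefl [simp]: "i \<in> I \<Longrightarrow> s i (s i \<mu>) = \<mu>"
  by (simp add: srefl_def cr_simps poly_mapping_eq_iff fun_eq_iff lookup_minus)

lemma srefl_comp [simp]: "i \<in> I \<Longrightarrow> s i \<circ> s i = id"
  by (auto simp: fun_eq_iff)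

lemma srefl_comp_left [simp]: "i \<in> I \<Longrightarrow> s i \<circ> (s i \<circ> w) = w"
  by (auto simp: fun_eq_iff)

lemma comp_srefl_cancel [simp]: "i \<in> I \<Longrightarrow> w \<circ> s i \<circ> s i = w"
  by (auto simp: fun_eq_iff)

lemma weyl_word: "set u \<subseteq> I \<Longrightarrow> word_prod D u \<in> W"
  by (auto simp: weyl_def)

lemma weylE: assumes "w \<in> W" obtains u where "set u \<subseteq> I" "word_prod D u = w"
  using assms by (auto simp: weyl_def)

lemma id_weyl [simp]: "id \<in> W"
  using weyl_word[of "[]"] by simp

lemma comp_weyl [simp]: "v \<in> W \<Longrightarrow> w \<in> W \<Longrightarrow> v \<circ> w \<in> W"
  by (metis Un_subset_iff set_append weylE weyl_word word_prod_append)

lemma srefl_weyl [simp]: "i \<in> I \<Longrightarrow> s i \<in> W"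
  using weyl_word[of "[i]"] by simp

lemma word_prod_rev: "set u \<subseteq> I \<Longrightarrow> word_prod D (rev u) \<circ> word_prod D u = id"
  by (induction u) (auto simp: fun_eq_iff)

lemma word_prod_rev_inv:
  assumes "set u \<subseteq> I" shows "bij (word_prod D u)" "iv (word_prod D u) = word_prod D (rev u)"
  using word_prod_rev[of u] word_prod_rev[of "rev u"] assms
  by (auto simp: o_bij inv_unique_comp)

lemma weyl_bij [simp]: "w \<in> W \<Longrightarrow> bij w"
  using word_prod_rev_inv(1) weylE by blast

lemma inv_weyl [simp]: "w \<in> W \<Longrightarrow> iv w \<in> W"
  by (metis set_rev weylE weyl_word word_prod_rev_inv(2))

lemma weyl_inv_comp [simp]: "w \<in> W \<Longrightarrow> iv w \<circ> w = id" "w \<in> W \<Longrightarrow> w \<circ> iv w = id"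
  by (auto simp: fun_eq_iff bij_is_inj bij_is_surj surj_f_inv_f)

lemma weyl_inv_ap [simp]: "w \<in> W \<Longrightarrow> iv w (w \<mu>) = \<mu>" "w \<in> W \<Longrightarrow> w (iv w \<mu>) = \<mu>"
  by (auto simp: bij_is_inj bij_is_surj surj_f_inv_f)

lemma inv_inv_weyl [simp]: "w \<in> W \<Longrightarrow> iv (iv w) = w"
  by (simp add: inv_inv_eq)

lemma inv_comp_weyl: "v \<in> W \<Longrightarrow> w \<in> W \<Longrightarrow> iv (v \<circ> w) = iv w \<circ> iv v"
  by (simp add: o_inv_distrib)

lemma inv_srefl [simp]: "i \<in> I \<Longrightarrow> iv (s i) = s i"
  by (simp add: inv_unique_comp)

lemma weyl_add: "w \<in> W \<Longrightarrow> w (\<mu> + \<nu>) = w \<mu> + w \<nu>"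
proof (erule weylE)
  fix u assume "set u \<subseteq> I" "word_prod D u = w"
  moreover have "set u \<subseteq> I \<Longrightarrow> word_prod D u (\<mu> + \<nu>) = word_prod D u \<mu> + word_prod D u \<nu>"
    by (induction u) (auto simp: srefl_add)
  ultimately show ?thesis by auto
qed

lemma weyl_0 [simp]: "w \<in> W \<Longrightarrow> w 0 = 0"
  using weyl_add[of w 0 0] by simp

lemma weyl_uminus: "w \<in> W \<Longrightarrow> w (- \<mu>) = - w \<mu>"
  using weyl_add[of w \<mu> "- \<mu>"] by (simp add: minus_unique)

lemma weyl_diff: "w \<in> W \<Longrightarrow> w (\<mu> - \<nu>) = w \<mu> - w \<nu>"
  using weyl_add[of w \<mu> "- \<nu>"] weyl_uminus[of w \<nu>] by simp

lemma weyl_cmul: "w \<in> W \<Longrightarrow> w (frag_cmul c \<mu>) = frag_cmul c (w \<mu>)"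
  by (rule additive_frag_cmul) (auto simp: weyl_add frag_cmul_distrib)

lemma cr_sum: "j \<in> I \<Longrightarrow> cr j (\<Sum>i\<in>A. f i) = (\<Sum>i\<in>A. cr j (f i))"
  by (induction A rule: infinite_finite_induct) (auto simp: cr_simps)

subsection \<open>Length\<close>

lemma len_le: assumes "set u \<subseteq> I" "word_prod D u = w" shows "\<ell> w \<le> length u"
  unfolding len_def using assms by (intro Least_le) auto

lemma reduced_exists: assumes "w \<in> W" obtains u where "set u \<subseteq> I" "word_prod D u = w" "length u = \<ell> w"
proof -
  obtain u where u: "set u \<subseteq> I" "word_prod D u = w" using assms weylE by blast
  have "\<exists>v. set v \<subseteq> I \<and> word_prod D v = w \<and> length v = \<ell> w"
    unfolding len_def by (rule LeastI[of _ "length u"]) (use u in auto)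
  then show ?thesis using that by blast
qed

lemma len_id [simp]: "\<ell> id = 0"
  using len_le[of "[]" id] by simp

lemma len_0_iff: "w \<in> W \<Longrightarrow> \<ell> w = 0 \<longleftrightarrow> w = id"
  by (metis len_id length_0_conv reduced_exists word_prod_Nil)

lemma len_comp: assumes "v \<in> W" "w \<in> W" shows "\<ell> (v \<circ> w) \<le> \<ell> v + \<ell> w"
proof -
  obtain a where a: "set a \<subseteq> I" "word_prod D a = v" "length a = \<ell> v" using assms reduced_exists by blast
  obtain b where b: "set b \<subseteq> I" "word_prod D b = w" "length b = \<ell> w" using assms reduced_exists by blast
  show ?thesis using len_le[of "a @ b" "v \<circ> w"] a b by auto
qed

lemma len_srefl_le: "i \<in> I \<Longrightarrow> \<ell> (s i) \<le> 1"
  using len_le[of "[i]"] by simp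

lemma len_inv_le: assumes "w \<in> W" shows "\<ell> (iv w) \<le> \<ell> w"
proof -
  obtain a where a: "set a \<subseteq> I" "word_prod D a = w" "length a = \<ell> w" using assms reduced_exists by blast
  have "iv w = word_prod D (rev a)" using a word_prod_rev_inv(2) by metis
  then show ?thesis using len_le[of "rev a" "iv w"] a by auto
qed

lemma len_inv [simp]: "w \<in> W \<Longrightarrow> \<ell> (iv w) = \<ell> w"
  by (metis inv_inv_weyl inv_weyl le_antisym len_inv_le)

lemma finite_len_le: "finite {w \<in> W. \<ell> w \<le> k}"
proof -
  have "{w \<in> W. \<ell> w \<le> k} \<subseteq> word_prod D ` {u. set u \<subseteq> I \<and> length u \<le> k}"
  proof
    fix w assume w: "w \<in> {w \<in> W. \<ell> w \<le> k}"
    obtain u where "set u \<subseteq> I" "word_prod D u = w" "length u = \<ell> w" using w reduced_exists by blast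
    then show "w \<in> word_prod D ` {u. set u \<subseteq> I \<and> length u \<le> k}" using w by auto
  qed
  then show ?thesis using finite_lists_length_le[OF finite_nodes, of k] finite_surj by blast
qed

end

text \<open>The alternating word of length \<open>k\<close> in \<open>a\<close>, \<open>b\<close> whose last letter is \<open>a\<close>.\<close>

primrec altw :: "'i \<Rightarrow> 'i \<Rightarrow> nat \<Rightarrow> 'i list" where
  "altw a b 0 = []"
| "altw a b (Suc k) = altw b a k @ [a]"

lemma set_altw: "set (altw a b k) \<subseteq> {a, b}"
  by (induction k arbitrary: a b) auto

lemma length_altw [simp]: "length (altw a b k) = k"
  by (induction k arbitrary: a b) auto

lemma altw_add: "\<exists>x. set x \<subseteq> {a, b} \<and> length x = j \<and> altw a b (j + k) = x @ altw a b k"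
proof (induction k arbitrary: a b)
  case 0
  then show ?case using set_altw[of a b j] by auto
next
  case (Suc k)
  then obtain x where "set x \<subseteq> {b, a}" "length x = j" "altw b a (j + k) = x @ altw b a k" by blast
  then show ?case by (intro exI[of _ x]) auto
qed

section \<open>Rank two subgroups and the sign theorem\<close>

context kac_moody_datum
begin

text \<open>Two equal neighbouring letters cancel, so a word that cannot be shortened inside the
  dihedral subgroup alternates. The induction adds letters on the right because \<open>altw\<close>
  is built from its right end.\<close>

lemma word_alternating:
  assumes "set u \<subseteq> {a, b}" "a \<in> I" "b \<in> I"
  shows "(\<exists>v. set v \<subseteq> {a, b} \<and> length v < length u \<and> word_prod D v = word_prod D u) \<or>
    u = altw a b (length u) \<or> u = altw b a (length u)"
  using assms(1)
proof (induction u rule: rev_induct)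
  case (snoc c x)
  then have c: "c = a \<or> c = b" and x: "set x \<subseteq> {a, b}" by auto
  have cI: "c \<in> I" using c assms by auto
  have cancel: ?case if "x = altw c d (length x)" "x \<noteq> []" "{c, d} = {a, b}" for d
  proof -
    obtain k where k: "length x = Suc k" using \<open>x \<noteq> []\<close> by (cases x) auto
    with that have xe: "x = altw d c k @ [c]" by auto
    have "word_prod D (altw d c k) = word_prod D (x @ [c])"
      using cI by (simp add: xe)
    moreover have "set (altw d c k) \<subseteq> {a, b}" using set_altw[of d c k] that(3) by auto
    moreover have "length (altw d c k) < length (x @ [c])" using k by simp
    ultimately show ?thesis by blast
  qed
  consider v where "set v \<subseteq> {a, b}" "length v < length x" "word_prod D v = word_prod D x"
    | "x = []" | "x \<noteq> []" "x = altw a b (length x)" | "x \<noteq> []" "x = altw b a (length x)"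
    using snoc.IH x by auto
  then show ?case
  proof cases
    case (1 v)
    then show ?thesis using c by (intro disjI1 exI[of _ "v @ [c]"]) auto
  next
    case 2
    then show ?thesis using c by auto
  next
    case 3
    then show ?thesis
      using c cancel[of b] by (metis altw.simps(2) insert_commute length_append_singleton)
  next
    case 4
    then show ?thesis
      using c cancel[of a] by (metis altw.simps(2) insert_commute length_append_singleton)
  qed
qed simp

text \<open>The Cartan entries of types A1 x A1, A2, B2 and G2, each with the length m of its braid
  relation.\<close>

definition fin_type :: "int \<Rightarrow> int \<Rightarrow> nat \<Rightarrow> bool" where
  "fin_type p q m \<longleftrightarrow> (p, q, m) \<in> {(0, 0, 2), (-1, -1, 3), (-1, -2, 4), (-2, -1, 4), (-1, -3, 6), (-3, -1, 6)}"

lemma cartan_cases: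
  assumes "a \<in> I" "b \<in> I" "a \<noteq> b"
  shows "(\<exists>m. fin_type (cr a (rt b)) (cr b (rt a)) m) \<or> cr a (rt b) * cr b (rt a) \<ge> 4"
proof -
  define p q where "p = - cr a (rt b)" and "q = - cr b (rt a)"
  have pq: "p \<ge> 0" "q \<ge> 0" using cartan_nonpos assms by (auto simp: p_def q_def)
  have z: "p = 0 \<longleftrightarrow> q = 0" using cartan_zero assms by (auto simp: p_def q_def)
  have "(\<exists>m. fin_type (-p) (-q) m) \<or> p * q \<ge> 4"
  proof (cases "p * q \<ge> 4")
    case False
    have "p \<le> 3 \<and> q \<le> 3"
    proof (cases "p = 0")
      case False
      then have "p \<ge> 1" "q \<ge> 1" using pq z by auto
      then have "p \<le> p * q" "q \<le> p * q" by auto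
      then show ?thesis using \<open>\<not> p * q \<ge> 4\<close> by auto
    qed (use z in auto)
    then have "p \<in> {0, 1, 2, 3}" "q \<in> {0, 1, 2, 3}" using pq by auto
    then show ?thesis using False z by (auto simp: fin_type_def)
  qed simp
  then show ?thesis by (simp add: p_def q_def)
qed

lemma braid:
  assumes "a \<in> I" "b \<in> I" "fin_type (cr a (rt b)) (cr b (rt a)) m"
  shows "word_prod D (altw a b m) = word_prod D (altw b a m)"
  using assms(3) unfolding fin_type_def
  by (auto simp: fun_eq_iff poly_mapping_eq_iff srefl_def cr_simps assms(1,2) lookup_minus
      lookup_add lookup_frag_cmul numeral_eq_Suc algebra_simps)

text \<open>The sign theorem is proved at once for roots, \<open>e w j = w \<alpha>\<^sub>j\<close>, and for coroots, \<open>e w j = w \<alpha>\<^sub>j\<^sup>\<or>\<close>;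
  the argument \<open>x\<close> is a coordinate in the first case and a weight in the second.\<close>

definition ecomb :: "(('n weight \<Rightarrow> 'n weight) \<Rightarrow> 'i \<Rightarrow> 'x \<Rightarrow> int) \<Rightarrow> ('n weight \<Rightarrow> 'n weight) \<Rightarrow> 'i \<Rightarrow> bool" where
  "ecomb e w i \<longleftrightarrow> (\<exists>c :: 'i \<Rightarrow> nat. \<forall>x. e w i x = (\<Sum>j\<in>I. int (c j) * e id j x))"

context
  fixes e :: "('n weight \<Rightarrow> 'n weight) \<Rightarrow> 'i \<Rightarrow> 'x \<Rightarrow> int" and m :: "'i \<Rightarrow> 'i \<Rightarrow> int"
  assumes e_step: "\<And>w i j x. w \<in> W \<Longrightarrow> i \<in> I \<Longrightarrow> j \<in> I \<Longrightarrow> e (w \<circ> s i) j x = e w j x - m i j * e w i x"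
    and m_eq: "m = (\<lambda>i j. cr i (rt j)) \<or> m = (\<lambda>i j. cr j (rt i))"
begin

text \<open>\<open>m\<close> is the Cartan matrix or its transpose because roots and coroots
  transform by transposed matrices. The rank two argument uses only properties common to
  both.\<close>

lemma m_props: "i \<in> I \<Longrightarrow> m i i = 2" "i \<in> I \<Longrightarrow> j \<in> I \<Longrightarrow> i \<noteq> j \<Longrightarrow> m i j \<le> 0"
  using m_eq cartan_diag cartan_nonpos by auto

text \<open>A cone argument. The inequality \<open>- m a b * P \<ge> 2 * Q\<close> passes to the
  next coefficient pair \<open>(B * P - Q, P)\<close> because the product of the two Cartan entries
  is at least 4. Hence the coefficients stay nonnegative for alternating words of every
  length.\<close>

lemma rank2_big:
  assumes "a \<in> I" "b \<in> I" "a \<noteq> b" "m a b * m b a \<ge> 4" "v \<in> W"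
    "P \<ge> 0" "Q \<ge> 0" "- m a b * P \<ge> 2 * Q"
  shows "\<exists>p q. p \<ge> 0 \<and> q \<ge> 0 \<and> (\<forall>x. P * e (v \<circ> word_prod D (altw a b k)) b x
     + Q * e (v \<circ> word_prod D (altw a b k)) a x = p * e v b x + q * e v a x)"
  using assms
proof (induction k arbitrary: a b P Q)
  case 0
  then show ?case by (intro exI[of _ P] exI[of _ Q]) auto
next
  case (Suc k)
  define B where "B = - m a b"
  define A where "A = - m b a"
  let ?w = "v \<circ> word_prod D (altw b a k)"
  have wW: "?w \<in> W" using Suc.prems set_altw[of b a k] by (intro comp_weyl weyl_word) auto
  have AB: "A \<ge> 0" "B \<ge> 0" "A * B \<ge> 4" using Suc.prems m_props by (auto simp: A_def B_def mult.commute)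
  have BP: "B * P \<ge> 2 * Q" using Suc.prems by (simp add: B_def)
  have Q': "B * P - Q \<ge> 0" using BP Suc.prems by linarith
  have "A * (2 * Q) \<le> A * (B * P)" using BP AB by (intro mult_left_mono) auto
  moreover have "4 * P \<le> A * B * P" using AB Suc.prems by (intro mult_right_mono) auto
  ultimately have inv: "A * (B * P - Q) \<ge> 2 * P" by (simp add: algebra_simps)
  have "\<exists>p q. p \<ge> 0 \<and> q \<ge> 0 \<and> (\<forall>x. (B * P - Q) * e ?w a x + P * e ?w b x = p * e v a x + q * e v b x)"
    by (rule Suc.IH) (use Suc.prems Q' inv in \<open>auto simp: A_def mult.commute\<close>)
  then obtain p q where pq: "p \<ge> 0" "q \<ge> 0"
    "\<And>x. (B * P - Q) * e ?w a x + P * e ?w b x = p * e v a x + q * e v b x" by blast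
  have st: "v \<circ> word_prod D (altw a b (Suc k)) = ?w \<circ> s a" by (simp add: o_assoc)
  have E: "e (?w \<circ> s a) b x = e ?w b x - m a b * e ?w a x" "e (?w \<circ> s a) a x = - e ?w a x" for x
    using e_step[OF wW, of a b x] e_step[OF wW, of a a x] Suc.prems m_props by auto
  have "P * e (?w \<circ> s a) b x + Q * e (?w \<circ> s a) a x = q * e v b x + p * e v a x" for x
    using pq(3)[of x] unfolding E B_def by (simp add: algebra_simps)
  then show ?case using pq unfolding st by blast
qed

text \<open>The transfer of a coefficient pair through successive letters. In finite type only
  lengths below 6 matter, so \<open>rank2_small\<close> can evaluate the recursion case by
  case.\<close>

fun altcoef :: "int \<Rightarrow> int \<Rightarrow> nat \<Rightarrow> int \<Rightarrow> int \<Rightarrow> int \<times> int" where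
  "altcoef A B 0 P Q = (P, Q)"
| "altcoef A B (Suc k) P Q = prod.swap (altcoef B A k (- A * P - Q) P)"

lemma rank2_coef:
  assumes "a \<in> I" "b \<in> I" "v \<in> W"
  shows "P * e (v \<circ> word_prod D (altw a b k)) b x + Q * e (v \<circ> word_prod D (altw a b k)) a x
    = fst (altcoef (m a b) (m b a) k P Q) * e v b x + snd (altcoef (m a b) (m b a) k P Q) * e v a x"
  using assms
proof (induction k arbitrary: a b P Q)
  case (Suc k)
  let ?w = "v \<circ> word_prod D (altw b a k)"
  have wW: "?w \<in> W" using Suc.prems set_altw[of b a k] by (intro comp_weyl weyl_word) auto
  have st: "v \<circ> word_prod D (altw a b (Suc k)) = ?w \<circ> s a" by (simp add: o_assoc)
  have E: "e (?w \<circ> s a) b x = e ?w b x - m a b * e ?w a x" "e (?w \<circ> s a) a x = - e ?w a x"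
    using e_step[OF wW, of a b x] e_step[OF wW, of a a x] Suc.prems m_props by auto
  have "P * e (?w \<circ> s a) b x + Q * e (?w \<circ> s a) a x = (- m a b * P - Q) * e ?w a x + P * e ?w b x"
    unfolding E by (simp add: algebra_simps)
  also have "\<dots> = fst (altcoef (m b a) (m a b) k (- m a b * P - Q) P) * e v a x
    + snd (altcoef (m b a) (m a b) k (- m a b * P - Q) P) * e v b x"
    by (rule Suc.IH) (use Suc.prems in auto)
  finally show ?case unfolding st altcoef.simps fst_swap snd_swap by linarith
qed simp

lemma rank2_small:
  assumes "a \<in> I" "b \<in> I" "fin_type (cr a (rt b)) (cr b (rt a)) n" "v \<in> W" "k < n"
  shows "\<exists>p q. p \<ge> 0 \<and> q \<ge> 0 \<and> (\<forall>x. e (v \<circ> word_prod D (altw a b k)) b x = p * e v b x + q * e v a x)"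
proof -
  have f: "fin_type (m a b) (m b a) n"
    using m_eq assms(3) by (auto simp: fin_type_def)
  have "k \<in> {0, 1, 2, 3, 4, 5}" using f assms(5) by (auto simp: fin_type_def)
  then have "fst (altcoef (m a b) (m b a) k 1 0) \<ge> 0 \<and> snd (altcoef (m a b) (m b a) k 1 0) \<ge> 0"
    using f assms(5) unfolding fin_type_def by (auto simp: numeral_eq_Suc)
  then show ?thesis using rank2_coef[OF assms(1,2,4), of 1 k _ 0] by force
qed

text \<open>The two minimality hypotheses force a nonempty \<open>u\<close> to alternate and to end
  in \<open>a\<close>. In finite type they also keep it shorter than the braid word, since a longer
  word could be rewritten to end in \<open>b\<close> and then be shortened by
  \<open>s b\<close>.\<close>

lemma rank2:
  assumes "a \<in> I" "b \<in> I" "a \<noteq> b" "v \<in> W" "set u \<subseteq> {a, b}"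
    and red: "\<And>u'. set u' \<subseteq> {a, b} \<Longrightarrow> word_prod D u' = word_prod D u \<Longrightarrow> length u \<le> length u'"
    and redb: "\<And>u'. set u' \<subseteq> {a, b} \<Longrightarrow> word_prod D u' = word_prod D u \<circ> s b \<Longrightarrow> length u \<le> length u'"
  shows "\<exists>p q. p \<ge> 0 \<and> q \<ge> 0 \<and> (\<forall>x. e (v \<circ> word_prod D u) b x = p * e v b x + q * e v a x)"
proof -
  define k where "k = length u"
  have nb: "k = 0" if ub: "word_prod D u = word_prod D (altw b a k)"
  proof (rule ccontr)
    assume "k \<noteq> 0"
    then obtain j where j: "k = Suc j" by (cases k) auto
    have "word_prod D (altw a b j) = word_prod D u \<circ> s b"
      using ub assms by (simp add: j)
    then have "length u \<le> length (altw a b j)" using redb set_altw[of a b j] by blast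
    then show False using j by (simp add: k_def)
  qed
  have ua: "u = altw a b k"
  proof -
    have "\<not> (\<exists>v. set v \<subseteq> {a, b} \<and> length v < length u \<and> word_prod D v = word_prod D u)"
      using red leD by blast
    then consider "u = altw a b k" | "u = altw b a k"
      using word_alternating[OF assms(5,1,2)] by (auto simp: k_def)
    then show ?thesis by cases (use nb in auto)
  qed
  show ?thesis
  proof (cases "\<exists>n. fin_type (cr a (rt b)) (cr b (rt a)) n")
    case True
    then obtain n where n: "fin_type (cr a (rt b)) (cr b (rt a)) n" by blast
    have "k < n"
    proof (rule ccontr)
      assume "\<not> k < n"
      then obtain j where kj: "k = j + n" by (metis add.commute le_add_diff_inverse not_less)
      have "n > 0" using n by (auto simp: fin_type_def)
      obtain x where x: "set x \<subseteq> {a, b}" "length x = j" "altw a b (j + n) = x @ altw a b n"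
        using altw_add by metis
      obtain n' where n': "n = Suc n'" using \<open>n > 0\<close> by (cases n) auto
      have "word_prod D (x @ altw a b n') = word_prod D u \<circ> s b"
        using braid[OF assms(1,2) n] assms(2) x by (simp add: ua kj n' o_assoc[symmetric])
      moreover have "set (x @ altw a b n') \<subseteq> {a, b}" using x set_altw[of a b n'] by auto
      ultimately have "length u \<le> length (x @ altw a b n')" using redb by blast
      then show False using x kj n' by (simp add: k_def)
    qed
    then show ?thesis using rank2_small[OF assms(1,2) n assms(4)] ua by metis
  next
    case False
    then have "cr a (rt b) * cr b (rt a) \<ge> 4" using cartan_cases assms by blast
    then have "m a b * m b a \<ge> 4" using m_eq by (auto simp: mult.commute)
    from rank2_big[OF assms(1-3) this assms(4), of 1 0 k] m_props(2)[OF assms(1-3)]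
    show ?thesis using ua by simp
  qed
qed

lemma ecomb_add:
  assumes "\<And>x. e w i x = p * e v j x + q * e v k x" "p \<ge> 0" "q \<ge> 0" "ecomb e v j" "ecomb e v k"
  shows "ecomb e w i"
proof -
  obtain c d where "\<And>x. e v j x = (\<Sum>j\<in>I. int (c j) * e id j x)"
    "\<And>x. e v k x = (\<Sum>j\<in>I. int (d j) * e id j x)" using assms(4,5) by (auto simp: ecomb_def)
  then have "e w i x = (\<Sum>j\<in>I. int (nat p * c j + nat q * d j) * e id j x)" for x
    using assms(1-3) by (simp add: sum_distrib_left algebra_simps sum.distrib)
  then show ?thesis unfolding ecomb_def by (intro exI[of _ "\<lambda>j. nat p * c j + nat q * d j"]) auto
qed

text \<open>Induction on length by reduction to rank two: w is split as v times an element of a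
  dihedral subgroup containing \<open>s i\<close>, the induction hypothesis applies to v at both
  generators, and \<open>rank2\<close> combines the two vectors of v with nonnegative
  coefficients.\<close>

theorem ecomb_ascent:
  "w \<in> W \<Longrightarrow> i \<in> I \<Longrightarrow> \<not> \<ell> (w \<circ> s i) < \<ell> w \<Longrightarrow> ecomb e w i"
proof (induction "\<ell> w" arbitrary: w i rule: less_induct)
  case less
  show ?case
  proof (cases "\<ell> w = 0")
    case True
    then have [simp]: "w = id" using less len_0_iff by blast
    have "e id i x = (\<Sum>j\<in>I. int (if j = i then 1 else 0) * e id j x)" for x
      using less finite_nodes by (simp add: if_distrib if_distribR sum.If_cases cong: if_cong)
    then show ?thesis unfolding ecomb_def by (intro exI[of _ "\<lambda>j. if j = i then 1 else 0"]) auto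
  next
    case False
    obtain u where u: "set u \<subseteq> I" "word_prod D u = w" "length u = \<ell> w" using less reduced_exists by blast
    then obtain u0 t where ut: "u = u0 @ [t]" using False by (cases u rule: rev_cases) auto
    have tI: "t \<in> I" and u0: "set u0 \<subseteq> I" using u ut by auto
    have v0: "word_prod D u0 = w \<circ> s t" using u ut tI by auto
    have lt: "\<ell> (w \<circ> s t) < \<ell> w" using len_le[OF u0 v0] u ut by simp
    then have ti: "t \<noteq> i" using less by auto
    \<comment> \<open>Here t is the last letter of a reduced word of w. A shortest v with this
      property ascends at both t and i, since a descent could be moved into the dihedral
      factor.\<close>
    define Q where "Q v \<longleftrightarrow> v \<in> W \<and> (\<exists>x. set x \<subseteq> {t, i} \<and> w = v \<circ> word_prod D x \<and> \<ell> v + length x = \<ell> w)" for v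
    have Q0: "Q (w \<circ> s t)"
    proof -
      have "\<ell> w \<le> \<ell> (w \<circ> s t) + 1"
        using len_comp[of "w \<circ> s t" "s t"] len_srefl_le[OF tI] tI less by simp
      then show ?thesis unfolding Q_def using tI less lt by (auto intro!: exI[of _ "[t]"])
    qed
    obtain v where v: "Q v" "\<And>v'. Q v' \<Longrightarrow> \<ell> v \<le> \<ell> v'"
      using ex_has_least_nat[of Q _ \<ell>] Q0 by metis
    then obtain x where x: "set x \<subseteq> {t, i}" "w = v \<circ> word_prod D x" "\<ell> v + length x = \<ell> w" and vW: "v \<in> W"
      by (auto simp: Q_def)
    have lv: "\<ell> v < \<ell> w" using v(2)[OF Q0] lt by simp
    have no: "\<not> \<ell> (v \<circ> s j) < \<ell> v" if "j \<in> {t, i}" for j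
    proof
      assume *: "\<ell> (v \<circ> s j) < \<ell> v"
      have jI: "j \<in> I" using that tI less by auto
      have sx: "set (j # x) \<subseteq> {t, i}" using x that by auto
      then have sxI: "set (j # x) \<subseteq> I" using tI less by auto
      have w': "w = (v \<circ> s j) \<circ> word_prod D (j # x)" using x jI by (simp add: fun_eq_iff)
      have "\<ell> w \<le> \<ell> (v \<circ> s j) + \<ell> (word_prod D (j # x))"
        by (subst w') (use vW jI sxI weyl_word in \<open>blast intro: len_comp comp_weyl srefl_weyl\<close>)
      moreover have "\<ell> (word_prod D (j # x)) \<le> length (j # x)" using len_le[OF sxI] by simp
      ultimately have "\<ell> (v \<circ> s j) + length (j # x) = \<ell> w" using * x by simp
      then have "Q (v \<circ> s j)" unfolding Q_def using w' sx vW jI by (metis comp_weyl srefl_weyl)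
      then show False using v(2) * by fastforce
    qed
    have tiI: "{t, i} \<subseteq> I" using tI less by auto
    have "\<exists>p q. p \<ge> 0 \<and> q \<ge> 0 \<and> (\<forall>y. e (v \<circ> word_prod D x) i y = p * e v i y + q * e v t y)"
    proof (rule rank2[OF tI less(3) ti vW x(1)])
      fix u' assume u': "set u' \<subseteq> {t, i}" "word_prod D u' = word_prod D x"
      have uI: "set u' \<subseteq> I" using u' tiI by blast
      have "\<ell> w \<le> \<ell> v + \<ell> (word_prod D u')" using len_comp[OF vW weyl_word[OF uI]] u' x by simp
      then show "length x \<le> length u'" using len_le[OF uI refl] x by linarith
    next
      fix u' assume u': "set u' \<subseteq> {t, i}" "word_prod D u' = word_prod D x \<circ> s i"
      have "w \<circ> s i = v \<circ> word_prod D u'" using x u' by (simp add: o_assoc)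
      moreover have uI: "set u' \<subseteq> I" using u' tiI by blast
      ultimately have "\<ell> (w \<circ> s i) \<le> \<ell> v + \<ell> (word_prod D u')"
        using len_comp[OF vW weyl_word[OF uI]] by simp
      then show "length x \<le> length u'" using len_le[OF uI refl] x less by linarith
    qed
    then obtain p q where pq: "p \<ge> 0" "q \<ge> 0" "\<And>y. e w i y = p * e v i y + q * e v t y" using x by blast
    show ?thesis
      using ecomb_add[OF pq(3,1,2)] less(1)[OF lv vW] no tI less(3) by blast
  qed
qed

end

subsection \<open>Signs of roots and coroots\<close>

definition nonneg_rt :: "'n weight \<Rightarrow> bool" where
  "nonneg_rt \<gamma> \<longleftrightarrow> (\<exists>c :: 'i \<Rightarrow> nat. \<gamma> = (\<Sum>j\<in>I. frag_cmul (int (c j)) (rt j)))"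

definition nonneg_cr :: "('n weight \<Rightarrow> int) \<Rightarrow> bool" where
  "nonneg_cr \<beta> \<longleftrightarrow> (\<exists>c :: 'i \<Rightarrow> nat. \<forall>\<mu>. \<beta> \<mu> = (\<Sum>i\<in>I. int (c i) * cr i \<mu>))"

lemma lookup_sum_cmul:
  "Poly_Mapping.lookup (\<Sum>j\<in>A. frag_cmul (c j) (f j)) n = (\<Sum>j\<in>A. c j * Poly_Mapping.lookup (f j) n)"
  by (induction A rule: infinite_finite_induct) (auto simp: lookup_add lookup_frag_cmul)

lemma rt_ascent:
  assumes "w \<in> W" "i \<in> I" "\<not> \<ell> (w \<circ> s i) < \<ell> w"
  shows "nonneg_rt (w (rt i))"
proof -
  have "ecomb (\<lambda>w j n. Poly_Mapping.lookup (w (rt j)) n) w i"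
    by (rule ecomb_ascent[where m = "\<lambda>i j. cr i (rt j)"])
       (use assms in \<open>auto simp: srefl_def weyl_diff weyl_cmul lookup_minus lookup_frag_cmul\<close>)
  then show ?thesis
    by (auto simp: ecomb_def nonneg_rt_def poly_mapping_eq_iff fun_eq_iff lookup_sum_cmul)
qed

lemma cr_ascent:
  assumes "w \<in> W" "i \<in> I" "\<not> \<ell> (w \<circ> s i) < \<ell> w"
  shows "nonneg_cr (cr i \<circ> iv w)"
proof -
  have "ecomb (\<lambda>w j \<mu>. cr j (iv w \<mu>)) w i"
    by (rule ecomb_ascent[where m = "\<lambda>i j. cr j (rt i)"])
       (use assms in \<open>auto simp: inv_comp_weyl srefl_def cr_simps\<close>)
  then show ?thesis by (auto simp: ecomb_def nonneg_cr_def)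
qed

lemma nonneg_rt_antisym: assumes "nonneg_rt \<gamma>" "nonneg_rt (- \<gamma>)" shows "\<gamma> = 0"
proof -
  obtain c d where c: "\<gamma> = (\<Sum>j\<in>I. frag_cmul (int (c j)) (rt j))"
    and d: "- \<gamma> = (\<Sum>j\<in>I. frag_cmul (int (d j)) (rt j))" using assms by (auto simp: nonneg_rt_def)
  have "(\<Sum>j\<in>I. frag_cmul (int (c j + d j)) (rt j)) = \<gamma> + - \<gamma>"
    unfolding d by (subst c) (simp add: frag_cmul_distrib sum.distrib)
  then have "int (c j + d j) = 0" if "j \<in> I" for j
    using roots_independent[of "\<lambda>j. int (c j + d j)"] that by simp
  then have "c j = 0" if "j \<in> I" for j using that by force
  then show ?thesis unfolding c by simp
qed

lemma nonneg_cr_antisym: assumes "nonneg_cr \<beta>" "nonneg_cr (\<lambda>\<mu>. - \<beta> \<mu>)" shows "\<beta> \<mu> = 0"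
proof -
  obtain c d where c: "\<And>\<mu>. \<beta> \<mu> = (\<Sum>j\<in>I. int (c j) * cr j \<mu>)"
    and d: "\<And>\<mu>. - \<beta> \<mu> = (\<Sum>j\<in>I. int (d j) * cr j \<mu>)" using assms unfolding nonneg_cr_def by metis
  have "(\<Sum>j\<in>I. int (c j + d j) * cr j \<mu>) = 0" for \<mu>
    using c[of \<mu>] d[of \<mu>] by (simp add: distrib_right sum.distrib)
  then have "int (c j + d j) = 0" if "j \<in> I" for j
    using coroots_independent[of "\<lambda>j. int (c j + d j)"] that by simp
  then have "c j = 0" if "j \<in> I" for j using that by force
  then show ?thesis unfolding c by simp
qed

lemma rt_nonzero: assumes "w \<in> W" "i \<in> I" shows "w (rt i) \<noteq> 0"
proof
  assume "w (rt i) = 0"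
  then have "rt i = 0" using weyl_inv_ap(1)[OF assms(1), of "rt i"] assms by simp
  then show False using cartan_diag[OF assms(2)] cr_0[OF assms(2)] by simp
qed

lemma srefl_rt: "i \<in> I \<Longrightarrow> s i (rt i) = - rt i"
  by (simp add: srefl_def cartan_diag poly_mapping_eq_iff fun_eq_iff lookup_minus lookup_frag_cmul)

lemma len_rmult_neq: assumes "w \<in> W" "i \<in> I" shows "\<ell> (w \<circ> s i) \<noteq> \<ell> w"
proof
  assume eq: "\<ell> (w \<circ> s i) = \<ell> w"
  have "nonneg_rt (w (rt i))" using rt_ascent assms eq by simp
  moreover have "nonneg_rt ((w \<circ> s i) (rt i))" using rt_ascent[of "w \<circ> s i" i] assms eq by simp
  then have "nonneg_rt (- w (rt i))" using assms by (simp add: srefl_rt weyl_uminus)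
  ultimately show False using nonneg_rt_antisym rt_nonzero assms by blast
qed

lemma rt_pos: assumes "w \<in> W" "i \<in> I" "\<ell> w < \<ell> (w \<circ> s i)" shows "nonneg_rt (w (rt i))"
  using rt_ascent assms by simp

lemma rt_neg: assumes "w \<in> W" "i \<in> I" "\<ell> (w \<circ> s i) < \<ell> w" shows "nonneg_rt (- w (rt i))"
  using rt_ascent[of "w \<circ> s i" i] assms by (simp add: srefl_rt weyl_uminus)

lemma cr_pos: assumes "w \<in> W" "i \<in> I" "\<ell> w < \<ell> (w \<circ> s i)" shows "nonneg_cr (cr i \<circ> iv w)"
  using cr_ascent assms by simp

lemma cr_srefl: "i \<in> I \<Longrightarrow> cr i (s i \<mu>) = - cr i \<mu>"
  by (simp add: srefl_def cr_simps)

lemma cr_neg: assumes "w \<in> W" "i \<in> I" "\<ell> (w \<circ> s i) < \<ell> w" shows "nonneg_cr (\<lambda>\<mu>. - cr i (iv w \<mu>))"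
proof -
  have "cr i \<circ> iv (w \<circ> s i) = (\<lambda>\<mu>. - cr i (iv w \<mu>))"
    using assms by (simp add: fun_eq_iff inv_comp_weyl cr_srefl)
  moreover have "nonneg_cr (cr i \<circ> iv (w \<circ> s i))" using cr_ascent[of "w \<circ> s i" i] assms by simp
  ultimately show ?thesis by simp
qed

lemma cr_neg_iff:
  assumes "w \<in> W" "i \<in> I"
  shows "nonneg_cr (\<lambda>\<mu>. - cr i (iv w \<mu>)) \<longleftrightarrow> \<ell> (w \<circ> s i) < \<ell> w"
proof
  assume *: "nonneg_cr (\<lambda>\<mu>. - cr i (iv w \<mu>))"
  show "\<ell> (w \<circ> s i) < \<ell> w"
  proof (rule ccontr)
    assume "\<not> ?thesis"
    then have "nonneg_cr (\<lambda>\<mu>. cr i (iv w \<mu>))" using cr_ascent[OF assms] by (simp add: o_def)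
    from nonneg_cr_antisym[OF this *] have "cr i (iv w (w (rt i))) = 0" .
    then show False using assms by (simp add: cartan_diag)
  qed
qed (use cr_neg assms in blast)

lemma conj_srefl:
  assumes "w \<in> W" "i \<in> I"
  shows "(w \<circ> s i \<circ> iv w) \<mu> = \<mu> - frag_cmul (cr i (iv w \<mu>)) (w (rt i))"
  using assms by (simp add: srefl_def weyl_diff weyl_cmul)

text \<open>A simple reflection changes the sign of only one positive real root.\<close>

lemma simple_conj:
  assumes w: "w \<in> W" and ij: "i \<in> I" "j \<in> I" and asc: "\<ell> w < \<ell> (w \<circ> s i)"
    and desc: "\<ell> (s j \<circ> w \<circ> s i) < \<ell> (s j \<circ> w)"
  shows "w \<circ> s i \<circ> iv w = s j"
proof -
  have jw: "s j \<circ> w \<in> W" using w ij by simp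
  obtain c where c: "w (rt i) = (\<Sum>k\<in>I. frag_cmul (int (c k)) (rt k))"
    using rt_pos[OF w ij(1) asc] by (auto simp: nonneg_rt_def)
  obtain d where d: "- s j (w (rt i)) = (\<Sum>k\<in>I. frag_cmul (int (d k)) (rt k))"
    using rt_neg[OF jw ij(1) desc] by (auto simp: nonneg_rt_def)
  \<comment> \<open>The expansions of \<open>w (rt i)\<close> and of minus its image under
    \<open>s j\<close> add up to a multiple of \<open>rt j\<close>. Linear independence therefore
    kills every other coefficient of both.\<close>
  let ?m = "\<lambda>k. if k = j then cr j (w (rt i)) else 0"
  have m: "(\<Sum>k\<in>I. frag_cmul (?m k) (rt k)) = frag_cmul (cr j (w (rt i))) (rt j)"
    using ij finite_nodes by (subst sum.remove[of _ j]) auto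
  have "(\<Sum>k\<in>I. frag_cmul (int (c k) + int (d k) - ?m k) (rt k))
      = w (rt i) + - s j (w (rt i)) - frag_cmul (cr j (w (rt i))) (rt j)"
    unfolding d m[symmetric] by (subst c)
      (simp add: poly_mapping_eq_iff fun_eq_iff lookup_sum_cmul lookup_add lookup_minus
        sum.distrib sum_subtractf algebra_simps)
  also have "\<dots> = 0" by (simp add: srefl_def)
  finally have "int (c k) + int (d k) - ?m k = 0" if "k \<in> I" for k
    using roots_independent[of "\<lambda>k. int (c k) + int (d k) - ?m k"] that by simp
  then have c0: "c k = 0" if "k \<in> I" "k \<noteq> j" for k using that by force
  have c1: "w (rt i) = frag_cmul (int (c j)) (rt j)"
    unfolding c using ij finite_nodes c0 by (subst sum.remove[of _ j]) auto
  obtain c' where c': "\<And>\<mu>. cr i (iv w \<mu>) = (\<Sum>k\<in>I. int (c' k) * cr k \<mu>)"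
    using cr_pos[OF w ij(1) asc] by (auto simp: nonneg_cr_def)
  obtain d' where d': "\<And>\<mu>. - cr i (iv w (s j \<mu>)) = (\<Sum>k\<in>I. int (d' k) * cr k \<mu>)"
    using cr_neg[OF jw ij(1) desc] w ij by (auto simp: nonneg_cr_def inv_comp_weyl)
  let ?n = "\<lambda>k. if k = j then cr i (iv w (rt j)) else 0"
  have "(\<Sum>k\<in>I. (int (c' k) + int (d' k) - ?n k) * cr k \<mu>) = 0" for \<mu>
  proof -
    have "(\<Sum>k\<in>I. ?n k * cr k \<mu>) = cr i (iv w (rt j)) * cr j \<mu>"
      using ij finite_nodes by (subst sum.remove[of _ j]) auto
    moreover have "cr i (iv w (s j \<mu>)) = cr i (iv w \<mu>) - cr j \<mu> * cr i (iv w (rt j))"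
      using w ij by (simp add: srefl_def weyl_diff weyl_cmul cr_simps)
    ultimately show ?thesis using c'[of \<mu>] d'[of \<mu>]
      by (simp add: sum.distrib sum_subtractf algebra_simps)
  qed
  then have "int (c' k) + int (d' k) - ?n k = 0" if "k \<in> I" for k
    using coroots_independent[of "\<lambda>k. int (c' k) + int (d' k) - ?n k"] that by simp
  then have c0': "c' k = 0" if "k \<in> I" "k \<noteq> j" for k using that by force
  have c1': "cr i (iv w \<mu>) = int (c' j) * cr j \<mu>" for \<mu>
    unfolding c' using ij finite_nodes c0' by (subst sum.remove[of _ j]) auto
  \<comment> \<open>The root is \<open>c j\<close> times \<open>rt j\<close> and its coroot is
    \<open>c' j\<close> times \<open>cr j\<close>. Both pairings equal 2, so the product of the two
    natural numbers is 1.\<close>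
  have "2 = cr i (iv w (w (rt i)))" using w ij by (simp add: cartan_diag)
  also have "\<dots> = int (c' j) * (int (c j) * 2)" by (simp only: c1' c1) (simp add: cr_simps ij)
  finally have "int (c' j * c j) = int 1" by simp
  then have "c' j * c j = 1" by (simp only: of_nat_eq_iff)
  then have one: "c' j = 1" "c j = 1" by simp_all
  show ?thesis
    by (rule ext) (simp only: conj_srefl[OF w ij(1)] c1 c1' one, simp add: srefl_def)
qed

subsection \<open>Reflections and the strong exchange condition\<close>

definition reflection :: "('n weight \<Rightarrow> 'n weight) \<Rightarrow> bool" where
  "reflection t \<longleftrightarrow> (\<exists>w\<in>W. \<exists>i\<in>I. t = w \<circ> s i \<circ> iv w)"

lemma reflection_iff: "reflection t \<longleftrightarrow> (\<exists>\<beta>. coroot_refl D \<beta> t)"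
  by (auto simp: reflection_def coroot_refl_def)

lemma reflectionE:
  assumes "reflection t"
  obtains x i where "x \<in> W" "i \<in> I" "t = x \<circ> s i \<circ> iv x" "\<ell> x < \<ell> (x \<circ> s i)"
proof -
  obtain x i where x: "x \<in> W" "i \<in> I" "t = x \<circ> s i \<circ> iv x" using assms by (auto simp: reflection_def)
  show ?thesis
  proof (cases "\<ell> x < \<ell> (x \<circ> s i)")
    case False
    then have "\<ell> (x \<circ> s i) < \<ell> (x \<circ> s i \<circ> s i)" using len_rmult_neq[of x i] x by simp
    moreover have "t = (x \<circ> s i) \<circ> s i \<circ> iv (x \<circ> s i)"
      using x by (simp add: inv_comp_weyl) (simp add: o_assoc)
    ultimately show ?thesis using that[of "x \<circ> s i" i] x by simp
  qed (use that x in blast)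
qed

lemma reflection_weyl [simp]: "reflection t \<Longrightarrow> t \<in> W"
  by (auto simp: reflection_def)

lemma reflection_invol [simp]: "reflection t \<Longrightarrow> t \<circ> t = id"
  by (auto simp: reflection_def fun_eq_iff)

lemma reflection_conj: "reflection t \<Longrightarrow> v \<in> W \<Longrightarrow> reflection (v \<circ> t \<circ> iv v)"
  unfolding reflection_def
proof (elim bexE)
  fix w i assume "v \<in> W" "w \<in> W" "i \<in> I" "t = w \<circ> s i \<circ> iv w"
  then show "\<exists>w\<in>W. \<exists>i\<in>I. v \<circ> t \<circ> iv v = w \<circ> s i \<circ> iv w"
    by (intro bexI[of _ "v \<circ> w"] bexI[of _ i]) (simp_all add: inv_comp_weyl comp_assoc)
qed

lemma reflection_srefl: "i \<in> I \<Longrightarrow> reflection (s i)"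
  unfolding reflection_def by (intro bexI[of _ id] bexI[of _ i]) auto

text \<open>Reading the word from its right end, the positive root \<open>x (rt i)\<close> turns
  negative at some letter. By \<open>simple_conj\<close> that letter equals the reflection
  conjugated by the part already read, so applying the reflection amounts to deleting the
  letter.\<close>

lemma deletion:
  assumes x: "x \<in> W" "i \<in> I" "\<ell> x < \<ell> (x \<circ> s i)"
  shows "set u \<subseteq> I \<Longrightarrow> \<ell> (word_prod D u \<circ> x \<circ> s i) < \<ell> (word_prod D u \<circ> x)
    \<Longrightarrow> \<exists>a j b. u = a @ j # b \<and> word_prod D u \<circ> (x \<circ> s i \<circ> iv x) = word_prod D (a @ b)"
proof (induction u)
  case (Cons j u)
  show ?case
  proof (cases "\<ell> (word_prod D u \<circ> x \<circ> s i) < \<ell> (word_prod D u \<circ> x)")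
    case True
    then obtain a k b where "u = a @ k # b" "word_prod D u \<circ> (x \<circ> s i \<circ> iv x) = word_prod D (a @ b)"
      using Cons by (metis set_subset_Cons subset_trans)
    then show ?thesis by - (rule exI[of _ "j # a"], rule exI[of _ k], rule exI[of _ b], simp add: fun_eq_iff)
  next
    case False
    define y where "y = word_prod D u \<circ> x"
    have uW: "word_prod D u \<in> W" and y: "y \<in> W" using x Cons.prems weyl_word by (auto simp: y_def)
    have "\<ell> y < \<ell> (y \<circ> s i)" using False len_rmult_neq[OF y, of i] x by (simp add: y_def)
    moreover have "\<ell> (s j \<circ> y \<circ> s i) < \<ell> (s j \<circ> y)" using Cons.prems by (simp add: y_def o_def)
    ultimately have c: "y \<circ> s i \<circ> iv y = s j" using simple_conj[OF y] x Cons.prems by simp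
    have "word_prod D u \<circ> (x \<circ> s i \<circ> iv x) = y \<circ> s i \<circ> iv y \<circ> word_prod D u"
      using uW x by (simp add: y_def inv_comp_weyl fun_eq_iff)
    then have e: "word_prod D u \<circ> (x \<circ> s i \<circ> iv x) = s j \<circ> word_prod D u" by (simp only: c)
    have "word_prod D (j # u) \<circ> (x \<circ> s i \<circ> iv x) = s j \<circ> (word_prod D u \<circ> (x \<circ> s i \<circ> iv x))"
      by (simp add: comp_assoc)
    also have "\<dots> = word_prod D u" unfolding e using Cons.prems by simp
    finally have "j # u = [] @ j # u \<and> word_prod D (j # u) \<circ> (x \<circ> s i \<circ> iv x) = word_prod D ([] @ u)"
      by (simp only: append_Nil simp_thms)
    then show ?thesis by blast
  qed
qed (use x in simp)

lemma comp_reflection_cancel [simp]: "reflection t \<Longrightarrow> w \<circ> t \<circ> t = w"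
  by (simp add: comp_assoc)

text \<open>The sign of w applied to the root of t decides. If it is negative,
  \<open>deletion\<close> applies to every word of w. Otherwise it is negative for
  \<open>w \<circ> t\<close>, and the same argument makes w the shorter of the two.\<close>

lemma strong_exchange_aux:
  assumes "w \<in> W" "reflection t"
  shows "\<ell> (w \<circ> t) < \<ell> w \<and>
      (\<forall>u. set u \<subseteq> I \<longrightarrow> word_prod D u = w \<longrightarrow> (\<exists>a j b. u = a @ j # b \<and> w \<circ> t = word_prod D (a @ b)))
    \<or> \<ell> w < \<ell> (w \<circ> t)"
proof -
  obtain x i where x: "x \<in> W" "i \<in> I" "t = x \<circ> s i \<circ> iv x" "\<ell> x < \<ell> (x \<circ> s i)"
    using reflectionE[OF assms(2)] by blast
  have del: "\<exists>a j b. u = a @ j # b \<and> w \<circ> t = word_prod D (a @ b)"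
    if "set u \<subseteq> I" "word_prod D u = w" "\<ell> (w \<circ> x \<circ> s i) < \<ell> (w \<circ> x)" for u w
    using deletion[OF x(1,2,4) that(1)] that x by simp
  have short: "\<ell> (w \<circ> t) < \<ell> w" if w: "w \<in> W" "\<ell> (w \<circ> x \<circ> s i) < \<ell> (w \<circ> x)" for w
  proof -
    obtain u where u: "set u \<subseteq> I" "word_prod D u = w" "length u = \<ell> w" using w reduced_exists by blast
    then obtain a j b where "u = a @ j # b" "w \<circ> t = word_prod D (a @ b)" using del w by blast
    then show ?thesis using len_le[of "a @ b" "w \<circ> t"] u by auto
  qed
  show ?thesis
  proof (cases "\<ell> (w \<circ> x \<circ> s i) < \<ell> (w \<circ> x)")
    case True
    then show ?thesis using short del assms by blast
  next
    case False
    have wt: "w \<circ> t \<circ> x = w \<circ> x \<circ> s i" using x by (simp add: fun_eq_iff)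
    have "\<ell> (w \<circ> x \<circ> s i) \<noteq> \<ell> (w \<circ> x)" using len_rmult_neq assms x by simp
    then have "\<ell> (w \<circ> t \<circ> x \<circ> s i) < \<ell> (w \<circ> t \<circ> x)"
      unfolding wt comp_srefl_cancel[OF x(2)] using False by simp
    from short[OF _ this] show ?thesis using assms by simp
  qed
qed

lemma strong_exchange:
  assumes "set u \<subseteq> I" "reflection t" "\<ell> (word_prod D u \<circ> t) < \<ell> (word_prod D u)"
  obtains a j b where "u = a @ j # b" "word_prod D u \<circ> t = word_prod D (a @ b)"
  using strong_exchange_aux[OF weyl_word[OF assms(1)] assms(2)] assms by auto

lemma len_reflection_neq: "w \<in> W \<Longrightarrow> reflection t \<Longrightarrow> \<ell> (w \<circ> t) \<noteq> \<ell> w"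
  using strong_exchange_aux by fastforce

subsection \<open>Bruhat order and the lifting property\<close>

abbreviation ble (infix "\<preceq>" 50) where "v \<preceq> w \<equiv> bruhat_le D v w"

lemma ble_weyl: "v \<preceq> w \<Longrightarrow> v \<in> W" "v \<preceq> w \<Longrightarrow> w \<in> W"
  by (auto simp: bruhat_le_def)

lemma ble_refl [simp]: "v \<in> W \<Longrightarrow> v \<preceq> v"
  by (auto simp: bruhat_le_def)

lemma ble_trans [trans]: "u \<preceq> v \<Longrightarrow> v \<preceq> w \<Longrightarrow> u \<preceq> w"
  unfolding bruhat_le_def by (meson rtrancl_trans)

lemma ble_step: "x \<in> W \<Longrightarrow> reflection t \<Longrightarrow> \<ell> x < \<ell> (x \<circ> t) \<Longrightarrow> x \<preceq> x \<circ> t"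
  unfolding bruhat_le_def reflection_iff[symmetric] by (auto intro!: r_into_rtrancl)

lemma ble_induct [consumes 1, case_names base step]:
  assumes "x \<preceq> y" "P x"
    and "\<And>y t. x \<preceq> y \<Longrightarrow> P y \<Longrightarrow> reflection t \<Longrightarrow> \<ell> y < \<ell> (y \<circ> t) \<Longrightarrow> P (y \<circ> t)"
  shows "P y"
proof -
  let ?R = "{(x, x \<circ> t) |x t. x \<in> W \<and> (\<exists>\<beta>. coroot_refl D \<beta> t) \<and> \<ell> x < \<ell> (x \<circ> t)}"
  have "(x, y) \<in> ?R\<^sup>*" "x \<in> W" using assms(1) by (auto simp: bruhat_le_def)
  then have "x \<preceq> y \<and> P y"
  proof (induction rule: rtrancl_induct)
    case (step y z)
    then obtain t where t: "z = y \<circ> t" "y \<in> W" "reflection t" "\<ell> y < \<ell> (y \<circ> t)" by (auto simp: reflection_iff)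
    then show ?case using step ble_step assms(3) ble_trans by blast
  qed (use assms(2) in simp)
  then show ?thesis ..
qed

lemma ble_len: "x \<preceq> y \<Longrightarrow> x = y \<or> \<ell> x < \<ell> y"
  by (induct rule: ble_induct) (auto simp: o_def)

lemma ble_len_le: "x \<preceq> y \<Longrightarrow> \<ell> x \<le> \<ell> y"
  using ble_len by fastforce

lemma ble_antisym: "x \<preceq> y \<Longrightarrow> y \<preceq> x \<Longrightarrow> x = y"
  using ble_len[of x y] ble_len[of y x] by auto

lemma finite_below: "finite {z \<in> W. z \<preceq> w}"
  by (rule finite_subset[OF _ finite_len_le[of "\<ell> w"]]) (auto dest: ble_len_le)

text \<open>Inversion moves the reflection to the left, and conjugating it by y brings it back to
  the right.\<close>

lemma ble_inv: assumes "x \<preceq> y" shows "iv x \<preceq> iv y"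
  using assms
proof (induction rule: ble_induct)
  case base
  then show ?case using assms ble_weyl by simp
next
  case (step y t)
  have y: "y \<in> W" using step ble_weyl by blast
  have "iv t = t" using step by (simp add: inv_unique_comp)
  moreover define t' where "t' = y \<circ> t \<circ> iv y"
  ultimately have eq: "iv (y \<circ> t) = iv y \<circ> t'"
    using y step by (simp add: inv_comp_weyl fun_eq_iff)
  have "\<ell> (iv y) < \<ell> (iv (y \<circ> t))" using y step by simp
  then have "iv y \<preceq> iv (y \<circ> t)"
    unfolding eq using y step by (intro ble_step) (simp_all add: reflection_conj t'_def)
  then show ?case using step ble_trans by blast
qed

abbreviation asc where "asc i x \<equiv> \<ell> x < \<ell> (s i \<circ> x)"

lemma len_lmult_neq: assumes "w \<in> W" "i \<in> I" shows "\<ell> (s i \<circ> w) \<noteq> \<ell> w"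
  using len_rmult_neq[of "iv w" i] len_inv[of "s i \<circ> w"] assms by (simp add: inv_comp_weyl)

lemma len_lmult_le: "w \<in> W \<Longrightarrow> i \<in> I \<Longrightarrow> \<ell> (s i \<circ> w) \<le> \<ell> w + 1"
  using len_comp[of "s i" w] len_srefl_le[of i] by simp

lemma not_asc: "w \<in> W \<Longrightarrow> i \<in> I \<Longrightarrow> \<not> asc i w \<longleftrightarrow> asc i (s i \<circ> w)"
  using len_lmult_neq[of w i] by auto

lemma len_asc: assumes "w \<in> W" "i \<in> I" "asc i w" shows "\<ell> (s i \<circ> w) = \<ell> w + 1"
  using len_lmult_le[OF assms(1,2)] assms(3) by simp

lemma ble_asc: assumes "w \<in> W" "i \<in> I" "asc i w" shows "w \<preceq> s i \<circ> w"
proof -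
  define t where "t = iv w \<circ> s i \<circ> iv (iv w)"
  have eq: "s i \<circ> w = w \<circ> t" using assms by (simp add: t_def fun_eq_iff)
  have "reflection t" unfolding t_def using assms by (intro reflection_conj reflection_srefl) auto
  then show ?thesis using ble_step[of w t] assms by (simp add: eq)
qed

lemma ble_desc: assumes "w \<in> W" "i \<in> I" "\<not> asc i w" shows "s i \<circ> w \<preceq> w"
  using ble_asc[of "s i \<circ> w" i] not_asc assms by simp

text \<open>In the ascending case a failure would let the exchange condition delete a letter of the
  word \<open>i # u\<close>. Deleting i gives the excluded equation, and deleting a letter of u
  makes \<open>x \<circ> t\<close> shorter than x.\<close>

lemma step_lmult:
  assumes "x \<in> W" "reflection t" "\<ell> x < \<ell> (x \<circ> t)" "i \<in> I" "s i \<circ> x \<noteq> x \<circ> t"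
  shows "\<ell> (s i \<circ> x) < \<ell> (s i \<circ> x \<circ> t)"
proof (cases "asc i x")
  case False
  have "\<ell> (x \<circ> t) \<le> \<ell> (s i \<circ> (x \<circ> t)) + 1"
    using len_lmult_le[of "s i \<circ> (x \<circ> t)" i] assms by simp
  then show ?thesis using False len_lmult_neq[OF assms(1,4)] assms(3) by (simp add: comp_assoc)
next
  case True
  show ?thesis
  proof (rule ccontr)
    assume "\<not> ?thesis"
    then have lt: "\<ell> (s i \<circ> x \<circ> t) < \<ell> (s i \<circ> x)"
      using len_reflection_neq[of "s i \<circ> x" t] assms by simp
    obtain u where u: "set u \<subseteq> I" "word_prod D u = x" "length u = \<ell> x" using assms reduced_exists by blast
    obtain a j b where ab: "i # u = a @ j # b" "word_prod D (i # u) \<circ> t = word_prod D (a @ b)"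
      using strong_exchange[of "i # u" t] u assms lt by auto
    show False
    proof (cases a)
      case Nil
      then have "s i \<circ> (x \<circ> t) = x" using ab u by (simp add: comp_assoc)
      then have "s i \<circ> x = x \<circ> t" using assms(4) by (metis srefl_comp_left)
      then show False using assms by simp
    next
      case (Cons k a')
      then have "u = a' @ j # b" "s i \<circ> (x \<circ> t) = s i \<circ> word_prod D (a' @ b)" using ab u by (auto simp: comp_assoc)
      then have "x \<circ> t = word_prod D (a' @ b)" "length (a' @ b) < \<ell> x" "set (a' @ b) \<subseteq> I"
        using u assms(4) by (metis srefl_comp_left, auto)
      then show False using len_le[of "a' @ b" "x \<circ> t"] assms(3) by simp
    qed
  qed
qed

text \<open>The lifting property in a form free of descent conditions, which survives the addition
  of a Bruhat step. The only step that left multiplication fails to preserve leads from y to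
  \<open>s i \<circ> y\<close>, and there the two elements merely trade places.\<close>

lemma ble_lmult:
  assumes "x \<preceq> y" "i \<in> I"
  shows "(s i \<circ> x \<preceq> s i \<circ> y \<or> s i \<circ> x \<preceq> y) \<and> (s i \<circ> x \<preceq> s i \<circ> y \<or> x \<preceq> s i \<circ> y)"
  using assms(1)
proof (induction rule: ble_induct)
  case base
  have "s i \<circ> x \<preceq> s i \<circ> x" using assms ble_weyl by simp
  then show ?case by blast
next
  case (step y t)
  have y: "y \<in> W" using step ble_weyl by blast
  have le: "y \<preceq> y \<circ> t" using ble_step y step by blast
  show ?case
  proof (cases "s i \<circ> y = y \<circ> t")
    case True
    then have "s i \<circ> (y \<circ> t) = y" using assms by (metis srefl_comp_left)
    then show ?thesis using step True le ble_trans by metis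
  next
    case False
    have "s i \<circ> y \<preceq> s i \<circ> (y \<circ> t)"
      using ble_step[of "s i \<circ> y" t] step_lmult[OF y step(2,3) assms(2) False] y assms step
      by (simp add: comp_assoc)
    then show ?thesis using step le ble_trans by blast
  qed
qed

lemma lift_desc: assumes "x \<preceq> y" "i \<in> I" "\<not> asc i y" shows "s i \<circ> x \<preceq> y"
  using ble_lmult[OF assms(1,2)] ble_desc[of y i] assms ble_weyl ble_trans by blast

lemma lift_asc: assumes "x \<preceq> y" "i \<in> I" "asc i x" shows "x \<preceq> s i \<circ> y"
  using ble_lmult[OF assms(1,2)] ble_asc[of x i] assms ble_weyl ble_trans by blast

lemma lift_both: assumes "x \<preceq> y" "i \<in> I" "asc i x \<longleftrightarrow> asc i y" shows "s i \<circ> x \<preceq> s i \<circ> y"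
proof (cases "asc i y")
  case True
  have "x \<preceq> s i \<circ> y" using assms ble_asc[of y i] True ble_weyl ble_trans by blast
  moreover have "\<not> asc i (s i \<circ> y)" using True not_asc assms ble_weyl by blast
  ultimately show ?thesis using lift_desc assms by blast
next
  case False
  have "s i \<circ> x \<preceq> y" using lift_desc assms False by blast
  moreover have "asc i (s i \<circ> x)" using not_asc[of x i] assms False ble_weyl by blast
  ultimately show ?thesis using lift_asc assms by blast
qed

lemma comp_srefl_inv: "x \<in> W \<Longrightarrow> i \<in> I \<Longrightarrow> iv (s i \<circ> iv x) = x \<circ> s i" "x \<in> W \<Longrightarrow> i \<in> I \<Longrightarrow> \<ell> (s i \<circ> iv x) = \<ell> (x \<circ> s i)"
proof -
  assume "x \<in> W" "i \<in> I"
  then show *: "iv (s i \<circ> iv x) = x \<circ> s i" by (simp add: inv_comp_weyl)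
  show "\<ell> (s i \<circ> iv x) = \<ell> (x \<circ> s i)"
    unfolding *[symmetric] using \<open>x \<in> W\<close> \<open>i \<in> I\<close> by (subst len_inv) auto
qed

lemma lift_asc_right:
  assumes "x \<preceq> y" "i \<in> I" "\<ell> x < \<ell> (x \<circ> s i)"
  shows "x \<preceq> y \<circ> s i"
proof -
  have W: "x \<in> W" "y \<in> W" using assms ble_weyl by auto
  have "iv x \<preceq> s i \<circ> iv y"
    by (rule lift_asc) (use assms W ble_inv in \<open>simp_all add: comp_srefl_inv\<close>)
  from ble_inv[OF this] show ?thesis using W assms by (simp only: comp_srefl_inv inv_inv_weyl)
qed

lemma ble_desc_right: "x \<in> W \<Longrightarrow> i \<in> I \<Longrightarrow> \<ell> (x \<circ> s i) < \<ell> x \<Longrightarrow> x \<circ> s i \<preceq> x"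
  using ble_step[of "x \<circ> s i" "s i"] reflection_srefl by simp

subsection \<open>Covers\<close>

abbreviation cov (infix "\<lessdot>" 50) where "x \<lessdot> y \<equiv> bruhat_cover D x y"

lemma cov_le: "x \<lessdot> y \<Longrightarrow> x \<preceq> y" and cov_neq: "x \<lessdot> y \<Longrightarrow> x \<noteq> y"
  by (auto simp: bruhat_cover_def)

lemma cov_between: "x \<lessdot> y \<Longrightarrow> x \<preceq> z \<Longrightarrow> z \<preceq> y \<Longrightarrow> z = x \<or> z = y"
  by (auto simp: bruhat_cover_def)

lemma covI: "x \<preceq> y \<Longrightarrow> x \<noteq> y \<Longrightarrow> (\<And>z. x \<preceq> z \<Longrightarrow> z \<preceq> y \<Longrightarrow> z = x \<or> z = y) \<Longrightarrow> x \<lessdot> y"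
  by (auto simp: bruhat_cover_def)

lemma cov_weyl: "x \<lessdot> y \<Longrightarrow> x \<in> W" "x \<lessdot> y \<Longrightarrow> y \<in> W"
  using cov_le ble_weyl by blast+

lemma ble_first_step:
  assumes "x \<preceq> y" "x \<noteq> y"
  obtains t where "reflection t" "\<ell> x < \<ell> (x \<circ> t)" "x \<circ> t \<preceq> y"
proof -
  let ?R = "{(x, x \<circ> t) |x t. x \<in> W \<and> (\<exists>\<beta>. coroot_refl D \<beta> t) \<and> \<ell> x < \<ell> (x \<circ> t)}"
  have "(x, y) \<in> ?R\<^sup>*" "x \<in> W" "y \<in> W" using assms(1) by (auto simp: bruhat_le_def)
  then obtain z where "(x, z) \<in> ?R" "(z, y) \<in> ?R\<^sup>*" using assms(2) by (meson converse_rtranclE)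
  moreover from this obtain t where "z = x \<circ> t" "reflection t" "\<ell> x < \<ell> (x \<circ> t)" by (auto simp: reflection_iff)
  ultimately show ?thesis using that[of t] \<open>x \<in> W\<close> \<open>y \<in> W\<close> by (auto simp: bruhat_le_def)
qed

lemma cov_reflection: assumes "x \<lessdot> y" obtains t where "reflection t" "y = x \<circ> t"
proof -
  obtain t where t: "reflection t" "\<ell> x < \<ell> (x \<circ> t)" "x \<circ> t \<preceq> y"
    using ble_first_step cov_le cov_neq assms by blast
  have "x \<preceq> x \<circ> t" using ble_step t assms cov_weyl by blast
  then have "x \<circ> t = x \<or> x \<circ> t = y" using cov_between assms t by blast
  then show ?thesis using that t by auto
qed

lemma cov_asc: assumes "y \<in> W" "i \<in> I" "asc i y" shows "y \<lessdot> s i \<circ> y"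
proof (rule covI)
  show "y \<preceq> s i \<circ> y" "y \<noteq> s i \<circ> y" using ble_asc assms by auto
  fix z assume "y \<preceq> z" "z \<preceq> s i \<circ> y"
  then show "z = y \<or> z = s i \<circ> y" using ble_len[of y z] ble_len[of z "s i \<circ> y"] len_asc[OF assms] by auto
qed

lemma cov_turn:
  assumes "x \<lessdot> y" "i \<in> I" "asc i x" "\<not> asc i y"
  shows "y = s i \<circ> x"
proof -
  have "s i \<circ> x \<preceq> y" using lift_desc cov_le assms by blast
  moreover have "x \<preceq> s i \<circ> x" "s i \<circ> x \<noteq> x" using ble_asc assms cov_weyl by auto
  ultimately show ?thesis using cov_between assms by blast
qed

lemma srefl_cancel_left: "i \<in> I \<Longrightarrow> s i \<circ> x = s i \<circ> y \<longleftrightarrow> x = y"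
  by (metis srefl_comp_left)

text \<open>If an intermediate z goes the other way at i than x, multiplication by
  \<open>s i\<close> moves it between x and y. If it goes the same way, lifting places z itself
  between x and y, which the cover turns into a contradiction.\<close>

lemma cov_lmult:
  assumes c: "x \<lessdot> y" and i: "i \<in> I" and same: "asc i x \<longleftrightarrow> asc i y"
  shows "s i \<circ> x \<lessdot> s i \<circ> y"
proof (rule covI)
  have W: "x \<in> W" "y \<in> W" using c cov_weyl by auto
  show "s i \<circ> x \<preceq> s i \<circ> y" using lift_both cov_le c i same by blast
  show "s i \<circ> x \<noteq> s i \<circ> y" using cov_neq[OF c] i by (simp add: srefl_cancel_left)
  fix z assume z: "s i \<circ> x \<preceq> z" "z \<preceq> s i \<circ> y"
  then have zW: "z \<in> W" using ble_weyl by blast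
  have ne: "y \<noteq> s i \<circ> x" using same not_asc[of x i] W i by auto
  show "z = s i \<circ> x \<or> z = s i \<circ> y"
  proof (cases "asc i z \<longleftrightarrow> asc i x")
    case False
    have "asc i z \<longleftrightarrow> asc i (s i \<circ> x)" "asc i (s i \<circ> y) \<longleftrightarrow> asc i z"
      using False same not_asc W i by blast+
    then have "s i \<circ> (s i \<circ> x) \<preceq> s i \<circ> z" "s i \<circ> z \<preceq> s i \<circ> (s i \<circ> y)" using lift_both z i by blast+
    then have "s i \<circ> z = x \<or> s i \<circ> z = y" using cov_between[OF c] i by simp
    then show ?thesis using i by (metis srefl_comp_left)
  next
    case True
    show ?thesis
    proof (cases "asc i x")
      case asc: True
      have "z \<preceq> y" using lift_asc[OF z(2) i] True asc i by simp
      moreover have "x \<preceq> z" using lift_desc[OF z(1) i] z True asc ble_asc W i ble_trans by blast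
      ultimately have "z = x \<or> z = y" using cov_between c by blast
      then show ?thesis
      proof
        assume "z = x"
        then show ?thesis using z(1) asc ble_len_le by fastforce
      next
        assume "z = y"
        then have "x \<preceq> s i \<circ> x" "s i \<circ> x \<preceq> y" using z ble_asc asc W i by auto
        then have "s i \<circ> x = x \<or> s i \<circ> x = y" using cov_between[OF c] by blast
        then show ?thesis using ne asc by auto
      qed
    next
      case desc: False
      have nz: "\<not> asc i z" "\<not> asc i y" using desc True same by auto
      have "x \<preceq> z" using lift_desc[OF z(1) i nz(1)] i by simp
      moreover have sy: "s i \<circ> y \<preceq> y" using ble_desc W i nz by blast
      ultimately have "z = x \<or> z = y" using cov_between c z ble_trans by blast
      then show ?thesis
      proof
        assume "z = x"
        then have "s i \<circ> y = x \<or> s i \<circ> y = y" using cov_between[OF c] z sy by blast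
        then show ?thesis using ne i len_lmult_neq[of y i] W by (metis srefl_comp_left)
      next
        assume "z = y"
        then show ?thesis using z(2) nz ble_len_le[of y "s i \<circ> y"] len_lmult_neq[of y i] W i by simp
      qed
    qed
  qed
qed

lemma cov_inv: assumes "x \<lessdot> y" shows "iv x \<lessdot> iv y"
proof (rule covI)
  have W: "x \<in> W" "y \<in> W" using assms cov_weyl by auto
  show "iv x \<preceq> iv y" using ble_inv cov_le assms by blast
  show "iv x \<noteq> iv y" using cov_neq[OF assms] W by (metis inv_inv_weyl)
  fix z assume z: "iv x \<preceq> z" "z \<preceq> iv y"
  then have zW: "z \<in> W" using ble_weyl by blast
  then have "x \<preceq> iv z" "iv z \<preceq> y" using ble_inv[OF z(1)] ble_inv[OF z(2)] W by auto
  then have "iv z = x \<or> iv z = y" using cov_between assms by blast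
  then show "z = iv x \<or> z = iv y" using zW by (metis inv_inv_weyl)
qed

lemma cov_rmult:
  assumes c: "x \<lessdot> y" and i: "i \<in> I" and d: "\<ell> (x \<circ> s i) < \<ell> x" "\<ell> (y \<circ> s i) < \<ell> y"
  shows "x \<circ> s i \<lessdot> y \<circ> s i"
proof -
  have W: "x \<in> W" "y \<in> W" using c cov_weyl by auto
  have "s i \<circ> iv x \<lessdot> s i \<circ> iv y"
    by (rule cov_lmult) (use cov_inv[OF c] i W d in \<open>simp_all add: comp_srefl_inv\<close>)
  from cov_inv[OF this] show ?thesis using W i by (simp only: comp_srefl_inv)
qed

lemma last_descent: assumes "u \<in> W" "u \<noteq> id" obtains j where "j \<in> I" "\<ell> (u \<circ> s j) < \<ell> u"
proof -
  obtain a where a: "set a \<subseteq> I" "word_prod D a = u" "length a = \<ell> u" using assms reduced_exists by blast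
  then obtain b j where b: "a = b @ [j]" using assms by (cases a rule: rev_cases) auto
  then have "word_prod D b = u \<circ> s j" using a by auto
  then have "\<ell> (u \<circ> s j) < \<ell> u" using len_le[of b "u \<circ> s j"] a b by simp
  moreover have "j \<in> I" using a b by simp
  ultimately show ?thesis using that by blast
qed

lemma first_descent: assumes "u \<in> W" "u \<noteq> id" obtains j where "j \<in> I" "\<not> asc j u"
proof -
  have "iv u \<noteq> id" using assms by (metis inv_id inv_inv_weyl)
  then obtain j where j: "j \<in> I" "\<ell> (iv u \<circ> s j) < \<ell> (iv u)" using last_descent[of "iv u"] assms by auto
  then have "\<not> asc j u" using comp_srefl_inv(2)[of "iv u" j] assms by simp
  then show ?thesis using that j by blast
qed

end

locale dominant_datum = kac_moody_datum D
  for D :: "('i, 'n::{finite,linorder}) root_datum" +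
  fixes lam :: "'n weight"
  assumes dom: "dominant D lam"
begin

subsection \<open>Cosets of the stabilizer and minimal representatives\<close>

abbreviation h where "h i y \<equiv> cr i (y lam)"

lemma dom': "i \<in> I \<Longrightarrow> cr i lam \<ge> 0"
  using dom by (auto simp: dominant_def)

lemma nonneg_cr_lam: "nonneg_cr \<beta> \<Longrightarrow> \<beta> lam \<ge> 0"
  by (auto simp: nonneg_cr_def intro!: sum_nonneg mult_nonneg_nonneg dom')

lemma h_asc: assumes "y \<in> W" "i \<in> I" "asc i y" shows "h i y \<ge> 0"
proof -
  have "\<ell> (iv y \<circ> s i) = \<ell> (s i \<circ> y)" using comp_srefl_inv(2)[of "iv y" i] assms by simp
  then have "nonneg_cr (cr i \<circ> iv (iv y))" using cr_pos[of "iv y" i] assms by simp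
  from nonneg_cr_lam[OF this] show ?thesis using assms by simp
qed

lemma h_srefl [simp]: "i \<in> I \<Longrightarrow> h i (s i \<circ> y) = - h i y"
  by (simp add: cr_srefl)

lemma h_desc: assumes "y \<in> W" "i \<in> I" "\<not> asc i y" shows "h i y \<le> 0"
  using h_asc[of "s i \<circ> y" i] not_asc[of y i] assms h_srefl[of i y] by simp

lemma h_pos_asc: "y \<in> W \<Longrightarrow> i \<in> I \<Longrightarrow> h i y > 0 \<Longrightarrow> asc i y"
  using h_desc by fastforce

lemma h_neg_desc: "y \<in> W \<Longrightarrow> i \<in> I \<Longrightarrow> h i y < 0 \<Longrightarrow> \<not> asc i y"
  using h_asc by fastforce

lemma h_0_fix: "h i y = 0 \<Longrightarrow> (s i \<circ> y) lam = y lam"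
  by (simp add: srefl_def)

lemma coset_eq: assumes "x \<in> W" shows "coset D lam x = {y \<in> W. y lam = x lam}"
proof -
  have "y \<in> coset D lam x" if "y \<in> W" "y lam = x lam" for y
  proof -
    have "iv x \<circ> y \<in> stab D lam" using that assms by (simp add: stab_def)
    moreover have "y = x \<circ> (iv x \<circ> y)" using assms by (simp add: fun_eq_iff)
    ultimately show ?thesis unfolding coset_def by blast
  qed
  then show ?thesis using assms by (auto simp: coset_def stab_def)
qed

lemma coset_eq_iff: "x \<in> W \<Longrightarrow> y \<in> W \<Longrightarrow> coset D lam x = coset D lam y \<longleftrightarrow> x lam = y lam"
  by (auto simp: coset_eq)

abbreviation mr where "mr x \<equiv> minrep D (coset D lam x)"

definition jmin :: "('n weight \<Rightarrow> 'n weight) \<Rightarrow> bool" where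
  "jmin x \<longleftrightarrow> x \<in> W \<and> (\<forall>j\<in>I. cr j lam = 0 \<longrightarrow> \<ell> x < \<ell> (x \<circ> s j))"

lemma srefl_lam: "cr j lam = 0 \<Longrightarrow> s j lam = lam"
  by (simp add: srefl_def)

lemma mr_weyl [simp]: "x \<in> W \<Longrightarrow> mr x \<in> W" and mr_lam [simp]: "x \<in> W \<Longrightarrow> mr x lam = x lam"
  and mr_len: "x \<in> W \<Longrightarrow> y \<in> W \<Longrightarrow> y lam = x lam \<Longrightarrow> \<ell> (mr x) \<le> \<ell> y"
proof -
  assume x: "x \<in> W"
  have "mr x \<in> coset D lam x"
    unfolding minrep_def arg_min_on_def by (rule arg_min_natI[of _ x]) (simp add: coset_eq x)
  then show "mr x \<in> W" "mr x lam = x lam" using x by (auto simp: coset_eq)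
  assume "y \<in> W" "y lam = x lam"
  then show "\<ell> (mr x) \<le> \<ell> y"
    unfolding minrep_def arg_min_on_def using x
    by (intro arg_min_nat_le[where P = "\<lambda>z. z \<in> coset D lam x" and m = \<ell>]) (simp add: coset_eq)
qed

lemma mr_cong: "x \<in> W \<Longrightarrow> y \<in> W \<Longrightarrow> x lam = y lam \<Longrightarrow> mr x = mr y"
  using coset_eq_iff by metis

lemma jmin_mr: assumes "x \<in> W" shows "jmin (mr x)"
  unfolding jmin_def
proof (intro conjI ballI impI)
  fix j assume j: "j \<in> I" "cr j lam = 0"
  have "\<ell> (mr x) \<le> \<ell> (mr x \<circ> s j)" using assms j by (intro mr_len) (auto simp: srefl_lam)
  then show "\<ell> (mr x) < \<ell> (mr x \<circ> s j)" using len_rmult_neq[of "mr x" j] assms j by simp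
qed (use assms in simp)

lemma nonneg_cr_sum:
  assumes "\<And>k. k \<in> A \<Longrightarrow> c k = 0 \<or> nonneg_cr (\<beta> k)"
  shows "nonneg_cr (\<lambda>\<mu>. \<Sum>k\<in>A. int (c k :: nat) * \<beta> k \<mu>)"
  using assms
proof (induction A rule: infinite_finite_induct)
  case (insert a A)
  obtain d where d: "\<And>\<mu>. (\<Sum>k\<in>A. int (c k) * \<beta> k \<mu>) = (\<Sum>i\<in>I. int (d i) * cr i \<mu>)"
    using insert by (auto simp: nonneg_cr_def)
  show ?case
  proof (cases "c a = 0")
    case True
    then show ?thesis using d insert unfolding nonneg_cr_def by auto
  next
    case False
    then have "nonneg_cr (\<beta> a)" using insert.prems[of a] by simp
    then obtain f where f: "\<And>\<mu>. \<beta> a \<mu> = (\<Sum>i\<in>I. int (f i) * cr i \<mu>)" unfolding nonneg_cr_def by blast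
    show ?thesis unfolding nonneg_cr_def
      by (rule exI[of _ "\<lambda>i. c a * f i + d i"])
         (use insert d f in \<open>simp add: sum.distrib sum_distrib_left algebra_simps\<close>)
  qed
qed (auto simp: nonneg_cr_def intro: exI[of _ "\<lambda>_. 0"])

text \<open>Let u be the quotient of x and y and j a right descent of u. The expansion
  \<open>c\<close>, evaluated at \<open>lam\<close>, is a sum of nonnegative terms with nonpositive
  value, so j fixes \<open>lam\<close> and only coroots orthogonal to \<open>lam\<close> occur.
  Minimality of x sends these to positive coroots, hence y descends at j, against its own
  minimality.\<close>

lemma jmin_unique: assumes x: "jmin x" and y: "jmin y" and eq: "x lam = y lam" shows "x = y"
proof (rule ccontr)
  assume ne: "x \<noteq> y"
  have W: "x \<in> W" "y \<in> W" using x y by (auto simp: jmin_def)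
  define u where "u = iv x \<circ> y"
  have uW: "u \<in> W" using W by (simp add: u_def)
  have yu: "y = x \<circ> u" using W by (simp add: u_def fun_eq_iff)
  have "u \<noteq> id" using yu ne by auto
  then obtain j where j: "j \<in> I" "\<ell> (u \<circ> s j) < \<ell> u" using last_descent uW by blast
  obtain c where c: "\<And>\<mu>. - cr j (iv u \<mu>) = (\<Sum>k\<in>I. int (c k) * cr k \<mu>)"
    using cr_neg[OF uW j] by (auto simp: nonneg_cr_def)
  have ul: "u lam = lam" using W eq by (simp add: u_def eq[symmetric])
  then have iul: "iv u lam = lam" using uW by (metis weyl_inv_ap(1))
  have nn: "\<And>k. k \<in> I \<Longrightarrow> 0 \<le> int (c k) * cr k lam" using dom' by simp
  have "(\<Sum>k\<in>I. int (c k) * cr k lam) = - cr j lam" using c[of lam] iul by simp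
  moreover have "(\<Sum>k\<in>I. int (c k) * cr k lam) \<ge> 0" using nn by (rule sum_nonneg)
  ultimately have j0: "cr j lam = 0" and "(\<Sum>k\<in>I. int (c k) * cr k lam) = 0" using dom'[OF j(1)] by auto
  then have c0: "int (c k) * cr k lam = 0" if "k \<in> I" for k
    using sum_nonneg_eq_0_iff[OF finite_nodes, of "\<lambda>k. int (c k) * cr k lam"] nn that by blast
  have "nonneg_cr (\<lambda>\<mu>. \<Sum>k\<in>I. int (c k) * (cr k \<circ> iv x) \<mu>)"
  proof (rule nonneg_cr_sum)
    fix k assume k: "k \<in> I"
    show "c k = 0 \<or> nonneg_cr (cr k \<circ> iv x)"
      using c0[OF k] cr_pos[OF W(1) k] x k by (auto simp: jmin_def)
  qed
  moreover have "(\<lambda>\<mu>. - cr j (iv y \<mu>)) = (\<lambda>\<mu>. \<Sum>k\<in>I. int (c k) * (cr k \<circ> iv x) \<mu>)"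
    using c W uW by (simp add: yu inv_comp_weyl)
  ultimately have "\<ell> (y \<circ> s j) < \<ell> y" using cr_neg_iff[OF W(2) j(1)] by simp
  then show False using y j j0 by (auto simp: jmin_def)
qed

lemma mr_eqI: "x \<in> W \<Longrightarrow> jmin y \<Longrightarrow> y lam = x lam \<Longrightarrow> mr x = y"
  using jmin_unique[OF jmin_mr] by simp

text \<open>A positive pairing makes every member of the coset ascend at i, so left multiplication
  raises all lengths by one and preserves their comparison.\<close>

lemma mr_srefl_pos:
  assumes "x \<in> W" "i \<in> I" "h i x > 0" shows "mr (s i \<circ> x) = s i \<circ> mr x"
proof (rule mr_eqI)
  show "jmin (s i \<circ> mr x)"
    unfolding jmin_def
  proof (intro conjI ballI impI)
    fix j assume j: "j \<in> I" "cr j lam = 0"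
    have "asc i (mr x)" "asc i (mr x \<circ> s j)"
      by (rule h_pos_asc; use assms j in \<open>simp add: srefl_lam\<close>)+
    then have "\<ell> (s i \<circ> mr x) = \<ell> (mr x) + 1" "\<ell> (s i \<circ> (mr x \<circ> s j)) = \<ell> (mr x \<circ> s j) + 1"
      using len_asc assms j by simp_all
    moreover have "\<ell> (mr x) < \<ell> (mr x \<circ> s j)" using jmin_mr[OF assms(1)] j by (auto simp: jmin_def)
    ultimately show "\<ell> (s i \<circ> mr x) < \<ell> (s i \<circ> mr x \<circ> s j)" by (simp add: comp_assoc)
  qed (use assms in simp)
qed (use assms in simp_all)

lemma mr_srefl: assumes "x \<in> W" "i \<in> I" "h i x \<noteq> 0" shows "mr (s i \<circ> x) = s i \<circ> mr x"
proof (cases "h i x > 0")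
  case False
  then have "h i (s i \<circ> x) > 0" using assms h_srefl[of i x] by simp
  then have "mr (s i \<circ> (s i \<circ> x)) = s i \<circ> mr (s i \<circ> x)" using assms by (intro mr_srefl_pos) auto
  then show ?thesis using assms by simp
qed (use mr_srefl_pos assms in blast)

lemma mr_srefl_0: "x \<in> W \<Longrightarrow> i \<in> I \<Longrightarrow> h i x = 0 \<Longrightarrow> mr (s i \<circ> x) = mr x"
  by (intro mr_cong) (auto simp: srefl_def)

text \<open>Where the pairing vanishes the coset is stable under \<open>s i\<close>, so its shortest
  element ascends. This is why the value 0 sides with the positive values here and in the lifting
  rules for \<open>cle\<close>.\<close>

lemma asc_mr: assumes "x \<in> W" "i \<in> I" shows "asc i (mr x) \<longleftrightarrow> h i x \<ge> 0"
proof (cases "h i x = 0")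
  case True
  then have "\<ell> (mr x) \<le> \<ell> (s i \<circ> mr x)" using assms by (intro mr_len) (auto simp: srefl_def)
  then show ?thesis using len_lmult_neq[of "mr x" i] assms True by simp
next
  case False
  then show ?thesis using h_asc[of "mr x" i] h_desc[of "mr x" i] assms by (cases "asc i (mr x)") auto
qed

end

context kac_moody_datum
begin

subsection \<open>Rational multiples in the root lattice\<close>

text \<open>The rational multiple of the weight by b lies in the root lattice, with the denominator
  cleared because weights have integer coordinates.\<close>

definition in_root_lattice :: "rat \<Rightarrow> 'n weight \<Rightarrow> bool" where
  "in_root_lattice b \<mu> \<longleftrightarrow> (\<exists>c :: 'i \<Rightarrow> int. frag_cmul (fst (quotient_of b)) \<mu>
     = frag_cmul (snd (quotient_of b)) (\<Sum>j\<in>I. frag_cmul (c j) (rt j)))"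

lemma rat_mult_int_iff:
  "b * of_int m \<in> \<int> \<longleftrightarrow> snd (quotient_of b) dvd fst (quotient_of b) * m"
proof -
  obtain p q where pq: "quotient_of b = (p, q)" by force
  have q: "q > 0" using quotient_of_denom_pos[OF pq] .
  have b: "b = of_int p / of_int q" using quotient_of_div[OF pq] .
  have "b * of_int m = of_int (p * m) / of_int q" by (simp add: b)
  moreover have "of_int (p * m) / (of_int q :: rat) \<in> \<int> \<longleftrightarrow> q dvd p * m"
    using q of_int_div_of_int_in_Ints_iff[of "p * m" q, where 'a = rat] by auto
  ultimately show ?thesis using pq by simp
qed

lemma in_root_lattice_add:
  assumes "in_root_lattice b \<mu>" "in_root_lattice b \<nu>" shows "in_root_lattice b (\<mu> + \<nu>)"
proof -
  obtain c d where c: "frag_cmul (fst (quotient_of b)) \<mu> = frag_cmul (snd (quotient_of b)) (\<Sum>j\<in>I. frag_cmul (c j) (rt j))"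
    and d: "frag_cmul (fst (quotient_of b)) \<nu> = frag_cmul (snd (quotient_of b)) (\<Sum>j\<in>I. frag_cmul (d j) (rt j))"
    using assms by (auto simp: in_root_lattice_def)
  have "frag_cmul (fst (quotient_of b)) (\<mu> + \<nu>)
    = frag_cmul (snd (quotient_of b)) (\<Sum>j\<in>I. frag_cmul (c j + d j) (rt j))"
    by (simp add: frag_cmul_distrib2 c d frag_cmul_distrib sum.distrib)
  then show ?thesis unfolding in_root_lattice_def by (rule exI[of _ "\<lambda>j. c j + d j"])
qed

lemma in_root_lattice_cmul:
  assumes "b * of_int m \<in> \<int>" "\<gamma> = (\<Sum>j\<in>I. frag_cmul (c j) (rt j))"
  shows "in_root_lattice b (frag_cmul m \<gamma>)"
proof -
  obtain k where k: "fst (quotient_of b) * m = snd (quotient_of b) * k"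
    using assms(1) by (auto simp: rat_mult_int_iff)
  have "frag_cmul (fst (quotient_of b)) (frag_cmul m \<gamma>)
    = frag_cmul (snd (quotient_of b)) (\<Sum>j\<in>I. frag_cmul (k * c j) (rt j))"
    unfolding assms(2) by (simp add: frag_cmul_sum k flip: mult.assoc)
  then show ?thesis unfolding in_root_lattice_def by (rule exI[of _ "\<lambda>j. k * c j"])
qed

lemma in_root_lattice_cr:
  assumes "in_root_lattice b \<mu>" "i \<in> I" shows "b * of_int (cr i \<mu>) \<in> \<int>"
proof -
  obtain c where "frag_cmul (fst (quotient_of b)) \<mu> = frag_cmul (snd (quotient_of b)) (\<Sum>j\<in>I. frag_cmul (c j) (rt j))"
    using assms by (auto simp: in_root_lattice_def)
  from arg_cong[OF this, of "cr i"] show ?thesis using assms(2)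
    by (simp add: cr_cmul rat_mult_int_iff)
qed

text \<open>Independence of the simple roots lets the coefficient of \<open>rt i\<close> be read
  off. For the cover from x to \<open>s i \<circ> x\<close> this recovers the integrality condition
  from the difference of weights alone.\<close>

lemma in_root_lattice_rt:
  assumes "in_root_lattice b (frag_cmul m (rt i))" "i \<in> I" shows "b * of_int m \<in> \<int>"
proof -
  obtain c where c: "frag_cmul (fst (quotient_of b)) (frag_cmul m (rt i))
      = frag_cmul (snd (quotient_of b)) (\<Sum>j\<in>I. frag_cmul (c j) (rt j))"
    using assms by (auto simp: in_root_lattice_def)
  let ?e = "\<lambda>j. snd (quotient_of b) * c j - (if j = i then fst (quotient_of b) * m else 0)"
  have "(\<Sum>j\<in>I. frag_cmul (if j = i then fst (quotient_of b) * m else 0) (rt j))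
    = frag_cmul (fst (quotient_of b)) (frag_cmul m (rt i))"
    using assms(2) finite_nodes by (subst sum.remove[of _ i]) auto
  then have "(\<Sum>j\<in>I. frag_cmul (?e j) (rt j)) = 0"
    using c by (simp add: poly_mapping_eq_iff fun_eq_iff lookup_sum_cmul lookup_frag_cmul
        left_diff_distrib sum_subtractf sum_distrib_left mult.assoc)
  then have "?e i = 0" using roots_independent[of ?e i] assms(2) by blast
  then have "fst (quotient_of b) * m = snd (quotient_of b) * c i" by simp
  then show ?thesis by (simp add: rat_mult_int_iff)
qed

lemma real_root_combination:
  assumes "w \<in> W" "i \<in> I" obtains c :: "'i \<Rightarrow> int" where "w (rt i) = (\<Sum>j\<in>I. frag_cmul (c j) (rt j))"
proof (cases "\<ell> w < \<ell> (w \<circ> s i)")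
  case True
  then show ?thesis using rt_pos[OF assms] that unfolding nonneg_rt_def by metis
next
  case False
  then have "\<ell> (w \<circ> s i) < \<ell> w" using len_rmult_neq[OF assms] by simp
  then obtain c :: "'i \<Rightarrow> nat" where c: "- w (rt i) = (\<Sum>j\<in>I. frag_cmul (int (c j)) (rt j))"
    using rt_neg[OF assms] unfolding nonneg_rt_def by metis
  have "w (rt i) = (\<Sum>j\<in>I. frag_cmul (- int (c j)) (rt j))"
    using arg_cong[OF c, of uminus] by (simp add: poly_mapping_eq_iff fun_eq_iff lookup_sum_cmul sum_negf)
  then show ?thesis by (rule that)
qed

end

context dominant_datum
begin

subsection \<open>Chains of covers satisfying an integrality condition\<close>

definition bst :: "rat \<Rightarrow> (('n weight \<Rightarrow> 'n weight) \<times> ('n weight \<Rightarrow> 'n weight)) set" where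
  "bst b = {(x, x \<circ> t) |x t. x \<lessdot> x \<circ> t \<and>
     (\<exists>\<beta>. coroot_refl D \<beta> t \<and> pos_real_coroot D \<beta> \<and> b * of_int (\<beta> lam) \<in> \<int>)}"

abbreviation bch where "bch b x y \<equiv> (x, y) \<in> (bst b)\<^sup>*"

text \<open>The definition asks for a positive coroot. If the given one is negative,
  \<open>w \<circ> s i\<close> yields the same reflection with the opposite coroot, and integrality
  is insensitive to the sign.\<close>

lemma bstI:
  assumes c: "x \<lessdot> y" and y: "y = x \<circ> (w \<circ> s i \<circ> iv w)" and w: "w \<in> W" "i \<in> I"
    and b: "b * of_int (cr i (iv w lam)) \<in> \<int>"
  shows "(x, y) \<in> bst b"
proof -
  let ?t = "w \<circ> s i \<circ> iv w"
  have "\<exists>\<beta>. coroot_refl D \<beta> ?t \<and> pos_real_coroot D \<beta> \<and> b * of_int (\<beta> lam) \<in> \<int>"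
  proof (cases "\<ell> w < \<ell> (w \<circ> s i)")
    case True
    let ?\<beta> = "cr i \<circ> iv w"
    have "coroot_refl D ?\<beta> ?t" using w by (auto simp: coroot_refl_def)
    moreover have "pos_real_coroot D ?\<beta>"
      unfolding pos_real_coroot_def using cr_pos[OF w True] w unfolding nonneg_cr_def by blast
    ultimately show ?thesis using b by (intro exI[of _ ?\<beta>]) simp
  next
    case False
    let ?v = "w \<circ> s i"
    let ?\<beta> = "cr i \<circ> iv ?v"
    have v: "?v \<in> W" using w by simp
    have "\<ell> ?v < \<ell> (?v \<circ> s i)" using False len_rmult_neq[OF w] w by simp
    then have "nonneg_cr ?\<beta>" using cr_pos[OF v w(2)] by blast
    then have "pos_real_coroot D ?\<beta>"
      unfolding pos_real_coroot_def using v w unfolding nonneg_cr_def by blast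
    moreover have "?t = ?v \<circ> s i \<circ> iv ?v" using w by (simp add: inv_comp_weyl fun_eq_iff)
    then have "coroot_refl D ?\<beta> ?t" using v w unfolding coroot_refl_def by blast
    moreover have "?\<beta> lam = - cr i (iv w lam)" using w by (simp add: inv_comp_weyl cr_srefl)
    then have "b * of_int (?\<beta> lam) \<in> \<int>" using b by (simp only: of_int_minus mult_minus_right Ints_minus)
    ultimately show ?thesis by blast
  qed
  then show ?thesis unfolding bst_def using c y by blast
qed

lemma bstE:
  assumes "(x, y) \<in> bst b"
  obtains w i where "x \<lessdot> y" "w \<in> W" "i \<in> I" "y = x \<circ> (w \<circ> s i \<circ> iv w)" "b * of_int (cr i (iv w lam)) \<in> \<int>"
  using assms unfolding bst_def coroot_refl_def by force

lemma bst_cov: "(x, y) \<in> bst b \<Longrightarrow> x \<lessdot> y"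
  by (erule bstE)

text \<open>The difference is a real root times the pairing of a coroot with \<open>lam\<close>, and
  b times that pairing is an integer. Summed along chains, this later makes endpoints
  integral.\<close>

lemma bst_lattice: assumes "(x, y) \<in> bst b" shows "in_root_lattice b (x lam - y lam)"
proof -
  obtain w i where w: "x \<lessdot> y" "w \<in> W" "i \<in> I" "y = x \<circ> (w \<circ> s i \<circ> iv w)" "b * of_int (cr i (iv w lam)) \<in> \<int>"
    using assms by (rule bstE)
  have x: "x \<in> W" using cov_weyl w by blast
  obtain c where c: "(x \<circ> w) (rt i) = (\<Sum>j\<in>I. frag_cmul (c j) (rt j))"
    using real_root_combination[of "x \<circ> w" i] x w by auto
  have "y lam = x lam - frag_cmul (cr i (iv w lam)) ((x \<circ> w) (rt i))"
    using conj_srefl[OF w(2,3), of lam] x by (simp add: w(4) weyl_diff weyl_cmul)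
  then have "x lam - y lam = frag_cmul (cr i (iv w lam)) ((x \<circ> w) (rt i))" by simp
  then show ?thesis using in_root_lattice_cmul[OF w(5) c] by simp
qed

lemma in_root_lattice_0 [simp]: "in_root_lattice b 0"
  unfolding in_root_lattice_def by (intro exI[of _ "\<lambda>_. 0"]) simp

lemma bch_lattice: "bch b x y \<Longrightarrow> in_root_lattice b (x lam - y lam)"
proof (induction rule: rtrancl_induct)
  case (step y z)
  then show ?case using in_root_lattice_add[OF step(3) bst_lattice[OF step(2)]] by simp
qed simp

lemma bch_h_diff: assumes "bch b x y" "i \<in> I" shows "b * of_int (h i x - h i y) \<in> \<int>"
  using in_root_lattice_cr[OF bch_lattice[OF assms(1)] assms(2)] assms(2) by (simp only: cr_diff)

lemma bch_h_iff: assumes "bch b x y" "i \<in> I" shows "b * of_int (h i x) \<in> \<int> \<longleftrightarrow> b * of_int (h i y) \<in> \<int>"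
proof -
  have e: "b * of_int (h i x) = b * of_int (h i x - h i y) + b * of_int (h i y)"
    by (simp add: algebra_simps)
  have "b * of_int (h i y) = b * of_int (h i x) - b * of_int (h i x - h i y)" by (simp add: algebra_simps)
  then show ?thesis using bch_h_diff[OF assms] e by (metis Ints_add Ints_diff)
qed

lemma bch_ble: "bch b x y \<Longrightarrow> x \<in> W \<Longrightarrow> x \<preceq> y"
proof (induction rule: rtrancl_induct)
  case (step y z)
  then show ?case using bst_cov cov_le ble_trans by blast
qed simp

lemma bst_asc:
  assumes "y \<in> W" "i \<in> I" "asc i y" "b * of_int (h i y) \<in> \<int>" shows "(y, s i \<circ> y) \<in> bst b"
  by (rule bstI[where w = "iv y" and i = i]) (use assms cov_asc in \<open>auto simp: fun_eq_iff\<close>)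

lemma bst_lmult:
  assumes "(x, y) \<in> bst b" "i \<in> I" "asc i x \<longleftrightarrow> asc i y" shows "(s i \<circ> x, s i \<circ> y) \<in> bst b"
proof -
  obtain w j where w: "x \<lessdot> y" "w \<in> W" "j \<in> I" "y = x \<circ> (w \<circ> s j \<circ> iv w)" "b * of_int (cr j (iv w lam)) \<in> \<int>"
    using assms(1) by (rule bstE)
  show ?thesis
    by (rule bstI[OF _ _ w(2,3,5)]) (use cov_lmult[OF w(1) assms(2,3)] w(4) in \<open>auto simp: comp_assoc\<close>)
qed

lemma bst_turn:
  assumes "(x, y) \<in> bst b" "i \<in> I" "asc i x" "\<not> asc i y"
  shows "y = s i \<circ> x" "b * of_int (h i x) \<in> \<int>"
proof -
  show y: "y = s i \<circ> x" using cov_turn bst_cov assms by blast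
  have "x lam - y lam = frag_cmul (h i x) (rt i)" by (simp add: y srefl_def)
  then show "b * of_int (h i x) \<in> \<int>" using bst_lattice[OF assms(1)] in_root_lattice_rt assms(2) by metis
qed

text \<open>Steps whose two ends go the same way at i are multiplied by \<open>s i\<close>, and a
  step that turns from ascent to descent is itself multiplication by \<open>s i\<close>. For a
  descent at x and an ascent at y nothing is claimed.\<close>

lemma bch_lift:
  assumes "bch b x y" and x: "x \<in> W" and i: "i \<in> I"
  shows "(asc i x \<longrightarrow> asc i y \<longrightarrow> bch b (s i \<circ> x) (s i \<circ> y)) \<and>
    (asc i x \<longrightarrow> \<not> asc i y \<longrightarrow> b * of_int (h i x) \<in> \<int> \<and> bch b (s i \<circ> x) y \<and> bch b x (s i \<circ> y)) \<and>
    (\<not> asc i x \<longrightarrow> \<not> asc i y \<longrightarrow> bch b (s i \<circ> x) (s i \<circ> y))"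
  using assms(1)
proof (induction rule: rtrancl_induct)
  case (step y z)
  have W: "y \<in> W" "z \<in> W" using step(2) bst_cov cov_weyl by blast+
  note yz = step(2) and xy = step(1)
  have xz: "bch b x z" using xy yz by (rule rtrancl_into_rtrancl)
  note IH = step(3)
  consider (up) "asc i y" "asc i z" | (down) "\<not> asc i y" "\<not> asc i z"
    | (turn) "asc i y" "\<not> asc i z" | (ret) "\<not> asc i y" "asc i z" by blast
  then show ?case
  proof cases
    case up
    then have st: "(s i \<circ> y, s i \<circ> z) \<in> bst b" using bst_lmult[OF yz i] by blast
    then show ?thesis using IH up by (meson rtrancl_into_rtrancl)
  next
    case down
    then have st: "(s i \<circ> y, s i \<circ> z) \<in> bst b" using bst_lmult[OF yz i] by blast
    then show ?thesis using IH down yz by (meson rtrancl_into_rtrancl)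
  next
    case turn
    note t = bst_turn[OF yz i turn]
    have sz: "s i \<circ> z = y" using t(1) i by simp
    have hx: "b * of_int (h i x) \<in> \<int>" using bch_h_iff[OF xy i] t(2) by blast
    show ?thesis
    proof (cases "asc i x")
      case True
      then have "bch b (s i \<circ> x) (s i \<circ> y)" using IH turn(1) by blast
      then have "bch b (s i \<circ> x) z" by (simp only: t(1))
      moreover have "bch b x (s i \<circ> z)" using xy by (simp only: sz)
      ultimately show ?thesis using True turn hx by blast
    next
      case False
      \<comment> \<open>Integrality at the turn is carried back along the chain to x, so the chain
        can be started one step lower, at \<open>s i \<circ> x\<close>.\<close>
      then have "asc i (s i \<circ> x)" using not_asc x i by blast
      moreover have "b * of_int (h i (s i \<circ> x)) \<in> \<int>"
        using hx by (simp only: h_srefl[OF i] of_int_minus mult_minus_right Ints_minus)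
      ultimately have "(s i \<circ> x, s i \<circ> (s i \<circ> x)) \<in> bst b"
        using bst_asc[of "s i \<circ> x" i b] x i by simp
      then have "(s i \<circ> x, x) \<in> bst b" using i by simp
      then have "bch b (s i \<circ> x) y" using xy by (meson converse_rtrancl_into_rtrancl)
      then have "bch b (s i \<circ> x) (s i \<circ> z)" by (simp only: sz)
      then show ?thesis using False turn by blast
    qed
  next
    case ret
    show ?thesis
    proof (cases "asc i x")
      case True
      then have "b * of_int (h i x) \<in> \<int>" "bch b (s i \<circ> x) y" using IH ret by blast+
      \<comment> \<open>A return from descent to ascent is bridged by the extra step from z to
        \<open>s i \<circ> z\<close>, whose integrality is carried along the chain from x.\<close>
      then have "b * of_int (h i z) \<in> \<int>" using bch_h_iff[OF xz i] by blast
      then have "(z, s i \<circ> z) \<in> bst b" using bst_asc W i ret by blast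
      then have "bch b (s i \<circ> x) (s i \<circ> z)"
        using \<open>bch b (s i \<circ> x) y\<close> yz by (meson rtrancl_into_rtrancl)
      then show ?thesis using True ret by blast
    qed (use ret in blast)
  qed
qed (use x in simp)

lemma jmin_iff: "x \<in> W \<Longrightarrow> jmin x \<longleftrightarrow> mr x = x"
  using jmin_mr[of x] mr_eqI[of x x] by auto

lemma not_jminE:
  assumes "x \<in> W" "\<not> jmin x"
  obtains j where "j \<in> I" "cr j lam = 0" "\<ell> (x \<circ> s j) < \<ell> x"
proof -
  obtain j where "j \<in> I" "cr j lam = 0" "\<not> \<ell> x < \<ell> (x \<circ> s j)" using assms by (auto simp: jmin_def)
  then show ?thesis using that len_rmult_neq[OF assms(1), of j] by auto
qed

lemma cov_desc_right: assumes "x \<in> W" "j \<in> I" "\<ell> (x \<circ> s j) < \<ell> x" shows "x \<circ> s j \<lessdot> x"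
proof -
  have "\<not> asc j (iv x)" using comp_srefl_inv(2) assms by simp
  then have "s j \<circ> iv x \<lessdot> s j \<circ> (s j \<circ> iv x)" using assms not_asc[of "iv x" j] by (intro cov_asc) auto
  then have "s j \<circ> iv x \<lessdot> iv x" using assms by simp
  from cov_inv[OF this] show ?thesis using assms by (simp only: comp_srefl_inv inv_inv_weyl)
qed

lemma bch_mr_self: "x \<in> W \<Longrightarrow> bch b (mr x) x"
proof (induction "\<ell> x" arbitrary: x rule: less_induct)
  case less
  show ?case
  proof (cases "jmin x")
    case False
    then obtain j where j: "j \<in> I" "cr j lam = 0" "\<ell> (x \<circ> s j) < \<ell> x" using not_jminE less by blast
    then have "bch b (mr (x \<circ> s j)) (x \<circ> s j)" using less by simp
    moreover have "mr (x \<circ> s j) = mr x" using less j by (intro mr_cong) (auto simp: srefl_lam)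
    moreover have "(x \<circ> s j, x) \<in> bst b"
      by (rule bstI[where w = id and i = j]) (use j less cov_desc_right in auto)
    ultimately show ?thesis by (metis rtrancl_into_rtrancl)
  qed (use less jmin_iff in simp)
qed

text \<open>Right descents of y that fix \<open>lam\<close> are stripped one at a time. If x has the
  same descent, the step is conjugated by \<open>s j\<close>, which leaves the pairing with
  \<open>lam\<close> unchanged. Otherwise x equals \<open>y \<circ> s j\<close> and the cosets
  agree.\<close>

lemma bst_mr: "(x, y) \<in> bst b \<Longrightarrow> bch b (mr x) (mr y)"
proof (induction "\<ell> y" arbitrary: x y rule: less_induct)
  case less
  have c: "x \<lessdot> y" using less bst_cov by blast
  then have W: "x \<in> W" "y \<in> W" using cov_weyl by auto
  show ?case
  proof (cases "jmin y")
    case True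
    then have "mr y = y" using jmin_iff W by blast
    then show ?thesis using bch_mr_self[OF W(1)] less(2) by (metis rtrancl_into_rtrancl)
  next
    case False
    then obtain j where j: "j \<in> I" "cr j lam = 0" "\<ell> (y \<circ> s j) < \<ell> y" using not_jminE W by blast
    have mr': "mr (x \<circ> s j) = mr x" "mr (y \<circ> s j) = mr y"
      using W j by (auto intro!: mr_cong simp: srefl_lam)
    show ?thesis
    proof (cases "\<ell> (x \<circ> s j) < \<ell> x")
      case True
      obtain w i where w: "w \<in> W" "i \<in> I" "y = x \<circ> (w \<circ> s i \<circ> iv w)" "b * of_int (cr i (iv w lam)) \<in> \<int>"
        using less(2) by (rule bstE)
      have "(x \<circ> s j, y \<circ> s j) \<in> bst b"
      proof (rule bstI[where w = "s j \<circ> w" and i = i])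
        show "x \<circ> s j \<lessdot> y \<circ> s j" using cov_rmult[OF c j(1) True j(3)] .
        show "y \<circ> s j = x \<circ> s j \<circ> (s j \<circ> w \<circ> s i \<circ> iv (s j \<circ> w))"
          using w j by (simp add: inv_comp_weyl fun_eq_iff)
      qed (use w j in \<open>simp_all add: inv_comp_weyl srefl_lam\<close>)
      then show ?thesis using less(1)[of "y \<circ> s j" "x \<circ> s j"] j mr' by simp
    next
      case False
      then have "x \<preceq> y \<circ> s j" using lift_asc_right[OF cov_le[OF c] j(1)] len_rmult_neq[OF W(1) j(1)] by simp
      then have "y \<circ> s j = x" using cov_between[OF c _ ble_desc_right[OF W(2) j(1,3)]] j(3) by auto
      then show ?thesis using mr' by auto
    qed
  qed
qed

lemma bch_mr: "bch b x y \<Longrightarrow> bch b (mr x) (mr y)"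
  by (induction rule: rtrancl_induct) (auto dest: bst_mr)

text \<open>At b = 0 the integrality condition is void, so refinement into covers is enough. The
  Bruhat order of cosets thereby becomes the case b = 0 of the chain relations.\<close>

lemma ble_bch_0: assumes "x \<preceq> y" shows "bch 0 x y"
  using assms
proof (induction "\<ell> y - \<ell> x" arbitrary: x y rule: less_induct)
  case less
  show ?case
  proof (cases "x = y")
    case False
    show ?thesis
    proof (cases "x \<lessdot> y")
      case True
      then obtain t where t: "reflection t" "y = x \<circ> t" by (rule cov_reflection)
      then obtain w i where "w \<in> W" "i \<in> I" "t = w \<circ> s i \<circ> iv w" by (auto simp: reflection_def)
      then have "(x, y) \<in> bst 0" using t True by (intro bstI[where w = w and i = i]) auto
      then show ?thesis by blast
    next
      case nc: False
      then obtain z where z: "x \<preceq> z" "z \<preceq> y" "z \<noteq> x" "z \<noteq> y" using less(2) False unfolding bruhat_cover_def by blast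
      have "\<ell> x < \<ell> z" "\<ell> z < \<ell> y" using ble_len z by blast+
      then have "bch 0 x z" "bch 0 z y" using less(1) z by auto
      then show ?thesis by (rule rtrancl_trans)
    qed
  qed simp
qed

lemma ble_mr: assumes "x \<preceq> y" shows "mr x \<preceq> mr y"
proof -
  have "bch 0 (mr x) (mr y)" using ble_bch_0[OF assms] bch_mr by blast
  then show ?thesis using bch_ble assms ble_weyl by simp
qed

lemma mr_ble: "x \<in> W \<Longrightarrow> mr x \<preceq> x"
  using bch_mr_self[of x 0] bch_ble by simp

subsection \<open>The relations between cosets\<close>

text \<open>The reflexive version of \<open>b_less\<close>, taken on group elements so that left
  multiplication by \<open>s i\<close> can be applied directly.\<close>

definition cle :: "rat \<Rightarrow> ('n weight \<Rightarrow> 'n weight) \<Rightarrow> ('n weight \<Rightarrow> 'n weight) \<Rightarrow> bool" where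
  "cle b x y \<longleftrightarrow> x \<in> W \<and> y \<in> W \<and> bch b (mr x) (mr y)"

lemma cle_weyl: "cle b x y \<Longrightarrow> x \<in> W" "cle b x y \<Longrightarrow> y \<in> W"
  by (auto simp: cle_def)

lemma cle_trans: "cle b x y \<Longrightarrow> cle b y z \<Longrightarrow> cle b x z"
  by (auto simp: cle_def)

lemma cle_same: "x \<in> W \<Longrightarrow> y \<in> W \<Longrightarrow> x lam = y lam \<Longrightarrow> cle b x y"
  using mr_cong[of x y] by (simp add: cle_def)

lemma cle_cong: "x \<in> W \<Longrightarrow> y \<in> W \<Longrightarrow> x' \<in> W \<Longrightarrow> y' \<in> W \<Longrightarrow> x lam = x' lam \<Longrightarrow> y lam = y' lam
    \<Longrightarrow> cle b x y \<longleftrightarrow> cle b x' y'"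
  using mr_cong[of x x'] mr_cong[of y y'] by (simp add: cle_def)

lemma bch_cle: "bch b x y \<Longrightarrow> x \<in> W \<Longrightarrow> y \<in> W \<Longrightarrow> cle b x y"
  by (simp add: cle_def bch_mr)

lemma cle_0: "x \<in> W \<Longrightarrow> y \<in> W \<Longrightarrow> cle 0 x y \<longleftrightarrow> mr x \<preceq> mr y"
  by (auto simp: cle_def ble_bch_0 bch_ble)

lemma ble_cle_0: "x \<preceq> y \<Longrightarrow> cle 0 x y"
  using cle_0 ble_mr ble_weyl by blast

lemma cle_h_diff: assumes "cle b x y" "i \<in> I" shows "b * of_int (h i x - h i y) \<in> \<int>"
  using bch_h_diff[of "mr x" "mr y" b i] assms by (auto simp: cle_def)

lemma cle_lattice: assumes "cle b x y" shows "in_root_lattice b (x lam - y lam)"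
  using bch_lattice[of "mr x" "mr y" b] assms by (auto simp: cle_def)

lemma cle_asc:
  assumes "y \<in> W" "i \<in> I" "h i y \<ge> 0" "b * of_int (h i y) \<in> \<int>" shows "cle b y (s i \<circ> y)"
proof -
  have "asc i (mr y)" using asc_mr assms by simp
  then have "(mr y, s i \<circ> mr y) \<in> bst b" using assms by (intro bst_asc) auto
  then have "cle b (mr y) (s i \<circ> mr y)" using assms by (intro bch_cle) auto
  then show ?thesis using assms cle_cong[of "mr y" "s i \<circ> mr y" y "s i \<circ> y"] by simp
qed

lemma cle_lift_same:
  assumes "cle b x y" "i \<in> I" "h i x \<ge> 0 \<longleftrightarrow> h i y \<ge> 0" shows "cle b (s i \<circ> x) (s i \<circ> y)"
proof -
  have W: "x \<in> W" "y \<in> W" using assms cle_weyl by auto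
  have "bch b (s i \<circ> mr x) (s i \<circ> mr y)"
    using bch_lift[of "mr x" "mr y" b i] assms asc_mr W unfolding cle_def by auto
  then have "cle b (s i \<circ> mr x) (s i \<circ> mr y)" using W assms by (intro bch_cle) auto
  then show ?thesis using W assms cle_cong[of "s i \<circ> mr x" "s i \<circ> mr y" "s i \<circ> x" "s i \<circ> y"] by simp
qed

lemma cle_lift_diff:
  assumes "cle b x y" "i \<in> I" "h i x \<ge> 0" "h i y < 0"
  shows "b * of_int (h i x) \<in> \<int>" "cle b (s i \<circ> x) y" "cle b x (s i \<circ> y)"
proof -
  have W: "x \<in> W" "y \<in> W" using assms cle_weyl by auto
  have b: "b * of_int (h i (mr x)) \<in> \<int>" "bch b (s i \<circ> mr x) (mr y)" "bch b (mr x) (s i \<circ> mr y)"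
    using bch_lift[of "mr x" "mr y" b i] assms asc_mr W unfolding cle_def by auto
  show "b * of_int (h i x) \<in> \<int>" using b(1) W by simp
  have "cle b (s i \<circ> mr x) (mr y)" "cle b (mr x) (s i \<circ> mr y)" using b W assms by (auto intro: bch_cle)
  then show "cle b (s i \<circ> x) y" "cle b x (s i \<circ> y)"
    using W assms cle_cong[of "s i \<circ> mr x" "mr y" "s i \<circ> x" y] cle_cong[of "mr x" "s i \<circ> mr y" x "s i \<circ> y"]
    by simp_all
qed

subsection \<open>Deodhar lifts\<close>

text \<open>The Deodhar lift as a relation: the coset is that of q itself. Existence is then a
  separate matter, and the behaviour under \<open>s i\<close> can be argued without a description
  operator.\<close>

definition is_up :: "('n weight \<Rightarrow> 'n weight) \<Rightarrow> ('n weight \<Rightarrow> 'n weight) \<Rightarrow> bool" where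
  "is_up v q \<longleftrightarrow> v \<preceq> q \<and> (\<forall>p\<in>W. p lam = q lam \<longrightarrow> v \<preceq> p \<longrightarrow> q \<preceq> p)"

definition is_down :: "('n weight \<Rightarrow> 'n weight) \<Rightarrow> ('n weight \<Rightarrow> 'n weight) \<Rightarrow> bool" where
  "is_down w q \<longleftrightarrow> q \<preceq> w \<and> (\<forall>p\<in>W. p lam = q lam \<longrightarrow> p \<preceq> w \<longrightarrow> p \<preceq> q)"

lemma is_up_weyl: "is_up v q \<Longrightarrow> v \<in> W" "is_up v q \<Longrightarrow> q \<in> W"
  by (auto simp: is_up_def dest: ble_weyl)

lemma is_down_weyl: "is_down v q \<Longrightarrow> v \<in> W" "is_down v q \<Longrightarrow> q \<in> W"
  by (auto simp: is_down_def dest: ble_weyl)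

lemma is_up_le: "is_up v q \<Longrightarrow> v \<preceq> q" and is_down_le: "is_down w q \<Longrightarrow> q \<preceq> w"
  by (auto simp: is_up_def is_down_def)

lemma is_upD: "is_up v q \<Longrightarrow> v \<preceq> p \<Longrightarrow> p lam = q lam \<Longrightarrow> q \<preceq> p"
  by (auto simp: is_up_def dest: ble_weyl)

lemma is_downD: "is_down w q \<Longrightarrow> p \<preceq> w \<Longrightarrow> p lam = q lam \<Longrightarrow> p \<preceq> q"
  by (auto simp: is_down_def dest: ble_weyl)

lemma is_up_self: "v \<in> W \<Longrightarrow> is_up v v" and is_down_self: "v \<in> W \<Longrightarrow> is_down v v"
  by (auto simp: is_up_def is_down_def)

lemma is_up_unique: "is_up v q \<Longrightarrow> is_up v p \<Longrightarrow> p lam = q lam \<Longrightarrow> p = q"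
  by (metis ble_antisym is_upD is_up_le)

lemma is_down_unique: "is_down v q \<Longrightarrow> is_down v p \<Longrightarrow> p lam = q lam \<Longrightarrow> p = q"
  by (metis ble_antisym is_downD is_down_le)

lemma up_eqI:
  assumes "is_up v q" shows "up D lam v (coset D lam q) = q"
proof -
  have q: "q \<in> W" using is_up_weyl assms by blast
  show ?thesis unfolding up_def Let_def
  proof (rule the_equality)
    show "q \<in> {w \<in> W. v \<preceq> w \<and> coset D lam w = coset D lam q} \<and>
        (\<forall>x\<in>{w \<in> W. v \<preceq> w \<and> coset D lam w = coset D lam q}. q \<preceq> x)"
      using assms q by (auto simp: coset_eq_iff is_up_def)
    then show "\<And>w. w \<in> {w \<in> W. v \<preceq> w \<and> coset D lam w = coset D lam q} \<and>
        (\<forall>x\<in>{w \<in> W. v \<preceq> w \<and> coset D lam w = coset D lam q}. w \<preceq> x) \<Longrightarrow> w = q"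
      using ble_antisym by blast
  qed
qed

lemma down_eqI:
  assumes "is_down v q" shows "down D lam v (coset D lam q) = q"
proof -
  have q: "q \<in> W" using is_down_weyl assms by blast
  show ?thesis unfolding down_def Let_def
  proof (rule the_equality)
    show "q \<in> {w \<in> W. w \<preceq> v \<and> coset D lam w = coset D lam q} \<and>
        (\<forall>x\<in>{w \<in> W. w \<preceq> v \<and> coset D lam w = coset D lam q}. x \<preceq> q)"
      using assms q by (auto simp: coset_eq_iff is_down_def)
    then show "\<And>w. w \<in> {w \<in> W. w \<preceq> v \<and> coset D lam w = coset D lam q} \<and>
        (\<forall>x\<in>{w \<in> W. w \<preceq> v \<and> coset D lam w = coset D lam q}. x \<preceq> w) \<Longrightarrow> w = q"
      using ble_antisym by blast
  qed
qed

text \<open>A left descent i of the minimal representative of y makes the whole coset of y descend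
  and that of \<open>s i \<circ> y\<close> ascend. The lift of v, or of \<open>s i \<circ> v\<close>
  if v descends, into the lower coset is then multiplied by \<open>s i\<close>.\<close>

lemma is_up_exists:
  "v \<in> W \<Longrightarrow> y \<in> W \<Longrightarrow> mr v \<preceq> mr y \<Longrightarrow> \<exists>q. q lam = y lam \<and> is_up v q"
proof (induction "\<ell> (mr y)" arbitrary: v y rule: less_induct)
  case less
  show ?case
  proof (cases "v lam = y lam")
    case False
    have "mr y \<noteq> id"
    proof
      assume "mr y = id"
      then have "mr v = mr y" using less(4) ble_len[of "mr v" "mr y"] by auto
      then show False using False mr_lam less by metis
    qed
    then obtain i where i: "i \<in> I" "\<not> asc i (mr y)" using first_descent[of "mr y"] less by auto
    then have hy: "h i y < 0" using asc_mr[of y i] less by simp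
    have mry: "mr (s i \<circ> y) = s i \<circ> mr y" using mr_srefl hy i less by simp
    have lt: "\<ell> (mr (s i \<circ> y)) < \<ell> (mr y)" using i len_lmult_neq[of "mr y" i] less by (simp add: mry)
    have ascq: "asc i q" if "q \<in> W" "q lam = (s i \<circ> y) lam" for q
      using h_pos_asc[OF that(1) i(1)] that(2) hy h_srefl[of i y] i by simp
    have descp: "\<not> asc i p" if "p \<in> W" "p lam = y lam" for p
      using h_neg_desc[OF that(1) i(1)] that(2) hy by simp
    have sp: "(s i \<circ> p) lam = (s i \<circ> y) lam" if "p lam = y lam" for p using that by simp
    show ?thesis
    proof (cases "asc i v")
      case True
      have "asc i (mr v)" using asc_mr h_asc True less i by blast
      then have "mr v \<preceq> mr (s i \<circ> y)" using lift_asc[OF less(4) i(1)] by (simp add: mry)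
      then have "\<exists>q. q lam = (s i \<circ> y) lam \<and> is_up v q"
        by (intro less(1)[OF lt less(2)]) (use less(3) i in auto)
      then obtain q where q: "q lam = (s i \<circ> y) lam" "is_up v q" by blast
      have qW: "q \<in> W" using q is_up_weyl by blast
      have "v \<preceq> s i \<circ> q" using is_up_le[OF q(2)] ble_asc[OF qW i(1) ascq[OF qW q(1)]] ble_trans by blast
      moreover have "s i \<circ> q \<preceq> p" if p: "p \<in> W" "p lam = y lam" "v \<preceq> p" for p
      proof -
        have "v \<preceq> s i \<circ> p" using lift_asc[OF p(3) i(1) True] .
        then have "q \<preceq> s i \<circ> p" using is_upD[OF q(2)] sp p q by metis
        then have "s i \<circ> q \<preceq> s i \<circ> (s i \<circ> p)"
          by (rule lift_both) (use i ascq qW q p sp not_asc[of p i] descp in auto)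
        then show ?thesis using i by simp
      qed
      moreover have "(s i \<circ> q) lam = y lam" using q i by simp
      ultimately show ?thesis unfolding is_up_def by metis
    next
      case False
      have hv: "h i v \<le> 0" using h_desc False less i by blast
      have "mr (s i \<circ> v) \<preceq> mr (s i \<circ> y)"
      proof (cases "h i v = 0")
        case True
        then have "asc i (mr v)" using asc_mr less i by simp
        then show ?thesis using lift_asc[OF less(4) i(1)] mr_srefl_0[OF less(2) i(1) True] by (simp add: mry)
      next
        case F: False
        then have "\<not> asc i (mr v)" using asc_mr less i hv by simp
        then show ?thesis using lift_both[OF less(4) i(1)] i mr_srefl[OF less(2) i(1) F] by (simp add: mry)
      qed
      then have "\<exists>q. q lam = (s i \<circ> y) lam \<and> is_up (s i \<circ> v) q"
        by (intro less(1)[OF lt]) (use less(2,3) i in auto)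
      then obtain q where q: "q lam = (s i \<circ> y) lam" "is_up (s i \<circ> v) q" by blast
      have qW: "q \<in> W" using q is_up_weyl by blast
      have asv: "asc i (s i \<circ> v)" using False not_asc less i by blast
      have "s i \<circ> (s i \<circ> v) \<preceq> s i \<circ> q" using lift_both[OF is_up_le[OF q(2)] i(1)] asv ascq[OF qW q(1)] by blast
      then have "v \<preceq> s i \<circ> q" using i by simp
      moreover have "s i \<circ> q \<preceq> p" if p: "p \<in> W" "p lam = y lam" "v \<preceq> p" for p
      proof -
        have "s i \<circ> v \<preceq> s i \<circ> p" using lift_both[OF p(3) i(1)] False descp p by blast
        then have "q \<preceq> s i \<circ> p" using is_upD[OF q(2)] sp p q by metis
        then have "s i \<circ> q \<preceq> s i \<circ> (s i \<circ> p)"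
          by (rule lift_both) (use i ascq qW q p sp not_asc[of p i] descp in auto)
        then show ?thesis using i by simp
      qed
      moreover have "(s i \<circ> q) lam = y lam" using q i by simp
      ultimately show ?thesis unfolding is_up_def by metis
    qed
  qed (use less is_up_self in auto)
qed

text \<open>Induction on w through a left descent i. By the sign of the pairing, the members of the
  target coset all descend, all ascend, or are permuted by \<open>s i\<close>. Accordingly a lift
  below \<open>s i \<circ> w\<close> is multiplied by \<open>s i\<close>, kept, or replaced by the
  larger of itself and its product with \<open>s i\<close>.\<close>

lemma is_down_exists_aux:
  "w \<in> W \<Longrightarrow> v \<preceq> w \<Longrightarrow> \<exists>q. q lam = v lam \<and> is_down w q"
proof (induction "\<ell> w" arbitrary: v w rule: less_induct)
  case less
  have vW: "v \<in> W" using less ble_weyl by blast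
  show ?case
  proof (cases "w = id")
    case True
    then have "v = id" using less ble_len[of v w] by auto
    then show ?thesis using is_down_self[of id] True by (intro exI[of _ id]) simp
  next
    case False
    then obtain i where i: "i \<in> I" "\<not> asc i w" using first_descent less by blast
    let ?w = "s i \<circ> w"
    have lt: "\<ell> ?w < \<ell> w" using i len_lmult_neq less by fastforce
    have wW: "?w \<in> W" using i less by simp
    have asw: "asc i ?w" using not_asc less i by blast
    have le: "?w \<preceq> w" using ble_desc less i by blast
    have lw: "s i \<circ> q \<preceq> w" if "q \<preceq> ?w" for q
      using lift_desc[OF ble_trans[OF that le] i] .
    consider (neg) "h i v < 0" | (pos) "h i v > 0" | (zero) "h i v = 0" by linarith
    then show ?thesis
    proof cases
      case neg
      have descp: "\<not> asc i p" if "p \<in> W" "p lam = v lam" for p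
        using h_neg_desc[OF that(1) i(1)] that(2) neg by simp
      have "s i \<circ> v \<preceq> ?w" using lift_both[OF less(3) i(1)] descp vW i by blast
      then obtain q where q: "q lam = (s i \<circ> v) lam" "is_down ?w q" using less(1)[OF lt wW] by blast
      have qW: "q \<in> W" using q is_down_weyl by blast
      have "s i \<circ> q \<preceq> w" using lw is_down_le q by blast
      moreover have "p \<preceq> s i \<circ> q" if p: "p \<in> W" "p lam = v lam" "p \<preceq> w" for p
      proof -
        have "s i \<circ> p \<preceq> ?w" using lift_both[OF p(3) i(1)] descp p i by blast
        then have "s i \<circ> p \<preceq> q" using is_downD[OF q(2)] p q by simp
        moreover have "asc i q" using h_pos_asc[OF qW i(1)] q neg h_srefl[of i v] i by simp
        moreover have "asc i (s i \<circ> p)" using not_asc descp p i by blast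
        ultimately have "s i \<circ> (s i \<circ> p) \<preceq> s i \<circ> q" using lift_both i by blast
        then show ?thesis using i by simp
      qed
      moreover have "(s i \<circ> q) lam = v lam" using q i by simp
      ultimately show ?thesis unfolding is_down_def by metis
    next
      case pos
      have ascp: "asc i p" if "p \<in> W" "p lam = v lam" for p
        using h_pos_asc[OF that(1) i(1)] that(2) pos by simp
      have "v \<preceq> ?w" using lift_asc[OF less(3) i(1)] ascp vW by blast
      then obtain q where q: "q lam = v lam" "is_down ?w q" using less(1)[OF lt wW] by blast
      have "q \<preceq> w" using q is_down_le le ble_trans by blast
      moreover have "p \<preceq> q" if p: "p \<in> W" "p lam = v lam" "p \<preceq> w" for p
        using is_downD[OF q(2) lift_asc[OF p(3) i(1)]] ascp p q by simp
      ultimately show ?thesis unfolding is_down_def using q by metis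
    next
      case zero
      have fix_s: "(s i \<circ> p) lam = v lam" if "p lam = v lam" for p
        using that zero by (simp add: srefl_def)
      have "\<exists>v'. v' lam = v lam \<and> v' \<preceq> ?w"
      proof (cases "asc i v")
        case True
        then show ?thesis using lift_asc[OF less(3) i(1)] by blast
      next
        case False
        then show ?thesis using lift_both[OF less(3) i(1)] i fix_s by blast
      qed
      then obtain v' where "v' lam = v lam" "v' \<preceq> ?w" by blast
      then obtain q where q: "q lam = v lam" "is_down ?w q" using less(1)[OF lt wW] by metis
      have qW: "q \<in> W" using q is_down_weyl by blast
      \<comment> \<open>The coset is stable under \<open>s i\<close> here, and the maximum below w
        has to descend at i because w does. So the descending member of the pair is taken.\<close>
      define M where "M = (if asc i q then s i \<circ> q else q)"
      have M: "M \<in> W" "\<not> asc i M" "M lam = v lam" "q \<preceq> M"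
        using qW i q fix_s not_asc[of q i] ble_asc[of q i] by (auto simp: M_def simp del: o_apply)
      have "q \<preceq> ?w" using is_down_le q by blast
      then have "q \<preceq> w" "s i \<circ> q \<preceq> w" using lw le ble_trans by blast+
      then have "M \<preceq> w" by (simp add: M_def)
      moreover have "p \<preceq> M" if p: "p \<in> W" "p lam = v lam" "p \<preceq> w" for p
      proof (cases "asc i p")
        case True
        then have "p \<preceq> q" using is_downD[OF q(2) lift_asc[OF p(3) i(1)]] p q by simp
        then show ?thesis using M ble_trans by blast
      next
        case False
        then have "s i \<circ> p \<preceq> q" using is_downD[OF q(2) lift_both[OF p(3) i(1)]] fix_s p q i by simp
        then have "s i \<circ> (s i \<circ> p) \<preceq> M" using M lift_desc i ble_trans by blast
        then show ?thesis using i by simp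
      qed
      ultimately show ?thesis unfolding is_down_def using M by metis
    qed
  qed
qed

lemma is_down_exists:
  assumes "w \<in> W" "y \<in> W" "mr y \<preceq> mr w" shows "\<exists>q. q lam = y lam \<and> is_down w q"
proof -
  have "mr y \<preceq> w" using assms mr_ble ble_trans by blast
  then show ?thesis using is_down_exists_aux[OF assms(1)] assms(2) by fastforce
qed

subsection \<open>Lifts and simple reflections\<close>

definition up_rel :: "rat \<Rightarrow> ('n weight \<Rightarrow> 'n weight) \<Rightarrow> ('n weight \<Rightarrow> 'n weight) \<Rightarrow> bool" where
  "up_rel b y z \<longleftrightarrow> is_up z y \<and> cle b z y"

definition down_rel :: "rat \<Rightarrow> ('n weight \<Rightarrow> 'n weight) \<Rightarrow> ('n weight \<Rightarrow> 'n weight) \<Rightarrow> bool" where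
  "down_rel b y z \<longleftrightarrow> is_down y z \<and> cle b z y"

lemma up_relD: "up_rel b y z \<Longrightarrow> is_up z y" "up_rel b y z \<Longrightarrow> cle b z y"
  by (auto simp: up_rel_def)

lemma down_relD: "down_rel b y z \<Longrightarrow> is_down y z" "down_rel b y z \<Longrightarrow> cle b z y"
  by (auto simp: down_rel_def)

context
  fixes b :: rat and i y z
  assumes i: "i \<in> I" and yW: "y \<in> W" and zW: "z \<in> W" and ay: "asc i y" and az: "asc i z"
begin

lemma syW: "s i \<circ> y \<in> W" and szW: "s i \<circ> z \<in> W"
  using i yW zW by auto

lemma dy: "\<not> asc i (s i \<circ> y)" and dz: "\<not> asc i (s i \<circ> z)"
  using not_asc[of y i] not_asc[of z i] i yW zW ay az by auto

lemma ss: "s i \<circ> (s i \<circ> p) = p"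
  using i by simp

lemma cosets_pos:
  assumes "p \<in> W" "h i p > 0"
  shows "q \<in> W \<Longrightarrow> q lam = p lam \<Longrightarrow> asc i q" "q \<in> W \<Longrightarrow> q lam = (s i \<circ> p) lam \<Longrightarrow> \<not> asc i q"
  using h_pos_asc[of q i] h_neg_desc[of q i] assms h_srefl[OF i, of p] i by simp_all

text \<open>The whole coset of y ascends at i and that of \<open>s i \<circ> y\<close> descends. The
  lifting property therefore translates each competitor of one lift into a competitor of the
  other.\<close>

lemma up_shift_pos:
  assumes "h i y > 0"
  shows "is_up z y \<longleftrightarrow> is_up z (s i \<circ> y)" and "is_up z y \<longleftrightarrow> is_up (s i \<circ> z) (s i \<circ> y)"
proof -
  note cy = cosets_pos[OF yW assms]
  have sl: "(s i \<circ> q) lam = (s i \<circ> p) lam \<longleftrightarrow> q lam = p lam" for p q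
    using i by (metis comp_apply srefl_srefl)
  have A: "is_up z (s i \<circ> y)" if u: "is_up z y"
    unfolding is_up_def
  proof (intro conjI ballI impI)
    show "z \<preceq> s i \<circ> y" using is_up_le[OF u] ble_asc[OF yW i ay] ble_trans by blast
    fix p assume p: "p \<in> W" "p lam = (s i \<circ> y) lam" "z \<preceq> p"
    have "z \<preceq> s i \<circ> p" using lift_asc[OF p(3) i az] .
    then have "y \<preceq> s i \<circ> p" using is_upD[OF u] p i by simp
    then have "s i \<circ> y \<preceq> s i \<circ> (s i \<circ> p)" using lift_both i ay not_asc cy(2) p by blast
    then show "s i \<circ> y \<preceq> p" by (simp only: ss)
  qed
  have B: "is_up z y" if u: "is_up z (s i \<circ> y)"
    unfolding is_up_def
  proof (intro conjI ballI impI)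
    show "z \<preceq> y" using lift_asc[OF is_up_le[OF u] i az] by (simp only: ss)
    fix p assume p: "p \<in> W" "p lam = y lam" "z \<preceq> p"
    have ap: "asc i p" using cy(1) p by blast
    have "z \<preceq> s i \<circ> p" using p ble_asc[OF p(1) i ap] ble_trans by blast
    then have "s i \<circ> y \<preceq> s i \<circ> p" using is_upD[OF u] p i by simp
    then have "s i \<circ> (s i \<circ> y) \<preceq> s i \<circ> (s i \<circ> p)" using lift_both i dy not_asc p ap by blast
    then show "y \<preceq> p" by (simp only: ss)
  qed
  have C: "is_up (s i \<circ> z) (s i \<circ> y)" if u: "is_up z y"
    unfolding is_up_def
  proof (intro conjI ballI impI)
    show "s i \<circ> z \<preceq> s i \<circ> y" using lift_both[OF is_up_le[OF u] i] ay az by blast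
    fix p assume p: "p \<in> W" "p lam = (s i \<circ> y) lam" "s i \<circ> z \<preceq> p"
    have "s i \<circ> (s i \<circ> z) \<preceq> s i \<circ> p" using lift_both[OF p(3) i] dz cy(2) p by blast
    then have "y \<preceq> s i \<circ> p" using is_upD[OF u] p i by (simp add: ss)
    then have "s i \<circ> y \<preceq> s i \<circ> (s i \<circ> p)" using lift_both i ay not_asc cy(2) p by blast
    then show "s i \<circ> y \<preceq> p" by (simp only: ss)
  qed
  have E: "is_up z y" if u: "is_up (s i \<circ> z) (s i \<circ> y)"
    unfolding is_up_def
  proof (intro conjI ballI impI)
    have "s i \<circ> (s i \<circ> z) \<preceq> s i \<circ> (s i \<circ> y)" using lift_both[OF is_up_le[OF u] i] dy dz by blast
    then show "z \<preceq> y" by (simp only: ss)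
    fix p assume p: "p \<in> W" "p lam = y lam" "z \<preceq> p"
    have ap: "asc i p" using cy(1) p by blast
    have "s i \<circ> z \<preceq> s i \<circ> p" using lift_both[OF p(3) i] az ap by blast
    then have "s i \<circ> y \<preceq> s i \<circ> p" using is_upD[OF u] p i by simp
    then have "s i \<circ> (s i \<circ> y) \<preceq> s i \<circ> (s i \<circ> p)" using lift_both i dy not_asc p ap by blast
    then show "y \<preceq> p" by (simp only: ss)
  qed
  show "is_up z y \<longleftrightarrow> is_up z (s i \<circ> y)" using A B by blast
  show "is_up z y \<longleftrightarrow> is_up (s i \<circ> z) (s i \<circ> y)" using C E by blast
qed

lemma down_shift_pos:
  assumes "h i z > 0"
  shows "is_down y z \<longleftrightarrow> is_down (s i \<circ> y) z" and "is_down y z \<longleftrightarrow> is_down (s i \<circ> y) (s i \<circ> z)"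
proof -
  note cz = cosets_pos[OF zW assms]
  have A: "is_down (s i \<circ> y) z" if u: "is_down y z"
    unfolding is_down_def
  proof (intro conjI ballI impI)
    show "z \<preceq> s i \<circ> y" using is_down_le[OF u] ble_asc[OF yW i ay] ble_trans by blast
    fix p assume p: "p \<in> W" "p lam = z lam" "p \<preceq> s i \<circ> y"
    have "p \<preceq> s i \<circ> (s i \<circ> y)" using lift_asc[OF p(3) i] cz p by blast
    then show "p \<preceq> z" using is_downD[OF u] p by (simp only: ss)
  qed
  have B: "is_down y z" if u: "is_down (s i \<circ> y) z"
    unfolding is_down_def
  proof (intro conjI ballI impI)
    show "z \<preceq> y" using lift_asc[OF is_down_le[OF u] i az] by (simp only: ss)
    fix p assume p: "p \<in> W" "p lam = z lam" "p \<preceq> y"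
    then show "p \<preceq> z" using is_downD[OF u] ble_asc[OF yW i ay] ble_trans by blast
  qed
  have C: "is_down (s i \<circ> y) (s i \<circ> z)" if u: "is_down y z"
    unfolding is_down_def
  proof (intro conjI ballI impI)
    show "s i \<circ> z \<preceq> s i \<circ> y" using lift_both[OF is_down_le[OF u] i] ay az by blast
    fix p assume p: "p \<in> W" "p lam = (s i \<circ> z) lam" "p \<preceq> s i \<circ> y"
    have "s i \<circ> p \<preceq> s i \<circ> (s i \<circ> y)" using lift_both[OF p(3) i] dy cz(2) p by blast
    then have "s i \<circ> p \<preceq> z" using is_downD[OF u] p i by (simp add: ss)
    then have "s i \<circ> (s i \<circ> p) \<preceq> s i \<circ> z" using lift_both i az not_asc cz(2) p by blast
    then show "p \<preceq> s i \<circ> z" by (simp only: ss)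
  qed
  have E: "is_down y z" if u: "is_down (s i \<circ> y) (s i \<circ> z)"
    unfolding is_down_def
  proof (intro conjI ballI impI)
    have "s i \<circ> (s i \<circ> z) \<preceq> s i \<circ> (s i \<circ> y)" using lift_both[OF is_down_le[OF u] i] dy dz by blast
    then show "z \<preceq> y" by (simp only: ss)
    fix p assume p: "p \<in> W" "p lam = z lam" "p \<preceq> y"
    have ap: "asc i p" using cz(1) p by blast
    have "s i \<circ> p \<preceq> s i \<circ> y" using lift_both[OF p(3) i] ay ap by blast
    then have "s i \<circ> p \<preceq> s i \<circ> z" using is_downD[OF u] p i by simp
    then have "s i \<circ> (s i \<circ> p) \<preceq> s i \<circ> (s i \<circ> z)" using lift_both i dz not_asc p ap by blast
    then show "p \<preceq> z" by (simp only: ss)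
  qed
  show "is_down y z \<longleftrightarrow> is_down (s i \<circ> y) z" using A B by blast
  show "is_down y z \<longleftrightarrow> is_down (s i \<circ> y) (s i \<circ> z)" using C E by blast
qed

text \<open>The coset of y is stable under \<open>s i\<close>. If q is the lift of
  \<open>s i \<circ> z\<close>, then the lift of z is the ascending member of the pair formed by q
  and \<open>s i \<circ> q\<close>, and comparison with y gives the equivalence.\<close>

lemma up_shift_0:
  assumes "h i y = 0" "mr (s i \<circ> z) \<preceq> mr y"
  shows "\<not> is_up z (s i \<circ> y)"
    "is_up z y \<longleftrightarrow> is_up (s i \<circ> z) y \<or> is_up (s i \<circ> z) (s i \<circ> y)"
    "\<not> (is_up (s i \<circ> z) y \<and> is_up (s i \<circ> z) (s i \<circ> y))"
proof -
  have fix_s: "(s i \<circ> p) lam = y lam" if "p lam = y lam" for p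
    using that assms by (simp add: srefl_def)
  show no: "\<not> is_up z (s i \<circ> y)"
  proof
    assume u: "is_up z (s i \<circ> y)"
    have "z \<preceq> y" using lift_asc[OF is_up_le[OF u] i az] by (simp only: ss)
    then have "s i \<circ> y \<preceq> y" using is_upD[OF u] fix_s by simp
    then show False using ay ble_len_le by fastforce
  qed
  show "\<not> (is_up (s i \<circ> z) y \<and> is_up (s i \<circ> z) (s i \<circ> y))"
    using is_up_unique[of "s i \<circ> z" y "s i \<circ> y"] fix_s ay by auto
  obtain q where q: "q lam = y lam" "is_up (s i \<circ> z) q" using is_up_exists[OF szW yW assms(2)] by blast
  have qW: "q \<in> W" using q is_up_weyl by blast
  define p where "p = (if asc i q then q else s i \<circ> q)"
  have p: "p \<in> W" "asc i p" "p lam = y lam" "q = p \<or> q = s i \<circ> p"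
    using qW i q fix_s not_asc[of q i] by (auto simp: p_def simp del: o_apply)
  have "is_up z p"
    unfolding is_up_def
  proof (intro conjI ballI impI)
    have "z \<preceq> s i \<circ> p"
      using p is_up_le[OF q(2)] ble_asc[OF zW i az] ble_asc[OF p(1) i p(2)] ble_trans by blast
    then show "z \<preceq> p" using lift_asc[OF _ i az] ss by metis
    fix r assume r: "r \<in> W" "r lam = p lam" "z \<preceq> r"
    define m where "m = (if asc i r then s i \<circ> r else r)"
    have m: "m \<in> W" "\<not> asc i m" "m lam = y lam" "r = m \<or> r = s i \<circ> m"  "r \<preceq> m"
      using r i fix_s not_asc[of r i] p ble_asc[of r i] by (auto simp: m_def simp del: o_apply)
    have "s i \<circ> z \<preceq> m" using lift_desc[OF ble_trans[OF r(3) m(5)] i m(2)] .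
    then have "q \<preceq> m" using is_upD[OF q(2)] m q by simp
    then have pm: "p \<preceq> m" using p ble_asc[OF p(1) i p(2)] ble_trans by blast
    show "p \<preceq> r"
      using m(4) pm lift_asc[OF pm i p(2)] by auto
  qed
  then have zy: "is_up z y \<longleftrightarrow> p = y" using is_up_unique[of z p y] p by auto
  have "is_up (s i \<circ> z) y \<or> is_up (s i \<circ> z) (s i \<circ> y) \<longleftrightarrow> q = y \<or> q = s i \<circ> y"
    using is_up_unique[OF q(2)] q fix_s by metis
  also have "\<dots> \<longleftrightarrow> p = y"
    using p ay dy ss by metis
  finally show "is_up z y \<longleftrightarrow> is_up (s i \<circ> z) y \<or> is_up (s i \<circ> z) (s i \<circ> y)" using zy by blast
qed

text \<open>Dual to \<open>up_shift_0\<close>: the lift of \<open>s i \<circ> y\<close> is the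
  descending member of the pair formed from the lift of y.\<close>

lemma down_shift_0:
  assumes "h i z = 0" "mr z \<preceq> mr y"
  shows "\<not> is_down (s i \<circ> y) z"
    "is_down (s i \<circ> y) (s i \<circ> z) \<longleftrightarrow> is_down y z \<or> is_down y (s i \<circ> z)"
    "\<not> (is_down y z \<and> is_down y (s i \<circ> z))"
proof -
  have fix_s: "(s i \<circ> p) lam = z lam" if "p lam = z lam" for p
    using that assms by (simp add: srefl_def)
  show no: "\<not> is_down (s i \<circ> y) z"
  proof
    assume u: "is_down (s i \<circ> y) z"
    have "s i \<circ> z \<preceq> s i \<circ> y" using lift_desc[OF is_down_le[OF u] i dy] .
    then have "s i \<circ> z \<preceq> z" using is_downD[OF u] fix_s by simp
    then show False using az ble_len_le by fastforce
  qed
  show "\<not> (is_down y z \<and> is_down y (s i \<circ> z))"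
    using is_down_unique[of y z "s i \<circ> z"] fix_s az by auto
  obtain q where q: "q lam = z lam" "is_down y q" using is_down_exists[OF yW zW assms(2)] by blast
  have qW: "q \<in> W" using q is_down_weyl by blast
  define p where "p = (if asc i q then s i \<circ> q else q)"
  have p: "p \<in> W" "\<not> asc i p" "p lam = z lam" "q = p \<or> q = s i \<circ> p" "q \<preceq> p"
    using qW i q fix_s not_asc[of q i] ble_asc[of q i] by (auto simp: p_def simp del: o_apply)
  have qsy: "q \<preceq> s i \<circ> y" using is_down_le[OF q(2)] ble_asc[OF yW i ay] ble_trans by blast
  have "is_down (s i \<circ> y) p"
    unfolding is_down_def
  proof (intro conjI ballI impI)
    show "p \<preceq> s i \<circ> y" using p(4) qsy lift_desc[OF qsy i dy] ss by metis
    fix r assume r: "r \<in> W" "r lam = p lam" "r \<preceq> s i \<circ> y"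
    show "r \<preceq> p"
    proof (cases "asc i r")
      case True
      then have "r \<preceq> y" using lift_asc[OF r(3) i] by (simp only: ss)
      then have "r \<preceq> q" using is_downD[OF q(2)] r p q by simp
      then show ?thesis using p ble_trans by blast
    next
      case False
      then have "s i \<circ> r \<preceq> y" using lift_both[OF r(3) i] dy by (simp only: ss)
      then have "s i \<circ> r \<preceq> q" using is_downD[OF q(2)] fix_s[of r] r p q by simp
      then have "s i \<circ> (s i \<circ> r) \<preceq> p" using p lift_desc i ble_trans by blast
      then show ?thesis by (simp only: ss)
    qed
  qed
  then have zy: "is_down (s i \<circ> y) (s i \<circ> z) \<longleftrightarrow> p = s i \<circ> z"
    using is_down_unique[of "s i \<circ> y" p "s i \<circ> z"] p fix_s by auto
  have "is_down y z \<or> is_down y (s i \<circ> z) \<longleftrightarrow> q = z \<or> q = s i \<circ> z"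
    using is_down_unique[OF q(2)] q fix_s by metis
  also have "\<dots> \<longleftrightarrow> p = s i \<circ> z"
    using p az dz ss by metis
  finally show "is_down (s i \<circ> y) (s i \<circ> z) \<longleftrightarrow> is_down y z \<or> is_down y (s i \<circ> z)" using zy by blast
qed

end

end

subsection \<open>The group algebra\<close>

lemma act_RT_superset:
  assumes "finite A" "Poly_Mapping.keys f \<subseteq> A"
  shows "act_RT w f = (\<Sum>\<mu>\<in>A. Poly_Mapping.single (w \<mu>) (Poly_Mapping.lookup f \<mu>))"
  unfolding act_RT_def using assms
  by (intro sum.mono_neutral_left) (auto simp: in_keys_iff)

lemma act_RT_add: "act_RT w (f + g) = act_RT w f + act_RT w g"
proof -
  let ?A = "Poly_Mapping.keys f \<union> Poly_Mapping.keys g"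
  have "act_RT w (f + g) = (\<Sum>\<mu>\<in>?A. Poly_Mapping.single (w \<mu>) (Poly_Mapping.lookup (f + g) \<mu>))"
    by (rule act_RT_superset) (use Poly_Mapping.keys_add[of f g] in auto)
  also have "\<dots> = (\<Sum>\<mu>\<in>?A. Poly_Mapping.single (w \<mu>) (Poly_Mapping.lookup f \<mu>))
      + (\<Sum>\<mu>\<in>?A. Poly_Mapping.single (w \<mu>) (Poly_Mapping.lookup g \<mu>))"
    by (simp add: lookup_add single_add sum.distrib)
  also have "\<dots> = act_RT w f + act_RT w g"
    by (simp add: act_RT_superset[of ?A f] act_RT_superset[of ?A g])
  finally show ?thesis .
qed

lemma act_RT_0 [simp]: "act_RT w 0 = 0"
  by (simp add: act_RT_def)

lemma act_RT_single [simp]: "act_RT w (Poly_Mapping.single \<mu> c) = Poly_Mapping.single (w \<mu>) c"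
  by (simp add: act_RT_def)

lemma act_RT_ex [simp]: "act_RT w (ex \<mu>) = ex (w \<mu>)"
  by (simp add: ex_def)

lemma act_RT_uminus: "act_RT w (- f) = - act_RT w f"
  using act_RT_add[of w f "- f"] by (simp add: eq_neg_iff_add_eq_0 add.commute)

lemma act_RT_diff: "act_RT w (f - g) = act_RT w f - act_RT w g"
  using act_RT_add[of w f "- g"] act_RT_uminus[of w g] by simp

lemma act_RT_sum: "act_RT w (\<Sum>i\<in>A. f i) = (\<Sum>i\<in>A. act_RT w (f i))"
  by (induction A rule: infinite_finite_induct) (auto simp: act_RT_add)

lemma act_RT_comp: "act_RT v (act_RT w f) = act_RT (v \<circ> w) f"
  unfolding act_RT_def[of w] act_RT_def[of "v \<circ> w"] act_RT_sum by simp

lemma poly_mapping_sum_singles: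
  fixes f :: "'a \<Rightarrow>\<^sub>0 'b :: comm_monoid_add"
  shows "f = (\<Sum>\<mu>\<in>Poly_Mapping.keys f. Poly_Mapping.single \<mu> (Poly_Mapping.lookup f \<mu>))"
  by (rule poly_mapping_eqI) (simp add: lookup_sum lookup_single when_def in_keys_iff)

lemma act_RT_id [simp]: "act_RT id f = f"
  by (simp add: act_RT_def flip: poly_mapping_sum_singles)

lemma act_RT_mult:
  assumes add: "\<And>\<mu> \<nu>. w (\<mu> + \<nu>) = w \<mu> + w \<nu>"
  shows "act_RT w (f * g) = act_RT w f * act_RT w g"
proof -
  have "f * g = (\<Sum>\<mu>\<in>Poly_Mapping.keys f. Poly_Mapping.single \<mu> (Poly_Mapping.lookup f \<mu>))
      * (\<Sum>\<nu>\<in>Poly_Mapping.keys g. Poly_Mapping.single \<nu> (Poly_Mapping.lookup g \<nu>))"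
    by (rule arg_cong2[where f = "(*)", OF poly_mapping_sum_singles poly_mapping_sum_singles])
  also have "\<dots> = (\<Sum>\<mu>\<in>Poly_Mapping.keys f. \<Sum>\<nu>\<in>Poly_Mapping.keys g.
      Poly_Mapping.single (\<mu> + \<nu>) (Poly_Mapping.lookup f \<mu> * Poly_Mapping.lookup g \<nu>))"
    by (simp add: sum_product mult_single)
  finally show ?thesis
    by (simp add: act_RT_sum add act_RT_def[of w f] act_RT_def[of w g] sum_product mult_single)
qed

lemma ex_add: "ex (\<mu> + \<nu>) = ex \<mu> * ex \<nu>"
  by (simp add: ex_def mult_single)

lemma ex_0 [simp]: "ex 0 = 1"
  by (simp add: ex_def)

lemma act_RT_1: "w 0 = 0 \<Longrightarrow> act_RT w 1 = 1"
  using act_RT_ex[of w 0] by simp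

lemma lookup_act_RT: assumes "inj w" shows "Poly_Mapping.lookup (act_RT w f) (w \<mu>) = Poly_Mapping.lookup f \<mu>"
proof -
  have "Poly_Mapping.lookup (act_RT w f) (w \<mu>)
    = (\<Sum>\<nu>\<in>Poly_Mapping.keys f. if \<nu> = \<mu> then Poly_Mapping.lookup f \<nu> else 0)"
    unfolding act_RT_def lookup_sum by (intro sum.cong) (auto simp: lookup_single when_def dest: injD[OF assms])
  also have "\<dots> = Poly_Mapping.lookup f \<mu>" by (simp add: in_keys_iff)
  finally show ?thesis .
qed

lemma act_RT_eq_iff: "inj w \<Longrightarrow> act_RT w f = act_RT w g \<longleftrightarrow> f = g"
  by (metis lookup_act_RT poly_mapping_eqI)

lemma ex_eq_iff [simp]: "ex \<mu> = ex \<nu> \<longleftrightarrow> \<mu> = \<nu>"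
  by (metis (no_types) ex_def lookup_single_eq lookup_single_not_eq zero_neq_one)

lemma ex_neq_0 [simp]: "ex \<mu> \<noteq> 0"
  by (metis ex_def lookup_single_eq lookup_zero zero_neq_one)

lemma inj_frag_cmul: "N \<noteq> 0 \<Longrightarrow> inj (frag_cmul N)"
  by (rule injI) (simp add: poly_mapping_eq_iff fun_eq_iff lookup_frag_cmul)

lemma sum_two_index:
  assumes "finite Z" "\<And>p. p \<in> Z \<Longrightarrow> g p \<in> Z" "\<And>p. p \<in> Z \<Longrightarrow> g (g p) = p" "\<And>p. p \<in> Z \<Longrightarrow> P (g p) \<longleftrightarrow> \<not> P p"
  shows "(\<Sum>p\<in>Z. f p) = (\<Sum>p\<in>{p \<in> Z. P p}. f p + f (g p) :: 'a :: comm_monoid_add)"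
proof -
  have "(\<Sum>p\<in>Z. f p) = (\<Sum>p\<in>{p \<in> Z. P p}. f p) + (\<Sum>p\<in>{p \<in> Z. \<not> P p}. f p)"
    using assms(1) by (subst sum.union_disjoint[symmetric]) (auto intro!: sum.cong)
  also have "(\<Sum>p\<in>{p \<in> Z. \<not> P p}. f p) = (\<Sum>p\<in>{p \<in> Z. P p}. f (g p))"
    by (rule sum.reindex_bij_witness[where i = g and j = g]) (use assms in auto)
  finally show ?thesis by (simp add: sum.distrib)
qed

section \<open>The action of a simple reflection on rows of coefficients\<close>

context kac_moody_datum
begin

context
  fixes i :: 'i and N :: int
  assumes i: "i \<in> I"
begin

definition E :: "int \<Rightarrow> 'n RT" where "E T = ex (frag_cmul T (rt i))"

lemma E_0: "E 0 = 1" and E_add: "E (T + R) = E T * E R"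
  by (simp_all add: E_def frag_cmul_distrib ex_add)

abbreviation sg :: "'n RT \<Rightarrow> 'n RT" where "sg \<equiv> act_RT (s i)"

lemma sg_mult: "sg (f * g) = sg f * sg g"
  by (rule act_RT_mult) (rule srefl_add[OF i])

lemma sg_of_int: "sg (of_int c * f) = of_int c * sg f"
proof (induction c rule: int_induct[where k = 0])
  case (step1 c)
  then show ?case by (simp add: distrib_right act_RT_add)
next
  case (step2 c)
  then show ?case by (simp add: left_diff_distrib act_RT_diff)
qed simp

text \<open>The action of \<open>s\<^sub>i\<close> on \<open>\<Sum>\<^sub>z g\<^sub>z T\<^sub>z\<close>, rescaled by \<open>N\<close>.\<close>

definition S :: "(('n weight \<Rightarrow> 'n weight) \<Rightarrow> 'n RT) \<Rightarrow> ('n weight \<Rightarrow> 'n weight) \<Rightarrow> 'n RT" where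
  "S g z = (if asc i z then sg (g z) else (1 - E N) * sg (g (s i \<circ> z)) + E N * sg (g z))"

lemma S_mult: "S (\<lambda>z. f * g z) z = sg f * S g z"
  by (simp add: S_def sg_mult algebra_simps)

lemma S_add: "S (\<lambda>z. f z + g z) z = S f z + S g z"
  by (simp add: S_def act_RT_add algebra_simps)

lemma S_sum: "S (\<lambda>z. \<Sum>p\<in>A. f p z) z = (\<Sum>p\<in>A. S (f p) z)"
  by (simp add: S_def act_RT_sum sum_distrib_left sum.distrib)

lemma S_of_int: "S (\<lambda>z. of_int c * g z) z = of_int c * S g z"
  by (simp add: S_def sg_of_int algebra_simps)

text \<open>The two rows are multiplied by an upper triangular matrix with diagonal entries
  \<open>E (N - T)\<close> and \<open>E T\<close>. At T = N it is the matrix by which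
  \<open>s i\<close> acts on the two basis elements of y and \<open>s i \<circ> y\<close>.\<close>

definition intertwines :: "int \<Rightarrow> (('n weight \<Rightarrow> 'n weight) \<Rightarrow> ('n weight \<Rightarrow> 'n weight) \<Rightarrow> 'n RT)
    \<Rightarrow> ('n weight \<Rightarrow> 'n weight) \<Rightarrow> bool" where
  "intertwines T X y \<longleftrightarrow> (\<forall>z\<in>W.
     S (X y) z = E (N - T) * X y z + (1 - E N) * X (s i \<circ> y) z \<and>
     S (X (s i \<circ> y)) z = E T * X (s i \<circ> y) z)"

text \<open>\<open>s i\<close> exchanges the weights attached to the two rows, and these differ by k
  simple roots. Rewriting one as the other produces the factors \<open>E k\<close> and
  \<open>E (- k)\<close>.\<close>

lemma intertwines_diag:
  assumes X: "intertwines T X y" and d: "d (s i \<circ> y) = s i (d y)" and h: "cr i (d y) = k"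
  shows "intertwines (T + k) (\<lambda>y z. ex (d y) * X y z) y"
proof -
  have e: "ex (s i (d y)) = ex (d y) * E (- k)" "ex (d y) = ex (s i (d y)) * E k"
    using h by (simp_all add: E_def srefl_def flip: ex_add)
  have E1: "E (- k) * E (N - T) = E (N - (T + k))" "E k * E T = E (T + k)"
    by (simp_all add: algebra_simps flip: E_add)
  show ?thesis unfolding intertwines_def
  proof (intro ballI conjI)
    fix z assume z: "z \<in> W"
    have "S (\<lambda>z. ex (d y) * X y z) z = ex (s i (d y)) * (E (N - T) * X y z + (1 - E N) * X (s i \<circ> y) z)"
      using X z unfolding S_mult intertwines_def by simp
    also have "\<dots> = ex (d y) * (E (- k) * E (N - T)) * X y z + (1 - E N) * (ex (s i (d y)) * X (s i \<circ> y) z)"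
      by (simp only: distrib_left) (simp add: e(1) mult_ac)
    finally show "S (\<lambda>z. ex (d y) * X y z) z
        = E (N - (T + k)) * (ex (d y) * X y z) + (1 - E N) * (ex (d (s i \<circ> y)) * X (s i \<circ> y) z)"
      by (simp add: E1 d mult_ac)
    have "S (\<lambda>z. ex (d (s i \<circ> y)) * X (s i \<circ> y) z) z = ex (d y) * (E T * X (s i \<circ> y) z)"
      using X z i unfolding S_mult intertwines_def by (simp add: d)
    also have "\<dots> = ex (s i (d y)) * (E k * E T) * X (s i \<circ> y) z"
      by (subst e(2)) (simp only: mult_ac)
    finally show "S (\<lambda>z. ex (d (s i \<circ> y)) * X (s i \<circ> y) z) z = E (T + k) * (ex (d (s i \<circ> y)) * X (s i \<circ> y) z)"
      unfolding E1 d by (simp only: mult_ac)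
  qed
qed

text \<open>The condition on a two-by-two block \<open>(a, b; c, d)\<close> under which left multiplication by it turns
  parameter \<open>T\<close> into \<open>R\<close>.\<close>

definition block :: "int \<Rightarrow> int \<Rightarrow> int \<Rightarrow> int \<Rightarrow> int \<Rightarrow> int \<Rightarrow> bool" where
  "block T R a b c d \<longleftrightarrow>
     of_int a * E (N - T) = E (N - R) * of_int a + (1 - E N) * of_int c \<and>
     of_int a * (1 - E N) + of_int b * E T = E (N - R) * of_int b + (1 - E N) * of_int d \<and>
     of_int c * E (N - T) = E R * of_int c \<and>
     of_int c * (1 - E N) + of_int d * E T = E R * of_int d"

text \<open>The shapes met in \<open>up_block\<close> and \<open>down_block\<close>: the empty
  block, integral times with positive pairing (up and down), three shapes for non-integral times,
  and two for a vanishing pairing. The diagonal shape also recurs for a vanishing pairing.\<close>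

lemma blockI:
  "a = 0 \<Longrightarrow> b = 0 \<Longrightarrow> c = 0 \<Longrightarrow> d = 0 \<Longrightarrow> block T R a b c d"
  "c = a \<Longrightarrow> d = a \<Longrightarrow> T = N \<Longrightarrow> R = 0 \<Longrightarrow> block T R a b c d"
  "c = - a \<Longrightarrow> d = a \<Longrightarrow> T = 0 \<Longrightarrow> R = N \<Longrightarrow> block T R a b c d"
  "a = 0 \<Longrightarrow> c = 0 \<Longrightarrow> d = 0 \<Longrightarrow> T + R = N \<Longrightarrow> block T R a b c d"
  "b = 0 \<Longrightarrow> c = 0 \<Longrightarrow> a = d \<Longrightarrow> T = R \<Longrightarrow> block T R a b c d"
  "c = 0 \<Longrightarrow> a = d \<Longrightarrow> T = R \<Longrightarrow> T + R = N \<Longrightarrow> block T R a b c d"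
  "c = 0 \<Longrightarrow> a = b \<Longrightarrow> d = 0 \<Longrightarrow> T = N \<Longrightarrow> R = N \<Longrightarrow> block T R a b c d"
  "c = 0 \<Longrightarrow> a = 0 \<Longrightarrow> b = - d \<Longrightarrow> T = N \<Longrightarrow> R = N \<Longrightarrow> block T R a b c d"
proof -
  have r: "T + R = N \<Longrightarrow> N - R = T \<and> N - T = R" by auto
  show "a = 0 \<Longrightarrow> b = 0 \<Longrightarrow> c = 0 \<Longrightarrow> d = 0 \<Longrightarrow> block T R a b c d"
    "c = a \<Longrightarrow> d = a \<Longrightarrow> T = N \<Longrightarrow> R = 0 \<Longrightarrow> block T R a b c d"
    "c = - a \<Longrightarrow> d = a \<Longrightarrow> T = 0 \<Longrightarrow> R = N \<Longrightarrow> block T R a b c d"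
    "b = 0 \<Longrightarrow> c = 0 \<Longrightarrow> a = d \<Longrightarrow> T = R \<Longrightarrow> block T R a b c d"
    "c = 0 \<Longrightarrow> a = b \<Longrightarrow> d = 0 \<Longrightarrow> T = N \<Longrightarrow> R = N \<Longrightarrow> block T R a b c d"
    "c = 0 \<Longrightarrow> a = 0 \<Longrightarrow> b = - d \<Longrightarrow> T = N \<Longrightarrow> R = N \<Longrightarrow> block T R a b c d"
    by (auto simp: block_def E_0 algebra_simps)
  show "a = 0 \<Longrightarrow> c = 0 \<Longrightarrow> d = 0 \<Longrightarrow> T + R = N \<Longrightarrow> block T R a b c d"
    "c = 0 \<Longrightarrow> a = d \<Longrightarrow> T = R \<Longrightarrow> T + R = N \<Longrightarrow> block T R a b c d"
    using r by (auto simp: block_def algebra_simps)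
qed

text \<open>The elements below \<open>s i \<circ> y\<close> form a set stable under
  \<open>s i\<close>, over which both rows can be summed. The sum splits into pairs p,
  \<open>s i \<circ> p\<close>, and \<open>block\<close> is the equality of the coefficients of the
  two rows of X in each pair.\<close>

lemma intertwines_block:
  fixes u :: "('n weight \<Rightarrow> 'n weight) \<Rightarrow> ('n weight \<Rightarrow> 'n weight) \<Rightarrow> int"
  assumes y: "y \<in> W" "asc i y"
    and u: "\<And>y p. u y p \<noteq> 0 \<Longrightarrow> p \<preceq> y"
    and X: "\<And>p. p \<in> W \<Longrightarrow> asc i p \<Longrightarrow> s i \<circ> p \<preceq> s i \<circ> y \<Longrightarrow> intertwines (T p) X p"
    and bl: "\<And>p. p \<in> W \<Longrightarrow> asc i p \<Longrightarrow>
      block (T p) R (u y p) (u y (s i \<circ> p)) (u (s i \<circ> y) p) (u (s i \<circ> y) (s i \<circ> p))"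
  shows "intertwines R (\<lambda>y z. \<Sum>p\<in>{p \<in> W. p \<preceq> y}. of_int (u y p) * X p z) y"
proof -
  let ?sy = "s i \<circ> y"
  define Z where "Z = {p \<in> W. p \<preceq> ?sy}"
  define A where "A = {p \<in> Z. asc i p}"
  let ?Y = "\<lambda>y z. \<Sum>p\<in>{p \<in> W. p \<preceq> y}. of_int (u y p) * X p z"
  have ysy: "y \<preceq> ?sy" using ble_asc y i by blast
  have dsy: "\<not> asc i ?sy" using not_asc y i by blast
  have Z: "finite Z" "\<And>p. p \<in> Z \<Longrightarrow> s i \<circ> p \<in> Z" "\<And>p. p \<in> Z \<Longrightarrow> p \<in> W"
    unfolding Z_def using finite_below lift_desc[OF _ i dsy] i by auto
  have split: "(\<Sum>p\<in>Z. f p) = (\<Sum>p\<in>A. f p + f (s i \<circ> p))" for f :: "_ \<Rightarrow> 'n RT"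
    unfolding A_def using Z i not_asc by (intro sum_two_index) auto
  have YZ: "?Y q z = (\<Sum>p\<in>A. of_int (u q p) * X p z + of_int (u q (s i \<circ> p)) * X (s i \<circ> p) z)"
    if "q = y \<or> q = ?sy" for q z
  proof -
    have "?Y q z = (\<Sum>p\<in>Z. of_int (u q p) * X p z)"
      by (rule sum.mono_neutral_left) (use Z(1) that ysy ble_trans u in \<open>auto simp: Z_def\<close>)
    then show ?thesis by (simp only: split)
  qed
  have SX: "S (X p) z = E (N - T p) * X p z + (1 - E N) * X (s i \<circ> p) z"
    "S (X (s i \<circ> p)) z = E (T p) * X (s i \<circ> p) z" if "p \<in> A" "z \<in> W" for p z
  proof -
    have "p \<in> W" "asc i p" "s i \<circ> p \<preceq> ?sy" using that Z(2)[of p] unfolding A_def by (auto simp: Z_def)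
    then show "S (X p) z = E (N - T p) * X p z + (1 - E N) * X (s i \<circ> p) z"
      "S (X (s i \<circ> p)) z = E (T p) * X (s i \<circ> p) z"
      using X that unfolding intertwines_def by blast+
  qed
  have SY: "S (?Y q) z = (\<Sum>p\<in>A. of_int (u q p) * (E (N - T p) * X p z + (1 - E N) * X (s i \<circ> p) z)
      + of_int (u q (s i \<circ> p)) * (E (T p) * X (s i \<circ> p) z))"
    if q: "q = y \<or> q = ?sy" and z: "z \<in> W" for q z
  proof -
    have "S (?Y q) z = S (\<lambda>z. \<Sum>p\<in>A. of_int (u q p) * X p z + of_int (u q (s i \<circ> p)) * X (s i \<circ> p) z) z"
      using YZ[OF q] by simp
    also have "\<dots> = (\<Sum>p\<in>A. of_int (u q p) * S (X p) z + of_int (u q (s i \<circ> p)) * S (X (s i \<circ> p)) z)"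
      by (simp only: S_sum S_add S_of_int)
    also have "\<dots> = (\<Sum>p\<in>A. of_int (u q p) * (E (N - T p) * X p z + (1 - E N) * X (s i \<circ> p) z)
      + of_int (u q (s i \<circ> p)) * (E (T p) * X (s i \<circ> p) z))"
      using SX z by (intro sum.cong refl) (simp only:)
    finally show ?thesis .
  qed
  show ?thesis unfolding intertwines_def
  proof (intro ballI conjI)
    fix z assume z: "z \<in> W"
    show "S (?Y y) z = E (N - R) * ?Y y z + (1 - E N) * ?Y ?sy z"
      unfolding SY[OF disjI1[OF refl] z] unfolding YZ[OF disjI1[OF refl]] YZ[OF disjI2[OF refl]] sum_distrib_left sum.distrib[symmetric]
    proof (rule sum.cong[OF refl])
      fix p assume "p \<in> A"
      then have "block (T p) R (u y p) (u y (s i \<circ> p)) (u ?sy p) (u ?sy (s i \<circ> p))"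
        using bl Z by (auto simp: A_def)
      then have b1: "of_int (u y p) * E (N - T p) = E (N - R) * of_int (u y p) + (1 - E N) * of_int (u ?sy p)"
        and b2: "of_int (u y p) * (1 - E N) + of_int (u y (s i \<circ> p)) * E (T p)
          = E (N - R) * of_int (u y (s i \<circ> p)) + (1 - E N) * of_int (u ?sy (s i \<circ> p))"
        by (auto simp: block_def)
      have "of_int (u y p) * (E (N - T p) * X p z + (1 - E N) * X (s i \<circ> p) z)
          + of_int (u y (s i \<circ> p)) * (E (T p) * X (s i \<circ> p) z)
        = (of_int (u y p) * E (N - T p)) * X p z
          + (of_int (u y p) * (1 - E N) + of_int (u y (s i \<circ> p)) * E (T p)) * X (s i \<circ> p) z"
        by (simp only: distrib_left distrib_right mult.assoc add.assoc)
      then show "of_int (u y p) * (E (N - T p) * X p z + (1 - E N) * X (s i \<circ> p) z)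
          + of_int (u y (s i \<circ> p)) * (E (T p) * X (s i \<circ> p) z)
        = E (N - R) * (of_int (u y p) * X p z + of_int (u y (s i \<circ> p)) * X (s i \<circ> p) z)
          + (1 - E N) * (of_int (u ?sy p) * X p z + of_int (u ?sy (s i \<circ> p)) * X (s i \<circ> p) z)"
        unfolding b1 b2 by (simp only: distrib_left distrib_right mult.assoc add_ac)
    qed
    show "S (?Y ?sy) z = E R * ?Y ?sy z"
      unfolding SY[OF disjI2[OF refl] z] unfolding YZ[OF disjI2[OF refl]] sum_distrib_left
    proof (rule sum.cong[OF refl])
      fix p assume "p \<in> A"
      then have "block (T p) R (u y p) (u y (s i \<circ> p)) (u ?sy p) (u ?sy (s i \<circ> p))"
        using bl Z by (auto simp: A_def)
      then have b3: "of_int (u ?sy p) * E (N - T p) = E R * of_int (u ?sy p)"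
        and b4: "of_int (u ?sy p) * (1 - E N) + of_int (u ?sy (s i \<circ> p)) * E (T p) = E R * of_int (u ?sy (s i \<circ> p))"
        by (auto simp: block_def)
      have "of_int (u ?sy p) * (E (N - T p) * X p z + (1 - E N) * X (s i \<circ> p) z)
          + of_int (u ?sy (s i \<circ> p)) * (E (T p) * X (s i \<circ> p) z)
        = (of_int (u ?sy p) * E (N - T p)) * X p z
          + (of_int (u ?sy p) * (1 - E N) + of_int (u ?sy (s i \<circ> p)) * E (T p)) * X (s i \<circ> p) z"
        by (simp only: distrib_left distrib_right mult.assoc add.assoc)
      then show "of_int (u ?sy p) * (E (N - T p) * X p z + (1 - E N) * X (s i \<circ> p) z)
          + of_int (u ?sy (s i \<circ> p)) * (E (T p) * X (s i \<circ> p) z)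
        = E R * (of_int (u ?sy p) * X p z + of_int (u ?sy (s i \<circ> p)) * X (s i \<circ> p) z)"
        unfolding b3 b4 by (simp only: distrib_left mult.assoc)
    qed
  qed
qed

end

end

subsection \<open>The local intertwining relation\<close>

text \<open>For a path direction \<open>y\<close> at time \<open>k / N\<close>, the values \<open>T / N\<close> with \<open>T\<close> one of the following are the
  fractional part of \<open>(k / N) \<langle>y\<lambda>, \<alpha>\<^sub>i\<^sup>\<or>\<rangle>\<close> taken in \<open>(0, 1]\<close> and in \<open>[0, 1)\<close>, respectively;
  only for \<open>s\<^sub>i y\<lambda> = y\<lambda>\<close> the second one is \<open>1\<close>.\<close>

definition frac_left :: "int \<Rightarrow> int \<Rightarrow> int" where
  "frac_left N m = (if N dvd m then N else m mod N)"

definition frac_right :: "int \<Rightarrow> int \<Rightarrow> int \<Rightarrow> int" where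
  "frac_right N m c = (if c = 0 then N else m mod N)"

lemma Ints_quotient_iff:
  fixes N k m :: int assumes "N > 0"
  shows "(of_int k / of_int N :: rat) * of_int m \<in> \<int> \<longleftrightarrow> N dvd k * m"
proof -
  have "(of_int k / of_int N :: rat) * of_int m = of_int (k * m) / of_int N" by simp
  then show ?thesis using assms of_int_div_of_int_in_Ints_iff[of "k * m" N, where 'a = rat] by auto
qed

lemma mod_sum_eq:
  fixes N a b :: int assumes "N > 0" "N dvd a + b" "\<not> N dvd a"
  shows "a mod N + b mod N = N"
proof -
  have "(a mod N + b mod N) mod N = 0" using assms(2) by (simp add: mod_add_eq)
  then have d: "N dvd a mod N + b mod N" by auto
  have p: "a mod N > 0" using assms by (simp add: dvd_eq_mod_eq_0 order_less_le)
  have "a mod N < N" "b mod N < N" "b mod N \<ge> 0" using assms by auto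
  then have "0 < a mod N + b mod N" "a mod N + b mod N < 2 * N" using p by linarith+
  moreover from d obtain q where q: "a mod N + b mod N = N * q" by auto
  ultimately have q': "0 < N * q" "N * q < N * 2" by linarith+
  have "0 < q" using q'(1) assms(1) by (simp add: zero_less_mult_iff)
  moreover have "q < 2" using q'(2) assms(1) by (intro mult_left_less_imp_less[of N q 2]) auto
  ultimately have "q = 1" by simp
  then show ?thesis using q by simp
qed

lemma mod_diff_eq': fixes N a b :: int assumes "N dvd a - b" shows "a mod N = b mod N"
  using assms by (simp add: mod_eq_dvd_iff)

context dominant_datum
begin

definition dsign :: "rat \<Rightarrow> ('n weight \<Rightarrow> 'n weight) \<Rightarrow> ('n weight \<Rightarrow> 'n weight) \<Rightarrow> int" where
  "dsign b y z = (if down_rel b y z then (- 1) ^ (\<ell> y - \<ell> z) else 0)"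

context
  fixes i :: 'i and N k :: int and y z :: "'n weight \<Rightarrow> 'n weight"
  assumes i: "i \<in> I" and N: "N > 0" and yW: "y \<in> W" and zW: "z \<in> W" and ay: "asc i y" and az: "asc i z"
begin

abbreviation (input) bb :: rat where "bb \<equiv> of_int k / of_int N"
abbreviation (input) sy where "sy \<equiv> s i \<circ> y"
abbreviation (input) sz where "sz \<equiv> s i \<circ> z"

lemma hyz: "h i y \<ge> 0" "h i z \<ge> 0"
  using h_asc i yW zW ay az by auto

lemma cle_cong_diff:
  "cle bb z y \<Longrightarrow> N dvd k * h i z - k * h i y" "cle bb sz sy \<Longrightarrow> N dvd k * h i z - k * h i y"
  "cle bb sz y \<Longrightarrow> N dvd k * h i z + k * h i y" "cle bb z sy \<Longrightarrow> N dvd k * h i z + k * h i y"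
proof -
  note d = cle_h_diff[OF _ i, of bb, unfolded Ints_quotient_iff[OF N]]
  show "cle bb z y \<Longrightarrow> N dvd k * h i z - k * h i y" using d[of z y] by (simp add: right_diff_distrib)
  show "cle bb z sy \<Longrightarrow> N dvd k * h i z + k * h i y"
    using d[of z sy] by (simp add: h_srefl[OF i, unfolded comp_apply] distrib_left)
  show "N dvd k * h i z - k * h i y" if "cle bb sz sy"
  proof -
    have "N dvd - (k * h i z - k * h i y)"
      using d[OF that] by (simp add: h_srefl[OF i, unfolded comp_apply] algebra_simps)
    then show ?thesis by (simp only: dvd_minus_iff)
  qed
  show "N dvd k * h i z + k * h i y" if "cle bb sz y"
  proof -
    have e: "k * (h i sz - h i y) = - (k * h i z + k * h i y)"
      by (simp add: h_srefl[OF i, unfolded comp_apply] algebra_simps)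
    show ?thesis using d[OF that] unfolding e by (simp only: dvd_minus_iff)
  qed
qed

lemma cle_dvd_iff:
  assumes "cle bb z y \<or> cle bb sz y \<or> cle bb z sy \<or> cle bb sz sy"
  shows "N dvd k * h i z \<longleftrightarrow> N dvd k * h i y"
  using assms cle_cong_diff by (meson dvd_add_left_iff dvd_add_right_iff dvd_diff_commute dvd_diff_left_iff dvd_diff_right_iff)

text \<open>At an integral time the passages from z to \<open>s i \<circ> z\<close> and from y to
  \<open>s i \<circ> y\<close> are themselves relations, so transitivity identifies most of the four
  possibilities. The one from \<open>s i \<circ> z\<close> to y joins them when a pairing
  vanishes.\<close>

lemma cle_integral:
  assumes "N dvd k * h i z" "N dvd k * h i y"
  shows "cle bb z sy \<longleftrightarrow> cle bb z y" "cle bb sz sy \<longleftrightarrow> cle bb z y" "cle bb sz y \<Longrightarrow> cle bb z y"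
    "h i y = 0 \<or> h i z = 0 \<Longrightarrow> cle bb z y \<Longrightarrow> cle bb sz y"
proof -
  have zs: "cle bb z sz" and ys: "cle bb y sy"
    using cle_asc[of z i bb] cle_asc[of y i bb] hyz assms zW yW i Ints_quotient_iff[OF N] by auto
  have W: "sy \<in> W" "sz \<in> W" using i yW zW by auto
  have CA: "cle bb z y" if "cle bb z sy"
  proof (cases "h i y = 0")
    case True
    then show ?thesis using that cle_cong[OF zW W(1) zW yW refl h_0_fix[of i y, OF True]] by blast
  next
    case False
    then have "cle bb z (s i \<circ> sy)" using cle_lift_diff(3)[OF that i] hyz h_srefl[OF i, of y] by simp
    then show ?thesis using i by simp
  qed
  show 1: "cle bb z sy \<longleftrightarrow> cle bb z y" using CA cle_trans[OF _ ys] by blast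
  show 2: "cle bb sz sy \<longleftrightarrow> cle bb z y" using CA cle_trans[OF zs] cle_lift_same[OF _ i] hyz by auto
  show "cle bb sz y \<Longrightarrow> cle bb z y" using cle_trans[OF zs] by blast
  show "cle bb sz y" if "h i y = 0 \<or> h i z = 0" "cle bb z y"
    using that(1)
  proof
    assume "h i y = 0"
    then show ?thesis using that(2) 2 cle_cong[OF W(2,1) W(2) yW refl h_0_fix[of i y]] by blast
  next
    assume "h i z = 0"
    then show ?thesis using that(2) cle_cong[OF W(2) yW zW yW h_0_fix[of i z] refl] by blast
  qed
qed

text \<open>A relation from an ascent to a descent forces integrality by
  \<open>cle_lift_diff\<close>. At the other times \<open>s i\<close> only transports relations
  whose ends go the same way.\<close>

lemma cle_nonintegral:
  assumes "\<not> N dvd k * h i z" "\<not> N dvd k * h i y"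
  shows "\<not> cle bb z sy" "cle bb sz sy \<longleftrightarrow> cle bb z y"
proof -
  have pos: "h i y > 0" "h i z > 0" using assms hyz by (auto simp: order_less_le)
  show "\<not> cle bb z sy"
    using cle_lift_diff(1)[of bb z sy i] i pos hyz assms h_srefl[OF i, of y] Ints_quotient_iff[OF N] by auto
  have "cle bb z y" if "cle bb sz sy"
  proof -
    have "cle bb (s i \<circ> sz) (s i \<circ> sy)" using cle_lift_same[OF that i] pos h_srefl[OF i] by simp
    then show ?thesis using i by simp
  qed
  then show "cle bb sz sy \<longleftrightarrow> cle bb z y" using cle_lift_same[OF _ i] hyz by auto
qed

text \<open>At a non-integral time the lower left entry is 0 and the diagonal entries agree; a
  nonzero diagonal forces T = R, a nonzero upper right entry forces T + R = N. At an integral time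
  with \<open>h i y > 0\<close> all entries but the upper right one coincide. With
  \<open>h i y = 0\<close>, \<open>up_shift_0\<close> says how the lift of z splits according to the
  lift of \<open>s i \<circ> z\<close>.\<close>

lemma up_block:
  "block i N (frac_left N (k * h i z)) (frac_right N (k * h i y) (h i y))
    (of_bool (up_rel bb y z)) (of_bool (up_rel bb y sz)) (of_bool (up_rel bb sy z)) (of_bool (up_rel bb sy sz))"
proof -
  note up_shift = up_shift_pos[OF i yW zW ay az] and shift0 = up_shift_0[OF i yW zW ay az]
  consider (none) "\<not> up_rel bb y z" "\<not> up_rel bb y sz" "\<not> up_rel bb sy z" "\<not> up_rel bb sy sz"
    | (int) "N dvd k * h i z" "N dvd k * h i y" | (non) "\<not> N dvd k * h i z" "\<not> N dvd k * h i y"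
    using cle_dvd_iff by (auto simp: up_rel_def)
  then show ?thesis
  proof cases
    case none
    then show ?thesis by (intro blockI(1)[OF i]) auto
  next
    case non
    then have pos: "h i y > 0" using hyz by (auto simp: order_less_le)
    have c: "\<not> up_rel bb sy z" and ad: "up_rel bb sy sz \<longleftrightarrow> up_rel bb y z"
      using cle_nonintegral[OF non] up_shift[OF pos] by (auto simp: up_rel_def)
    have TR: "frac_left N (k * h i z) = k * h i z mod N" "frac_right N (k * h i y) (h i y) = k * h i y mod N"
      using non pos by (auto simp: frac_left_def frac_right_def)
    have a: "k * h i z mod N = k * h i y mod N" if "up_rel bb y z"
      using that cle_cong_diff(1) mod_diff_eq' by (auto simp: up_rel_def)
    have b: "k * h i z mod N + k * h i y mod N = N" if "up_rel bb y sz"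
      using that cle_cong_diff(3) mod_sum_eq[OF N] non by (auto simp: up_rel_def)
    consider "up_rel bb y z" "up_rel bb y sz" | "up_rel bb y z" "\<not> up_rel bb y sz"
      | "\<not> up_rel bb y z" "up_rel bb y sz" | "\<not> up_rel bb y z" "\<not> up_rel bb y sz" by blast
    then show ?thesis
    proof cases
      case 1
      then show ?thesis unfolding TR using a b c ad by (intro blockI(6)[OF i]) auto
    next
      case 2
      then show ?thesis unfolding TR using a c ad by (intro blockI(5)[OF i]) auto
    next
      case 3
      then show ?thesis unfolding TR using b c ad by (intro blockI(4)[OF i]) auto
    next
      case 4
      then show ?thesis using c ad by (intro blockI(1)[OF i]) auto
    qed
  next
    case int
    show ?thesis
    proof (cases "h i y > 0")
      case True
      have "up_rel bb sy z \<longleftrightarrow> up_rel bb y z" "up_rel bb sy sz \<longleftrightarrow> up_rel bb y z"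
        using cle_integral(1,2)[OF int] up_shift[OF True] by (auto simp: up_rel_def)
      then show ?thesis using int True
        by (intro blockI(2)[OF i]) (auto simp: frac_left_def frac_right_def)
    next
      case False
      then have h0: "h i y = 0" using hyz by simp
      have TR: "frac_left N (k * h i z) = N" "frac_right N (k * h i y) (h i y) = N"
        using int h0 by (auto simp: frac_left_def frac_right_def)
      show ?thesis
      proof (cases "cle bb z y")
        case True
        then have all: "cle bb sz y" "cle bb z sy" "cle bb sz sy" using cle_integral[OF int] h0 by auto
        have "mr sz \<preceq> mr y" using all(1) bch_ble[of "mr sz" "mr y" bb] i zW by (auto simp: cle_def)
        note sh = shift0[OF h0 this]
        have c: "\<not> up_rel bb sy z" using sh by (simp add: up_rel_def)
        consider "up_rel bb y z" "up_rel bb y sz" "\<not> up_rel bb sy sz"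
          | "up_rel bb y z" "\<not> up_rel bb y sz" "up_rel bb sy sz"
          | "\<not> up_rel bb y z" "\<not> up_rel bb y sz" "\<not> up_rel bb sy sz"
          using sh True all by (auto simp: up_rel_def)
        then show ?thesis
        proof cases
          case 1
          then show ?thesis unfolding TR using c by (intro blockI(7)[OF i]) auto
        next
          case 2
          then show ?thesis unfolding TR using c by (intro blockI(5)[OF i]) auto
        next
          case 3
          then show ?thesis using c by (intro blockI(1)[OF i]) auto
        qed
      next
        case False
        then show ?thesis using cle_integral[OF int]
          by (intro blockI(1)[OF i]) (auto simp: up_rel_def)
      qed
    qed
  qed
qed

text \<open>The same regimes as in \<open>up_block\<close>, but the sign of the pairing is now
  tested at z, whose coset the lift enters. The signs turn equal entries into opposite ones whenever
  the length difference changes by one.\<close>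

lemma down_block:
  "block i N (frac_right N (- k * h i z) (h i z)) (frac_left N (- k * h i y))
    (dsign bb y z) (dsign bb y sz) (dsign bb sy z) (dsign bb sy sz)"
proof -
  note down_shift = down_shift_pos[OF i yW zW ay az] and shift0 = down_shift_0[OF i yW zW ay az]
  have len: "\<ell> sy = \<ell> y + 1" "\<ell> sz = \<ell> z + 1" using len_asc i yW zW ay az by auto
  \<comment> \<open>The exponents are truncated differences, so these parity shifts rely on the
    Bruhat relation contained in each lift.\<close>
  have a1: "\<ell> sy - \<ell> z = Suc (\<ell> y - \<ell> z)" if "down_rel bb y z"
    using ble_len_le[OF is_down_le[OF down_relD(1)[OF that]]] len by simp
  have b1: "\<ell> y - \<ell> z = Suc (\<ell> y - \<ell> sz)" if "down_rel bb y sz"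
    using ble_len_le[OF is_down_le[OF down_relD(1)[OF that]]] len by simp
  have d1: "\<ell> sy - \<ell> sz = \<ell> y - \<ell> z" using len by simp
  consider (none) "\<not> down_rel bb y z" "\<not> down_rel bb y sz" "\<not> down_rel bb sy z" "\<not> down_rel bb sy sz"
    | (int) "N dvd k * h i z" "N dvd k * h i y" | (non) "\<not> N dvd k * h i z" "\<not> N dvd k * h i y"
    using cle_dvd_iff by (auto simp: down_rel_def)
  then show ?thesis
  proof cases
    case none
    then show ?thesis by (intro blockI(1)[OF i]) (auto simp: dsign_def)
  next
    case non
    then have pos: "h i z > 0" using hyz by (auto simp: order_less_le)
    have c: "\<not> down_rel bb sy z" and ad: "down_rel bb sy sz \<longleftrightarrow> down_rel bb y z"
      using cle_nonintegral[OF non] down_shift[OF pos] by (auto simp: down_rel_def)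
    have TR: "frac_right N (- k * h i z) (h i z) = - (k * h i z) mod N"
      "frac_left N (- k * h i y) = - (k * h i y) mod N"
      using non pos by (auto simp: frac_left_def frac_right_def)
    have a: "- (k * h i z) mod N = - (k * h i y) mod N" if "down_rel bb y z"
      using that cle_cong_diff(1) mod_diff_eq'[of N "k * h i z" "k * h i y"]
      by (auto simp: down_rel_def intro: mod_minus_cong)
    have b: "- (k * h i z) mod N + - (k * h i y) mod N = N" if "down_rel bb y sz"
    proof (rule mod_sum_eq[OF N])
      have "N dvd - (k * h i z + k * h i y)"
        using cle_cong_diff(3) that by (simp only: dvd_minus_iff down_rel_def)
      then show "N dvd - (k * h i z) + - (k * h i y)" by (simp add: algebra_simps)
    qed (use non in simp)
    consider "down_rel bb y z" "down_rel bb y sz" | "down_rel bb y z" "\<not> down_rel bb y sz"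
      | "\<not> down_rel bb y z" "down_rel bb y sz" | "\<not> down_rel bb y z" "\<not> down_rel bb y sz" by blast
    then show ?thesis
    proof cases
      case 1
      then show ?thesis unfolding TR using a b c ad d1 by (intro blockI(6)[OF i]) (auto simp: dsign_def)
    next
      case 2
      then show ?thesis unfolding TR using a c ad d1 by (intro blockI(5)[OF i]) (auto simp: dsign_def)
    next
      case 3
      then show ?thesis unfolding TR using b c ad d1 by (intro blockI(4)[OF i]) (auto simp: dsign_def)
    next
      case 4
      then show ?thesis using c ad by (intro blockI(1)[OF i]) (auto simp: dsign_def)
    qed
  next
    case int
    then have fl: "frac_left N (- k * h i y) = N" by (simp add: frac_left_def)
    show ?thesis
    proof (cases "h i z > 0")
      case True
      have ca: "down_rel bb sy z \<longleftrightarrow> down_rel bb y z" "down_rel bb sy sz \<longleftrightarrow> down_rel bb y z"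
        using cle_integral(1,2)[OF int] down_shift[OF True] by (auto simp: down_rel_def)
      have "frac_right N (- k * h i z) (h i z) = 0" using int True by (simp add: frac_right_def)
      then show ?thesis unfolding fl using ca a1 d1
        by (intro blockI(3)[OF i]) (auto simp: dsign_def)
    next
      case False
      then have h0: "h i z = 0" using hyz by simp
      have TR: "frac_right N (- k * h i z) (h i z) = N" using h0 by (simp add: frac_right_def)
      show ?thesis
      proof (cases "cle bb z y")
        case True
        then have all: "cle bb sz y" "cle bb z sy" "cle bb sz sy" using cle_integral[OF int] h0 by auto
        have "mr z \<preceq> mr y" using True bch_ble[of "mr z" "mr y" bb] zW by (auto simp: cle_def)
        note sh = shift0[OF h0 this]
        have c: "\<not> down_rel bb sy z" using sh by (simp add: down_rel_def)
        consider "down_rel bb y z" "\<not> down_rel bb y sz" "down_rel bb sy sz"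
          | "\<not> down_rel bb y z" "down_rel bb y sz" "down_rel bb sy sz"
          | "\<not> down_rel bb y z" "\<not> down_rel bb y sz" "\<not> down_rel bb sy sz"
          using sh True all by (auto simp: down_rel_def)
        then show ?thesis
        proof cases
          case 1
          then show ?thesis unfolding TR fl using c d1 by (intro blockI(5)[OF i]) (auto simp: dsign_def)
        next
          case 2
          then show ?thesis unfolding TR fl using c d1 b1 by (intro blockI(8)[OF i]) (auto simp: dsign_def)
        next
          case 3
          then show ?thesis using c by (intro blockI(1)[OF i]) (auto simp: dsign_def)
        qed
      next
        case False
        then show ?thesis using cle_integral[OF int]
          by (intro blockI(1)[OF i]) (auto simp: down_rel_def dsign_def)
      qed
    qed
  qed
qed

end

end

text \<open>Since c divides N, the multiples of c have residues that are multiples of c, so adding c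
  reaches N exactly and never jumps over it. The special value N of \<open>frac_right\<close> at c =
  0 makes the identity hold there too.\<close>

lemma frac_right_step:
  fixes N c m :: int
  assumes "N > 0" "c = 0 \<or> c dvd N" "c \<ge> 0"
  shows "frac_right N (m * c) c + c = frac_left N ((m + 1) * c)"
proof (cases "c = 0")
  case False
  then have c: "c > 0" using assms by simp
  obtain q where q: "N = c * q" using False assms by (auto elim: dvdE)
  have qp: "q > 0" using assms(1) c unfolding q by (simp add: zero_less_mult_iff)
  have e: "(x * c) mod N = c * (x mod q)" for x unfolding q by (simp add: mult.commute[of x c])
  have d: "N dvd (m + 1) * c \<longleftrightarrow> q dvd m + 1" unfolding q using c by (simp add: mult.commute[of _ c])
  have "m mod q + 1 = (if q dvd m + 1 then q else (m + 1) mod q)"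
  proof (cases "m mod q + 1 = q")
    case True
    then have "q dvd m + 1" by (metis dvd_eq_mod_eq_0 mod_add_left_eq mod_self)
    then show ?thesis using True by simp
  next
    case False
    then have lt: "m mod q + 1 < q" using pos_mod_bound[OF qp, of m] by simp
    have "(m + 1) mod q = (m mod q + 1) mod q" by (simp add: mod_add_left_eq)
    also have "\<dots> = m mod q + 1" using lt qp by (intro mod_pos_pos_trivial) auto
    finally have f: "(m + 1) mod q = m mod q + 1" .
    then have "(m + 1) mod q > 0" using pos_mod_sign[OF qp, of m] by linarith
    then have "\<not> q dvd m + 1" by (auto simp: dvd_eq_mod_eq_0)
    then show ?thesis using f by simp
  qed
  from arg_cong[OF this, of "(*) c"]
  have "c * (m mod q) + c = c * (if q dvd m + 1 then q else (m + 1) mod q)"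
    by (simp only: distrib_left mult_1_right)
  then show ?thesis using False d by (simp add: frac_left_def frac_right_def e) (simp add: q)
qed (simp add: frac_left_def frac_right_def)

lemma frac_left_step:
  fixes N c m :: int
  assumes "N > 0" "c = 0 \<or> c dvd N" "c \<ge> 0"
  shows "frac_left N (- m * c) - c = frac_right N (- (m + 1) * c) c"
  using frac_right_step[OF assms, of "- (m + 1)"] by simp

context kac_moody_datum
begin

lemma lam_scale_srefl: "s i (frag_cmul c \<mu>) = frag_cmul c (s i \<mu>)" if "i \<in> I"
  using weyl_cmul[OF srefl_weyl[OF that]] .

lemma scale_mult: "act_RT (frag_cmul c) (f * g) = act_RT (frag_cmul c) f * act_RT (frag_cmul c) g"
  by (rule act_RT_mult) (rule frag_cmul_distrib2)

text \<open>Multiplying all exponents by N is an injective ring endomorphism that commutes with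
  \<open>s i\<close> and sends \<open>E 1\<close> to \<open>E N\<close>, so the scaled relation can
  be pulled back.\<close>

lemma intertwines_scale:
  assumes i: "i \<in> I" and N: "N > 0"
    and X: "intertwines i N N (\<lambda>y z. act_RT (frag_cmul N) (P y z)) y"
  shows "intertwines i 1 1 P y"
proof -
  let ?\<psi> = "act_RT (frag_cmul N) :: 'n RT \<Rightarrow> 'n RT"
  have sg: "act_RT (s i) (?\<psi> f) = ?\<psi> (act_RT (s i) f)" for f
    unfolding act_RT_comp by (rule arg_cong[where f = "\<lambda>w. act_RT w f"]) (simp add: fun_eq_iff lam_scale_srefl i)
  have E: "E i N = ?\<psi> (E i 1)" by (simp add: E_def[OF i] i)
  have one: "?\<psi> 1 = 1" by (rule act_RT_1) simp
  have S: "S i N (\<lambda>z. ?\<psi> (g z)) z = ?\<psi> (S i 1 g z)" for g z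
    by (simp add: S_def i sg E scale_mult act_RT_add act_RT_diff one)
  have inj: "?\<psi> f = ?\<psi> g \<longleftrightarrow> f = g" for f g
    using N by (intro act_RT_eq_iff inj_frag_cmul) auto
  show ?thesis unfolding intertwines_def[OF i]
  proof (intro ballI conjI)
    fix z assume z: "z \<in> W"
    have "?\<psi> (S i 1 (P y) z) = ?\<psi> (E i 0 * P y z + (1 - E i 1) * P (s i \<circ> y) z)"
      using X z unfolding intertwines_def[OF i] S E
      by (simp add: scale_mult act_RT_add act_RT_diff one E_0[OF i])
    then show "S i 1 (P y) z = E i (1 - 1) * P y z + (1 - E i 1) * P (s i \<circ> y) z" by (simp add: inj)
    have "?\<psi> (S i 1 (P (s i \<circ> y)) z) = ?\<psi> (E i 1 * P (s i \<circ> y) z)"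
      using X z unfolding intertwines_def[OF i] S E by (simp add: scale_mult)
    then show "S i 1 (P (s i \<circ> y)) z = E i 1 * P (s i \<circ> y) z" by (simp add: inj)
  qed
qed

text \<open>The rows are single basis elements, on which \<open>s i\<close> acts by the untwisted
  matrix. This is the start of every matrix product.\<close>

lemma intertwines_id:
  assumes i: "i \<in> I" and p: "p \<in> W" "asc i p"
  shows "intertwines i N N (\<lambda>p z. of_bool (p = z)) p"
  unfolding intertwines_def[OF i]
proof (intro ballI conjI)
  fix z assume z: "z \<in> W"
  have ss: "s i \<circ> z = p \<longleftrightarrow> z = s i \<circ> p" using i by (metis srefl_comp_left)
  have d: "\<not> asc i (s i \<circ> p)" using not_asc p i by blast
  have one: "act_RT (s i) 1 = 1" using weyl_0[OF srefl_weyl[OF i]] by (rule act_RT_1)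
  have ne: "p \<noteq> s i \<circ> p" using p by auto
  show "S i N (\<lambda>z. of_bool (p = z)) z
      = E i (N - N) * of_bool (p = z) + (1 - E i N) * of_bool (s i \<circ> p = z)"
  proof (cases "asc i z")
    case True
    then have "z \<noteq> s i \<circ> p" using d by blast
    then show ?thesis using True by (auto simp: S_def[OF i] E_0[OF i] one)
  next
    case False
    then have "z \<noteq> p" using p by blast
    then show ?thesis using False ss by (auto simp: S_def[OF i] one)
  qed
  show "S i N (\<lambda>z. of_bool (s i \<circ> p = z)) z = E i N * of_bool (s i \<circ> p = z)"
  proof (cases "asc i z")
    case True
    then have "z \<noteq> s i \<circ> p" using d by blast
    then show ?thesis using True by (auto simp: S_def[OF i])
  next
    case False
    then have "z \<noteq> p" using p by blast
    then have "s i \<circ> p \<noteq> s i \<circ> z" using i by (metis srefl_comp_left)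
    then show ?thesis using False by (auto simp: S_def[OF i] one)
  qed
qed

end

context dominant_datum
begin

subsection \<open>Sums over walks\<close>

text \<open>The sign \<open>c\<close> is \<open>1\<close> for the dominant and \<open>-1\<close> for the antidominant formula.\<close>

definition step_coef :: "int \<Rightarrow> (rat \<Rightarrow> ('n weight \<Rightarrow> 'n weight) \<Rightarrow> ('n weight \<Rightarrow> 'n weight) \<Rightarrow> bool)
    \<Rightarrow> rat \<Rightarrow> ('n weight \<Rightarrow> 'n weight) \<Rightarrow> ('n weight \<Rightarrow> 'n weight) \<Rightarrow> int" where
  "step_coef c R b y p = (if R b y p then c ^ (\<ell> y - \<ell> p) else 0)"

text \<open>The interval before time (k + 1)/N is spent in direction p, and the jump from p to y
  closes it. \<open>S0\<close> is the matrix at time 0: the lift of z for the dominant formula, the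
  identity for the antidominant one.\<close>

primrec walk :: "int \<Rightarrow> (rat \<Rightarrow> ('n weight \<Rightarrow> 'n weight) \<Rightarrow> ('n weight \<Rightarrow> 'n weight) \<Rightarrow> bool)
    \<Rightarrow> (('n weight \<Rightarrow> 'n weight) \<Rightarrow> ('n weight \<Rightarrow> 'n weight) \<Rightarrow> bool) \<Rightarrow> int
    \<Rightarrow> nat \<Rightarrow> ('n weight \<Rightarrow> 'n weight) \<Rightarrow> ('n weight \<Rightarrow> 'n weight) \<Rightarrow> 'n RT" where
  "walk c R S0 N 0 = (\<lambda>y z. of_bool (S0 z y))"
| "walk c R S0 N (Suc k) = (\<lambda>y z. \<Sum>p\<in>{p \<in> W. p \<preceq> y}.
     of_int (step_coef c R (of_int (int (Suc k)) / of_int N) y p)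
       * (ex (frag_cmul c (p lam)) * walk c R S0 N k p z))"

lemma step_coef_up: "step_coef 1 up_rel b y p = of_bool (up_rel b y p)"
  by (simp add: step_coef_def)

lemma step_coef_down: "step_coef (- 1) down_rel b y p = dsign b y p"
  by (simp add: step_coef_def dsign_def)

text \<open>What \<open>frac_right_step\<close> asks of N for every direction used by a walk that
  ends below v.\<close>

definition h_divides :: "('n weight \<Rightarrow> 'n weight) \<Rightarrow> int \<Rightarrow> bool" where
  "h_divides v N \<longleftrightarrow> (\<forall>i\<in>I. \<forall>y\<in>W. s i \<circ> y \<preceq> v \<longrightarrow> asc i y \<longrightarrow> h i y = 0 \<or> h i y dvd N)"

context
  fixes N :: int and v :: "'n weight \<Rightarrow> 'n weight"
  assumes N: "N > 0" and hd: "h_divides v N"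
begin

lemma diag_scaled:
  assumes "i \<in> I" "intertwines i N T X y"
  shows "intertwines i N (T + c * h i y) (\<lambda>y z. ex (frag_cmul c (y lam)) * X y z) y"
  by (rule intertwines_diag[OF assms]) (use assms in \<open>simp_all add: lam_scale_srefl cr_cmul\<close>)

lemma intertwines_up_walk:
  assumes i: "i \<in> I"
  shows "y \<in> W \<Longrightarrow> asc i y \<Longrightarrow> s i \<circ> y \<preceq> v \<Longrightarrow>
    intertwines i N (frac_right N (int k * h i y) (h i y)) (walk 1 up_rel is_up N k) y"
proof (induction k arbitrary: y)
  case 0
  \<comment> \<open>The initial lift is the jump \<open>up_rel 0\<close> applied to the identity
    matrix, because the integrality condition is void at time 0. So \<open>up_block\<close> at k = 0
    covers the start.\<close>
  have "intertwines i N (frac_right N (0 * h i y) (h i y))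
      (\<lambda>y z. \<Sum>p\<in>{p \<in> W. p \<preceq> y}. of_int (of_bool (up_rel 0 y p)) * of_bool (p = z)) y"
  proof (rule intertwines_block[OF i 0(1,2), where T = "\<lambda>p. frac_left N (0 * h i p)"])
    show "intertwines i N (frac_left N (0 * h i p)) (\<lambda>p z. of_bool (p = z)) p" if "p \<in> W" "asc i p" for p
      using intertwines_id[OF i that] by (simp add: frac_left_def)
    show "block i N (frac_left N (0 * h i p)) (frac_right N (0 * h i y) (h i y))
        (of_bool (up_rel 0 y p)) (of_bool (up_rel 0 y (s i \<circ> p)))
        (of_bool (up_rel 0 (s i \<circ> y) p)) (of_bool (up_rel 0 (s i \<circ> y) (s i \<circ> p)))"
      if "p \<in> W" "asc i p" for p
      using up_block[OF i N 0(1) that(1) 0(2) that(2), of 0] by simp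
  qed (auto dest: up_relD is_up_le split: if_splits)
  moreover have "walk 1 up_rel is_up N 0
      = (\<lambda>y z. \<Sum>p\<in>{p \<in> W. p \<preceq> y}. of_int (of_bool (up_rel 0 y p)) * of_bool (p = z))"
  proof (intro ext)
    fix y z
    have u: "up_rel 0 y z \<longleftrightarrow> is_up z y"
      using ble_cle_0 is_up_le by (auto simp: up_rel_def)
    have "(\<Sum>p\<in>{p \<in> W. p \<preceq> y}. of_int (of_bool (up_rel 0 y p)) * of_bool (p = z))
      = (\<Sum>p\<in>{p \<in> W. p \<preceq> y}. if p = z then of_bool (up_rel 0 y z) else 0 :: 'n RT)"
      by (rule sum.cong) auto
    also have "\<dots> = (if z \<in> {p \<in> W. p \<preceq> y} then of_bool (up_rel 0 y z) else 0)"
      using finite_below by (rule sum.delta)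
    also have "\<dots> = of_bool (is_up z y)" unfolding u using is_up_le is_up_weyl by auto
    finally show "walk 1 up_rel is_up N 0 y z
      = (\<Sum>p\<in>{p \<in> W. p \<preceq> y}. of_int (of_bool (up_rel 0 y p)) * of_bool (p = z))" by simp
  qed
  ultimately show ?case by simp
next
  case (Suc k)
  show ?case
    unfolding walk.simps step_coef_up
  proof (rule intertwines_block[OF i Suc(2,3), where T = "\<lambda>p. frac_left N (int (Suc k) * h i p)"])
    fix p assume p: "p \<in> W" "asc i p"
    show "intertwines i N (frac_left N (int (Suc k) * h i p))
        (\<lambda>p z. ex (frag_cmul 1 (p lam)) * walk 1 up_rel is_up N k p z) p" if "s i \<circ> p \<preceq> s i \<circ> y"
    proof -
      have spv: "s i \<circ> p \<preceq> v" using that Suc(4) ble_trans by blast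
      have "h i p = 0 \<or> h i p dvd N" using hd p spv i unfolding h_divides_def by blast
      then have "frac_right N (int k * h i p) (h i p) + 1 * h i p = frac_left N (int (Suc k) * h i p)"
        using frac_right_step[OF N, of "h i p" "int k"] h_asc[OF p(1) i p(2)] by (simp add: add.commute)
      then show ?thesis using diag_scaled[OF i Suc(1)[OF p spv], of 1] by simp
    qed
    show "block i N (frac_left N (int (Suc k) * h i p)) (frac_right N (int (Suc k) * h i y) (h i y))
        (of_bool (up_rel (of_int (int (Suc k)) / of_int N) y p))
        (of_bool (up_rel (of_int (int (Suc k)) / of_int N) y (s i \<circ> p)))
        (of_bool (up_rel (of_int (int (Suc k)) / of_int N) (s i \<circ> y) p))
        (of_bool (up_rel (of_int (int (Suc k)) / of_int N) (s i \<circ> y) (s i \<circ> p)))"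
      using up_block[OF i N Suc(2) p(1) Suc(3) p(2), of "int (Suc k)"] .
  qed (auto dest: up_relD is_up_le split: if_splits)
qed

lemma intertwines_down_walk:
  assumes i: "i \<in> I"
  shows "y \<in> W \<Longrightarrow> asc i y \<Longrightarrow> s i \<circ> y \<preceq> v \<Longrightarrow>
    intertwines i N (frac_left N (- int k * h i y)) (walk (- 1) down_rel (\<lambda>z y. y = z) N k) y"
proof (induction k arbitrary: y)
  case 0
  show ?case using intertwines_id[OF i 0(1,2), of N] by (simp add: frac_left_def)
next
  case (Suc k)
  show ?case
    unfolding walk.simps step_coef_down
  proof (rule intertwines_block[OF i Suc(2,3), where T = "\<lambda>p. frac_right N (- int (Suc k) * h i p) (h i p)"])
    fix p assume p: "p \<in> W" "asc i p"
    show "intertwines i N (frac_right N (- int (Suc k) * h i p) (h i p))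
        (\<lambda>p z. ex (frag_cmul (- 1) (p lam)) * walk (- 1) down_rel (\<lambda>z y. y = z) N k p z) p" if "s i \<circ> p \<preceq> s i \<circ> y"
    proof -
      have spv: "s i \<circ> p \<preceq> v" using that Suc(4) ble_trans by blast
      have "h i p = 0 \<or> h i p dvd N" using hd p spv i unfolding h_divides_def by blast
      then have "frac_left N (- int k * h i p) + - 1 * h i p = frac_right N (- int (Suc k) * h i p) (h i p)"
        using frac_left_step[OF N, of "h i p" "int k"] h_asc[OF p(1) i p(2)] by (simp add: add.commute)
      then show ?thesis using diag_scaled[OF i Suc(1)[OF p spv], of "- 1"] by simp
    qed
    show "block i N (frac_right N (- int (Suc k) * h i p) (h i p)) (frac_left N (- int (Suc k) * h i y))
        (dsign (of_int (int (Suc k)) / of_int N) y p)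
        (dsign (of_int (int (Suc k)) / of_int N) y (s i \<circ> p))
        (dsign (of_int (int (Suc k)) / of_int N) (s i \<circ> y) p)
        (dsign (of_int (int (Suc k)) / of_int N) (s i \<circ> y) (s i \<circ> p))"
      using down_block[OF i N Suc(2) p(1) Suc(3) p(2), of "int (Suc k)"] .
  qed (auto simp: dsign_def dest: down_relD is_down_le split: if_splits)
qed

end

subsection \<open>Partial paths\<close>

text \<open>\<open>pre_path R P bs \<sigma>s y\<close>: a path up to some time after its last breakpoint, together with the
  element \<open>y\<close> of its last direction that is reached by the lifts.\<close>

inductive pre_path :: "(rat \<Rightarrow> ('n weight \<Rightarrow> 'n weight) \<Rightarrow> ('n weight \<Rightarrow> 'n weight) \<Rightarrow> bool)
    \<Rightarrow> (('n weight \<Rightarrow> 'n weight) \<Rightarrow> bool) \<Rightarrow> rat list \<Rightarrow> ('n weight \<Rightarrow> 'n weight) set list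
    \<Rightarrow> ('n weight \<Rightarrow> 'n weight) \<Rightarrow> bool"
  for R P where
  start: "P y \<Longrightarrow> pre_path R P [0] [coset D lam y] y"
| step: "pre_path R P bs \<sigma>s p \<Longrightarrow> last bs < b \<Longrightarrow> b < 1 \<Longrightarrow> R b y p \<Longrightarrow> p lam \<noteq> y lam
    \<Longrightarrow> pre_path R P (bs @ [b]) (\<sigma>s @ [coset D lam y]) y"

lemma pre_path_length: "pre_path R P bs \<sigma>s y \<Longrightarrow> length bs = length \<sigma>s \<and> bs \<noteq> []"
  by (induction rule: pre_path.induct) auto

lemma pre_path_last: "pre_path R P bs \<sigma>s y \<Longrightarrow> last \<sigma>s = coset D lam y"
  by (induction rule: pre_path.induct) auto

lemma pre_path_bounds: "pre_path R P bs \<sigma>s y \<Longrightarrow> sorted_wrt (<) bs \<and> hd bs = 0 \<and> (\<forall>b\<in>set bs. 0 \<le> b \<and> b \<le> last bs \<and> b < 1)"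
proof (induction rule: pre_path.induct)
  case (step bs \<sigma>s p b y)
  then have "bs \<noteq> []" using pre_path_length by blast
  then have "0 \<le> last bs" using step by auto
  then show ?case using step \<open>bs \<noteq> []\<close> by (fastforce simp: sorted_wrt_append)
qed auto

subsection \<open>Scaled positions\<close>

text \<open>N times the position reached at the last listed time. The floors make the scaled times
  integers and are exact when the breakpoints lie on the grid.\<close>

fun wsum :: "int \<Rightarrow> rat list \<Rightarrow> ('n weight \<Rightarrow> 'n weight) set list \<Rightarrow> 'n weight" where
  "wsum N (b # b' # bs) (\<sigma> # \<sigma>s) =
     frag_cmul (\<lfloor>of_int N * b'\<rfloor> - \<lfloor>of_int N * b\<rfloor>) (minrep D \<sigma> lam) + wsum N (b' # bs) \<sigma>s"
| "wsum N bs \<sigma>s = 0"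

lemma wsum_snoc:
  "length bs = length \<sigma>s \<Longrightarrow> wsum N (bs @ [b, b']) (\<sigma>s @ [\<sigma>])
    = wsum N (bs @ [b]) \<sigma>s + frag_cmul (\<lfloor>of_int N * b'\<rfloor> - \<lfloor>of_int N * b\<rfloor>) (minrep D \<sigma> lam)"
proof (induction bs \<sigma>s rule: list_induct2)
  case (Cons x xs y ys)
  then show ?case by (cases xs; cases ys) (auto simp: add.assoc)
qed simp

lemma wsum_lookup:
  assumes "length bs = length \<sigma>s + 1" "\<And>b. b \<in> set bs \<Longrightarrow> of_int N * b \<in> \<int>"
  shows "of_int (Poly_Mapping.lookup (wsum N bs \<sigma>s) n)
    = (of_int N :: rat) * (\<Sum>j<length \<sigma>s. (bs ! (j + 1) - bs ! j) * of_int (Poly_Mapping.lookup (minrep D (\<sigma>s ! j) lam) n))"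
  using assms
proof (induction N bs \<sigma>s rule: wsum.induct)
  case (1 N b b' bs \<sigma> \<sigma>s)
  have f: "of_int \<lfloor>of_int N * b\<rfloor> = of_int N * b" "of_int \<lfloor>of_int N * b'\<rfloor> = of_int N * b'"
    using 1(3)[of b] 1(3)[of b'] by (auto elim!: Ints_cases)
  have IH: "of_int (Poly_Mapping.lookup (wsum N (b' # bs) \<sigma>s) n)
    = of_int N * (\<Sum>j<length \<sigma>s. ((b' # bs) ! (j + 1) - (b' # bs) ! j) * of_int (Poly_Mapping.lookup (minrep D (\<sigma>s ! j) lam) n))"
    using 1 by simp
  show ?case
    unfolding wsum.simps lookup_add of_int_add IH length_Cons sum.lessThan_Suc_shift
    by (simp add: lookup_frag_cmul f distrib_left right_diff_distrib left_diff_distrib mult.assoc)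
qed auto

text \<open>One divisibility for two purposes: with simple roots it yields \<open>h_divides\<close>,
  and with the roots along a chain it puts all breakpoints on the grid.\<close>

definition good_scale :: "('n weight \<Rightarrow> 'n weight) \<Rightarrow> int \<Rightarrow> bool" where
  "good_scale v N \<longleftrightarrow> N > 0 \<and> (\<forall>x y m \<gamma>. x \<preceq> v \<longrightarrow> y \<preceq> v \<longrightarrow> x lam - y lam = frag_cmul m \<gamma> \<longrightarrow> m \<noteq> 0 \<longrightarrow> \<gamma> \<noteq> 0 \<longrightarrow> m dvd N)"

text \<open>A nonzero lattice element has a coordinate of absolute value at least 1, so m is bounded
  by the coordinates of finitely many differences. The factorial of the bound is divisible by every
  such m.\<close>

lemma good_scale_exists: "\<exists>N. good_scale v N"
proof -
  define X where "X = {z \<in> W. z \<preceq> v}"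
  define K where "K = Max (insert 0 ((\<lambda>(x, y, n). nat \<bar>Poly_Mapping.lookup (x lam - y lam) n\<bar>) ` (X \<times> X \<times> UNIV)))"
  have fin: "finite ((\<lambda>(x, y, n). nat \<bar>Poly_Mapping.lookup (x lam - y lam) n\<bar>) ` (X \<times> X \<times> (UNIV :: 'n set)))"
    unfolding X_def using finite_below by auto
  have "m dvd (fact K :: int)" if x: "x \<preceq> v" "y \<preceq> v" and m: "x lam - y lam = frag_cmul m \<gamma>" "m \<noteq> 0" "\<gamma> \<noteq> 0"
    for x y m and \<gamma> :: "'n weight"
  proof -
    obtain n where n: "Poly_Mapping.lookup \<gamma> n \<noteq> 0"
      using m(3) by (metis lookup_zero poly_mapping_eqI)
    have "x \<in> X" "y \<in> X" using x ble_weyl by (auto simp: X_def)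
    then have "nat \<bar>Poly_Mapping.lookup (x lam - y lam) n\<bar> \<le> K"
      unfolding K_def using fin by (intro Max_ge insertI2 image_eqI[of _ _ "(x, y, n)"]) auto
    moreover have "\<bar>m\<bar> * 1 \<le> \<bar>m\<bar> * \<bar>Poly_Mapping.lookup \<gamma> n\<bar>" using n by (intro mult_left_mono) auto
    then have "nat \<bar>m\<bar> \<le> nat \<bar>Poly_Mapping.lookup (x lam - y lam) n\<bar>"
      unfolding m(1) by (simp add: lookup_frag_cmul abs_mult)
    ultimately have "nat \<bar>m\<bar> dvd fact K" using m(2) by (intro dvd_fact) auto
    then have "int (nat \<bar>m\<bar>) dvd int (fact K)" by (simp only: int_dvd_int_iff)
    then show ?thesis by simp
  qed
  then show ?thesis unfolding good_scale_def by (intro exI[of _ "fact K"]) auto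
qed

lemma good_scale_h: assumes "good_scale v N" shows "h_divides v N"
  unfolding h_divides_def
proof (intro ballI impI)
  fix i y assume *: "i \<in> I" "y \<in> W" "s i \<circ> y \<preceq> v" "asc i y"
  have "y \<preceq> v" using ble_asc[OF *(2,1,4)] *(3) ble_trans by blast
  moreover have "y lam - (s i \<circ> y) lam = frag_cmul (h i y) (rt i)" by (simp add: srefl_def)
  moreover have "rt i \<noteq> 0" using rt_nonzero[of id i] * by simp
  ultimately show "h i y = 0 \<or> h i y dvd N" using assms *(3) unfolding good_scale_def by blast
qed

lemma bch_nontrivial_step:
  assumes "bch b x y" "x lam \<noteq> y lam" "x \<in> W"
  shows "\<exists>x' y' m \<gamma>. x' \<preceq> y \<and> y' \<preceq> y \<and> x' lam - y' lam = frag_cmul m \<gamma> \<and> m \<noteq> 0 \<and> \<gamma> \<noteq> 0 \<and> b * of_int m \<in> \<int>"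
  using assms(1,2)
proof (induction rule: rtrancl_induct)
  case (step y z)
  have yz: "y \<preceq> z" using step bst_cov cov_le by blast
  show ?case
  proof (cases "x lam = y lam")
    case False
    then show ?thesis using step(3) yz ble_trans by blast
  next
    case True
    then have ne: "y lam \<noteq> z lam" using step by simp
    obtain w i where w: "w \<in> W" "i \<in> I" "z = y \<circ> (w \<circ> s i \<circ> iv w)" "b * of_int (cr i (iv w lam)) \<in> \<int>"
      using step(2) by (rule bstE)
    have y: "y \<in> W" "z \<in> W" using yz ble_weyl by auto
    have "y lam - z lam = frag_cmul (cr i (iv w lam)) ((y \<circ> w) (rt i))"
      using conj_srefl[OF w(1,2), of lam] y by (simp add: w(3) weyl_diff weyl_cmul)
    moreover have "cr i (iv w lam) \<noteq> 0" using ne calculation by auto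
    moreover have "(y \<circ> w) (rt i) \<noteq> 0" using rt_nonzero[of "y \<circ> w" i] y w by simp
    ultimately show ?thesis using yz y w(4) by (meson ble_refl)
  qed
qed simp

text \<open>A chain between different cosets has a step that moves \<open>lam\<close> by a nonzero
  multiple m of a root with b times m integral. Since m divides N, b times N is integral as
  well.\<close>

lemma cle_scale_int:
  assumes "good_scale v N" "cle b p y" "p lam \<noteq> y lam" "y \<preceq> v"
  shows "of_int N * b \<in> \<int>"
proof -
  have W: "p \<in> W" "y \<in> W" using assms cle_weyl by auto
  obtain x' y' m \<gamma> where *: "x' \<preceq> mr y" "y' \<preceq> mr y" "x' lam - y' lam = frag_cmul m \<gamma>" "m \<noteq> 0" "\<gamma> \<noteq> 0" "b * of_int m \<in> \<int>"
    using bch_nontrivial_step[of "mr p" "mr y" b] assms W by (auto simp: cle_def)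
  have "mr y \<preceq> v" using mr_ble[OF W(2)] assms ble_trans by blast
  then have "m dvd N" using assms(1) * unfolding good_scale_def by (meson ble_trans)
  then obtain q where "N = m * q" by (elim dvdE)
  then have "of_int N * b = of_int q * (b * of_int m)" by simp
  then show ?thesis using *(6) by (metis Ints_mult Ints_of_int)
qed

text \<open>The denominator of b cancels because the weight lattice is torsion free.\<close>

lemma in_root_lattice_scale:
  assumes "in_root_lattice b \<mu>" "of_int N * b \<in> \<int>"
  shows "\<exists>\<nu>. frag_cmul \<lfloor>of_int N * b\<rfloor> \<mu> = frag_cmul N \<nu>"
proof -
  obtain p q where pq: "quotient_of b = (p, q)" by force
  have q: "q > 0" using quotient_of_denom_pos[OF pq] .
  have b: "b = of_int p / of_int q" using quotient_of_div[OF pq] .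
  obtain c where c: "frag_cmul p \<mu> = frag_cmul q (\<Sum>j\<in>I. frag_cmul (c j) (rt j))"
    using assms(1) pq by (auto simp: in_root_lattice_def)
  define \<nu> where "\<nu> = (\<Sum>j\<in>I. frag_cmul (c j) (rt j))"
  obtain m where m: "of_int N * b = of_int m" using assms(2) by (auto elim: Ints_cases)
  then have "(of_int (N * p) :: rat) = of_int (m * q)" using q by (simp add: b field_simps)
  then have e: "N * p = m * q" by (simp only: of_int_eq_iff)
  have "frag_cmul (q * m) \<mu> = frag_cmul N (frag_cmul p \<mu>)" using e by (simp add: mult.commute)
  also have "\<dots> = frag_cmul q (frag_cmul N \<nu>)" using c by (simp add: \<nu>_def mult.commute)
  finally have "frag_cmul q (frag_cmul m \<mu>) = frag_cmul q (frag_cmul N \<nu>)" by simp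
  then have "frag_cmul m \<mu> = frag_cmul N \<nu>" by (rule injD[OF inj_frag_cmul, rotated]) (use q in simp)
  then show ?thesis using m by auto
qed

end

text \<open>The common ground of the upward and the downward lifts. \<open>R_det\<close> says that
  times, directions and the element after a jump determine the element before it, so that different
  predecessors contribute different paths in \<open>walk_paths\<close>.\<close>

locale path_setting = dominant_datum D lam
  for D :: "('i, 'n::{finite,linorder}) root_datum" and lam +
  fixes R :: "rat \<Rightarrow> ('n weight \<Rightarrow> 'n weight) \<Rightarrow> ('n weight \<Rightarrow> 'n weight) \<Rightarrow> bool"
    and S0 :: "('n weight \<Rightarrow> 'n weight) \<Rightarrow> ('n weight \<Rightarrow> 'n weight) \<Rightarrow> bool"
    and c :: int and N :: int and v :: "'n weight \<Rightarrow> 'n weight"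
  assumes good: "good_scale v N"
    and R_le: "R b y p \<Longrightarrow> p \<preceq> y" and R_cle: "R b y p \<Longrightarrow> cle b p y"
    and R_same: "R b y p \<Longrightarrow> p lam = y lam \<Longrightarrow> p = y" and R_refl: "y \<in> W \<Longrightarrow> R b y y"
    and S0_le: "z \<in> W \<Longrightarrow> S0 z y \<Longrightarrow> z \<preceq> y" and S0_sign: "S0 z y \<Longrightarrow> c = 1 \<or> y = z"
    and R_det: "pre_path R (S0 z) bs \<sigma>s p \<Longrightarrow> pre_path R (S0 z) bs \<sigma>s p' \<Longrightarrow> R b y p \<Longrightarrow> R b y p' \<Longrightarrow> p = p'"
begin

lemma N: "N > 0"
  using good by (simp add: good_scale_def)

lemma pre_path_ble:
  assumes "z \<in> W" shows "pre_path R (S0 z) bs \<sigma>s y \<Longrightarrow> z \<preceq> y"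
proof (induction rule: pre_path.induct)
  case (step bs \<sigma>s p b y)
  then show ?case using R_le ble_trans by blast
qed (use S0_le assms in blast)

lemma pre_path_int: "pre_path R (S0 z) bs \<sigma>s y \<Longrightarrow> y \<preceq> v \<Longrightarrow> b \<in> set bs \<Longrightarrow> of_int N * b \<in> \<int>"
proof (induction rule: pre_path.induct)
  case (step bs \<sigma>s p b' y)
  then have "p \<preceq> v" using R_le ble_trans by blast
  moreover have "of_int N * b' \<in> \<int>" using cle_scale_int[OF good R_cle] step by blast
  ultimately show ?case using step by auto
qed simp

definition paths_upto :: "nat \<Rightarrow> ('n weight \<Rightarrow> 'n weight) \<Rightarrow> ('n weight \<Rightarrow> 'n weight) \<Rightarrow> 'n path set" where
  "paths_upto k z y = {(bs, \<sigma>s). pre_path R (S0 z) bs \<sigma>s y \<and> last bs \<le> of_int (int k) / of_int N}"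

definition ext :: "nat \<Rightarrow> ('n weight \<Rightarrow> 'n weight) \<Rightarrow> 'n path \<Rightarrow> 'n path" where
  "ext k y = (\<lambda>(bs, \<sigma>s). (bs @ [of_int (int k) / of_int N], \<sigma>s @ [coset D lam y]))"

definition pos :: "nat \<Rightarrow> 'n path \<Rightarrow> 'n weight" where
  "pos k = (\<lambda>(bs, \<sigma>s). wsum N (bs @ [of_int (int k) / of_int N]) \<sigma>s)"

definition nbrs :: "nat \<Rightarrow> ('n weight \<Rightarrow> 'n weight) \<Rightarrow> ('n weight \<Rightarrow> 'n weight) set" where
  "nbrs k y = {p \<in> W. p \<preceq> y \<and> p \<noteq> y \<and> R (of_int (int k) / of_int N) y p}"

lemma grid_le: "of_int N * b \<in> \<int> \<Longrightarrow> b < of_int (int (Suc k)) / of_int N \<Longrightarrow> b \<le> of_int (int k) / (of_int N :: rat)"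
proof -
  assume "of_int N * b \<in> \<int>" and lt: "b < of_int (int (Suc k)) / of_int N"
  then obtain m where m: "of_int N * b = of_int m" by (auto elim: Ints_cases)
  have "of_int m < (of_int (int (Suc k)) :: rat)" using lt N unfolding m[symmetric] by (simp add: field_simps)
  then have "m \<le> int k" by simp
  then have "of_int N * b \<le> (of_int (int k) :: rat)" unfolding m by linarith
  then show ?thesis using N by (simp add: field_simps)
qed

lemma paths_upto_0: "paths_upto 0 z y = (if S0 z y then {([0], [coset D lam y])} else {})"
proof -
  have "(bs, \<sigma>s) \<in> paths_upto 0 z y \<longleftrightarrow> S0 z y \<and> bs = [0] \<and> \<sigma>s = [coset D lam y]" for bs \<sigma>s
  proof
    assume "(bs, \<sigma>s) \<in> paths_upto 0 z y"
    then have p: "pre_path R (S0 z) bs \<sigma>s y" and l: "last bs \<le> 0" by (auto simp: paths_upto_def)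
    from p show "S0 z y \<and> bs = [0] \<and> \<sigma>s = [coset D lam y]"
    proof cases
      case (step bs' \<sigma>s' p b)
      then have "0 \<le> last bs'" using pre_path_bounds[OF step(3)] pre_path_length[OF step(3)] by auto
      then show ?thesis using l step by simp
    qed auto
  qed (auto simp: paths_upto_def intro: start)
  then show ?thesis by auto
qed

text \<open>All breakpoints lie on the grid. A last breakpoint beyond k/N therefore equals (k +
  1)/N, and the path without it has its last breakpoint at k/N or earlier.\<close>

lemma paths_upto_Suc:
  assumes y: "y \<preceq> v" and k: "int (Suc k) < N"
  shows "paths_upto (Suc k) z y = paths_upto k z y \<union> (\<Union>p\<in>nbrs (Suc k) y. ext (Suc k) y ` paths_upto k z p)"
proof (intro equalityI subsetI)
  fix q assume "q \<in> paths_upto (Suc k) z y"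
  then obtain bs \<sigma>s where q: "q = (bs, \<sigma>s)" and p: "pre_path R (S0 z) bs \<sigma>s y"
    and l: "last bs \<le> of_int (int (Suc k)) / of_int N" by (auto simp: paths_upto_def)
  show "q \<in> paths_upto k z y \<union> (\<Union>p\<in>nbrs (Suc k) y. ext (Suc k) y ` paths_upto k z p)"
  proof (cases "last bs \<le> of_int (int k) / of_int N")
    case True
    then show ?thesis using p q by (auto simp: paths_upto_def)
  next
    case False
    have "last bs \<in> set bs" using pre_path_length[OF p] by auto
    then have "of_int N * last bs \<in> \<int>" using pre_path_int[OF p y] by blast
    then have last: "last bs = of_int (int (Suc k)) / of_int N" using False l grid_le by force
    from p show ?thesis
    proof cases
      case start
      then show ?thesis using False N by simp
    next
      case (step bs' \<sigma>s' p' b)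
      have pv: "p' \<preceq> v" using R_le step y ble_trans by blast
      have "last bs' \<in> set bs'" using pre_path_length[OF step(3)] by auto
      then have "of_int N * last bs' \<in> \<int>" using pre_path_int[OF step(3) pv] by blast
      moreover have b: "b = of_int (int (Suc k)) / of_int N" using last step by simp
      ultimately have "last bs' \<le> of_int (int k) / of_int N" using grid_le step by blast
      then have "(bs', \<sigma>s') \<in> paths_upto k z p'" using step by (auto simp: paths_upto_def)
      moreover have "p' \<in> nbrs (Suc k) y" using step b R_le ble_weyl unfolding nbrs_def by blast
      moreover have "q = ext (Suc k) y (bs', \<sigma>s')" using q step b by (simp add: ext_def)
      ultimately show ?thesis by blast
    qed
  qed
next
  have lt: "of_int (int k) / of_int N < (of_int (int (Suc k)) / of_int N :: rat)"
    using N by (simp add: divide_strict_right_mono)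
  fix q assume "q \<in> paths_upto k z y \<union> (\<Union>p\<in>nbrs (Suc k) y. ext (Suc k) y ` paths_upto k z p)"
  then show "q \<in> paths_upto (Suc k) z y"
  proof
    assume "q \<in> paths_upto k z y"
    then show ?thesis using lt unfolding paths_upto_def by fastforce
  next
    assume "q \<in> (\<Union>p\<in>nbrs (Suc k) y. ext (Suc k) y ` paths_upto k z p)"
    then obtain p bs \<sigma>s where p: "p \<in> nbrs (Suc k) y" "pre_path R (S0 z) bs \<sigma>s p"
      "last bs \<le> of_int (int k) / of_int N" "q = ext (Suc k) y (bs, \<sigma>s)" by (auto simp: paths_upto_def)
    have "(of_int (int (Suc k)) / of_int N :: rat) < 1" using k N by (simp add: field_simps)
    moreover have "p lam \<noteq> y lam" using R_same p(1) unfolding nbrs_def by blast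
    moreover have "last bs < of_int (int (Suc k)) / of_int N" using p lt by simp
    ultimately have "pre_path R (S0 z) (bs @ [of_int (int (Suc k)) / of_int N]) (\<sigma>s @ [coset D lam y]) y"
      using p step by (auto simp: nbrs_def)
    then show ?thesis using p(4) by (simp add: ext_def paths_upto_def)
  qed
qed

lemma finite_paths_upto: "y \<preceq> v \<Longrightarrow> int k < N \<Longrightarrow> finite (paths_upto k z y)"
proof (induction k arbitrary: y)
  case (Suc k)
  have "finite (nbrs (Suc k) y)" by (rule finite_subset[OF _ finite_below[of y]]) (auto simp: nbrs_def)
  moreover have "finite (paths_upto k z p)" if "p \<in> nbrs (Suc k) y" for p
    using Suc that ble_trans by (auto simp: nbrs_def)
  ultimately show ?case using Suc by (subst paths_upto_Suc) auto
qed (simp add: paths_upto_0)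

lemma pos_ext: assumes "(bs, \<sigma>s) \<in> paths_upto k z p" shows "pos (Suc k) (ext (Suc k) y (bs, \<sigma>s)) = pos (Suc k) (bs, \<sigma>s)"
  using assms pre_path_length[of R "S0 z" bs \<sigma>s p] by (auto simp: pos_def ext_def wsum_snoc paths_upto_def)

lemma pos_Suc: assumes "(bs, \<sigma>s) \<in> paths_upto k z p" "p \<in> W" shows "pos (Suc k) (bs, \<sigma>s) = pos k (bs, \<sigma>s) + p lam"
proof -
  have pp: "pre_path R (S0 z) bs \<sigma>s p" using assms by (auto simp: paths_upto_def)
  then obtain bs' b where b: "bs = bs' @ [b]" using pre_path_length by (metis rev_exhaust)
  then obtain \<sigma>s' \<sigma> where s: "\<sigma>s = \<sigma>s' @ [\<sigma>]" using pre_path_length[OF pp] by (metis rev_exhaust list.size(3) length_0_conv)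
  have \<sigma>: "minrep D \<sigma> lam = p lam" using pre_path_last[OF pp] s assms by simp
  have "length bs' = length \<sigma>s'" using pre_path_length[OF pp] b s by simp
  then show ?thesis using N
    by (simp add: pos_def b s wsum_snoc \<sigma> frag_cmul_diff_distrib frag_cmul_distrib left_diff_distrib)
qed

lemma sign_mult: "p \<preceq> y \<Longrightarrow> z \<preceq> p \<Longrightarrow> c ^ (\<ell> y - \<ell> p) * c ^ (\<ell> p - \<ell> z) = c ^ (\<ell> y - \<ell> z)"
  using ble_len_le[of p y] ble_len_le[of z p] by (simp flip: power_add)

lemma paths_upto_ble: "z \<in> W \<Longrightarrow> q \<in> paths_upto k z y \<Longrightarrow> z \<preceq> y"
  using pre_path_ble by (auto simp: paths_upto_def)

lemma frag_cmul_ex_add: "ex (frag_cmul c \<mu>) * ex (frag_cmul c \<nu>) = ex (frag_cmul c (\<nu> + \<mu>))"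
  by (simp add: frag_cmul_distrib2 ex_add mult.commute)

text \<open>The step from \<open>y\<close> to \<open>y\<close> accounts for paths without a breakpoint at time \<open>(k + 1) / N\<close>.\<close>

lemma walk_paths:
  assumes "z \<in> W"
  shows "y \<preceq> v \<Longrightarrow> int k < N \<Longrightarrow> walk c R S0 N k y z
    = (\<Sum>q\<in>paths_upto k z y. of_int (c ^ (\<ell> y - \<ell> z)) * ex (frag_cmul c (pos k q)))"
proof (induction k arbitrary: y)
  case 0
  have "wsum N [0, 0] \<sigma>s = 0" for \<sigma>s by (cases \<sigma>s) auto
  moreover have "(of_int c :: 'n RT) ^ (\<ell> y - \<ell> z) = 1" if "S0 z y" using S0_sign[OF that] by auto
  ultimately show ?case by (simp add: paths_upto_0 pos_def)
next
  case (Suc k)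
  let ?b = "of_int (int (Suc k)) / of_int N :: rat"
  let ?f = "\<lambda>y q. of_int (c ^ (\<ell> y - \<ell> z)) * ex (frag_cmul c (pos (Suc k) q)) :: 'n RT"
  have yW: "y \<in> W" using Suc(2) ble_weyl by blast
  have k: "int k < N" using Suc(3) by simp
  have fin: "finite (nbrs (Suc k) y)" by (rule finite_subset[OF _ finite_below[of y]]) (auto simp: nbrs_def)
  have pv: "p \<preceq> v" if "p \<in> nbrs (Suc k) y" for p using that Suc(2) ble_trans unfolding nbrs_def by blast
  have summand: "of_int (step_coef c R ?b y p) * (ex (frag_cmul c (p lam)) * walk c R S0 N k p z)
      = (\<Sum>q\<in>paths_upto k z p. ?f y q)" if p: "p \<preceq> y" "R ?b y p" for p
  proof -
    have pW: "p \<in> W" using p ble_weyl by blast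
    have "walk c R S0 N k p z = (\<Sum>q\<in>paths_upto k z p. of_int (c ^ (\<ell> p - \<ell> z)) * ex (frag_cmul c (pos k q)))"
      using Suc(1) p(1) Suc(2) k ble_trans by blast
    then have "of_int (step_coef c R ?b y p) * (ex (frag_cmul c (p lam)) * walk c R S0 N k p z)
      = (\<Sum>q\<in>paths_upto k z p. of_int (c ^ (\<ell> y - \<ell> p)) * (ex (frag_cmul c (p lam)) *
           (of_int (c ^ (\<ell> p - \<ell> z)) * ex (frag_cmul c (pos k q)))))"
      using p by (simp only: step_coef_def if_True sum_distrib_left)
    also have "\<dots> = (\<Sum>q\<in>paths_upto k z p. ?f y q)"
    proof (rule sum.cong[OF refl])
      fix q assume q: "q \<in> paths_upto k z p"
      have zp: "z \<preceq> p" using paths_upto_ble q assms by blast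
      have "pos (Suc k) q = pos k q + p lam" using q pos_Suc[of "fst q" "snd q"] pW by simp
      then have e: "ex (frag_cmul c (pos (Suc k) q)) = ex (frag_cmul c (p lam)) * ex (frag_cmul c (pos k q))"
        by (simp add: frag_cmul_ex_add)
      show "of_int (c ^ (\<ell> y - \<ell> p)) * (ex (frag_cmul c (p lam)) *
           (of_int (c ^ (\<ell> p - \<ell> z)) * ex (frag_cmul c (pos k q)))) = ?f y q"
        unfolding e sign_mult[OF p(1) zp, symmetric] of_int_mult by (simp only: mult_ac)
    qed
    finally show ?thesis .
  qed
  have "walk c R S0 N (Suc k) y z = (\<Sum>p\<in>insert y (nbrs (Suc k) y).
      of_int (step_coef c R ?b y p) * (ex (frag_cmul c (p lam)) * walk c R S0 N k p z))"
    unfolding walk.simps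
    by (rule sum.mono_neutral_right[OF finite_below]) (use yW in \<open>auto simp: nbrs_def step_coef_def\<close>)
  also have "\<dots> = (\<Sum>p\<in>insert y (nbrs (Suc k) y). \<Sum>q\<in>paths_upto k z p. ?f y q)"
    by (rule sum.cong[OF refl], rule summand) (use R_refl yW in \<open>auto simp: nbrs_def\<close>)
  also have "\<dots> = (\<Sum>q\<in>paths_upto k z y. ?f y q) + (\<Sum>p\<in>nbrs (Suc k) y. \<Sum>q\<in>paths_upto k z p. ?f y q)"
    using fin by (subst sum.insert) (auto simp: nbrs_def)
  also have "(\<Sum>p\<in>nbrs (Suc k) y. \<Sum>q\<in>paths_upto k z p. ?f y q)
    = (\<Sum>p\<in>nbrs (Suc k) y. \<Sum>q\<in>ext (Suc k) y ` paths_upto k z p. ?f y q)"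
  proof (rule sum.cong[OF refl])
    fix p
    have "inj_on (ext (Suc k) y) (paths_upto k z p)" by (auto simp: inj_on_def ext_def)
    then have "(\<Sum>q\<in>ext (Suc k) y ` paths_upto k z p. ?f y q)
      = (\<Sum>q\<in>paths_upto k z p. ?f y (ext (Suc k) y q))" by (simp add: sum.reindex)
    also have "\<dots> = (\<Sum>q\<in>paths_upto k z p. ?f y q)"
      using pos_ext by (intro sum.cong) auto
    finally show "(\<Sum>q\<in>paths_upto k z p. ?f y q) = (\<Sum>q\<in>ext (Suc k) y ` paths_upto k z p. ?f y q)" ..
  qed
  also have "\<dots> = (\<Sum>q\<in>(\<Union>p\<in>nbrs (Suc k) y. ext (Suc k) y ` paths_upto k z p). ?f y q)"
  proof (rule sum.UNION_disjoint[symmetric])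
    show "\<forall>p\<in>nbrs (Suc k) y. finite (ext (Suc k) y ` paths_upto k z p)"
      using finite_paths_upto pv k by blast
    show "\<forall>p\<in>nbrs (Suc k) y. \<forall>p'\<in>nbrs (Suc k) y. p \<noteq> p' \<longrightarrow>
        ext (Suc k) y ` paths_upto k z p \<inter> ext (Suc k) y ` paths_upto k z p' = {}"
    proof (intro ballI impI)
      fix p p' assume n: "p \<in> nbrs (Suc k) y" "p' \<in> nbrs (Suc k) y" "p \<noteq> p'"
      have False if "(bs, \<sigma>s) \<in> paths_upto k z p" "(bs, \<sigma>s) \<in> paths_upto k z p'" for bs \<sigma>s
        using R_det[of z bs \<sigma>s p p' ?b y] that n unfolding paths_upto_def nbrs_def by blast
      then show "ext (Suc k) y ` paths_upto k z p \<inter> ext (Suc k) y ` paths_upto k z p' = {}"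
        by (auto simp: ext_def)
    qed
  qed (use fin in simp)
  also have "(\<Sum>q\<in>paths_upto k z y. ?f y q) + \<dots> = (\<Sum>q\<in>paths_upto (Suc k) z y. ?f y q)"
    unfolding paths_upto_Suc[OF Suc(2,3)]
  proof (rule sum.union_disjoint[symmetric])
    show "finite (paths_upto k z y)" using finite_paths_upto Suc(2) k by blast
    show "finite (\<Union>p\<in>nbrs (Suc k) y. ext (Suc k) y ` paths_upto k z p)"
      using finite_paths_upto pv k fin by blast
    have "\<not> ?b \<le> of_int (int k) / of_int N" using N by (simp add: field_simps)
    then show "paths_upto k z y \<inter> (\<Union>p\<in>nbrs (Suc k) y. ext (Suc k) y ` paths_upto k z p) = {}"
      by (auto simp: paths_upto_def ext_def)
  qed
  finally show ?case .
qed

end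

context dominant_datum
begin

subsection \<open>Comparison with LS paths\<close>

text \<open>An LS path with the final time 1 removed, so that paths can be built by appending a time
  and a direction together.\<close>

definition partial_ls :: "rat list \<Rightarrow> ('n weight \<Rightarrow> 'n weight) set list \<Rightarrow> bool" where
  "partial_ls bs \<sigma>s \<longleftrightarrow> length bs = length \<sigma>s \<and> \<sigma>s \<noteq> [] \<and> bs ! 0 = 0 \<and> sorted_wrt (<) bs \<and> last bs < 1 \<and>
     set \<sigma>s \<subseteq> coset D lam ` W \<and>
     (\<forall>j. 0 < j \<and> j < length \<sigma>s \<longrightarrow> b_less D lam (bs ! j) (\<sigma>s ! (j - 1)) (\<sigma>s ! j))"

lemma sorted_last: "sorted_wrt (<) bs \<Longrightarrow> (b::rat) \<in> set bs \<Longrightarrow> b \<le> last bs"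
  by (induction bs rule: rev_induct) (auto simp: sorted_wrt_append)

lemma sorted_less_iff:
  "sorted_wrt (<) bs \<Longrightarrow> bs \<noteq> [] \<Longrightarrow> (\<forall>x\<in>set bs. x < (b::rat)) \<longleftrightarrow> last bs < b"
  using sorted_last le_less_trans last_in_set by metis

lemma ls_paths_iff: "(cs, \<sigma>s) \<in> ls_paths D lam \<longleftrightarrow> (\<exists>bs. cs = bs @ [1] \<and> partial_ls bs \<sigma>s)"
proof
  assume a: "(cs, \<sigma>s) \<in> ls_paths D lam"
  then have len: "length cs = length \<sigma>s + 1" and c: "cs ! 0 = 0" "cs ! length \<sigma>s = 1" "sorted_wrt (<) cs"
    "set \<sigma>s \<subseteq> coset D lam ` W"
    "\<forall>j. 0 < j \<and> j < length \<sigma>s \<longrightarrow> b_less D lam (cs ! j) (\<sigma>s ! (j - 1)) (\<sigma>s ! j)"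
    by (auto simp: ls_paths_def)
  obtain bs b where cs: "cs = bs @ [b]" using len by (metis add.commute length_0_conv not_one_le_zero le_add1 rev_exhaust)
  have lb: "length bs = length \<sigma>s" using len cs by simp
  have b: "b = 1" using c(2) cs by (simp add: lb[symmetric] nth_append)
  have ne: "\<sigma>s \<noteq> []" using c by auto
  then have "bs \<noteq> []" using lb by auto
  then have "last bs < 1" using c(3) cs b by (simp add: sorted_wrt_append)
  moreover have "bs ! 0 = 0" using c(1) cs \<open>bs \<noteq> []\<close> by (simp add: nth_append)
  moreover have "sorted_wrt (<) bs" using c(3) cs by (simp add: sorted_wrt_append)
  ultimately have "partial_ls bs \<sigma>s" using c(4,5) lb ne unfolding cs partial_ls_def by (auto simp: nth_append)
  then show "\<exists>bs. cs = bs @ [1] \<and> partial_ls bs \<sigma>s" using cs b by blast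
next
  assume "\<exists>bs. cs = bs @ [1] \<and> partial_ls bs \<sigma>s"
  then obtain bs where cs: "cs = bs @ [1]" and p: "partial_ls bs \<sigma>s" by blast
  have "bs \<noteq> []" using p by (auto simp: partial_ls_def)
  then have "\<forall>x\<in>set bs. x < 1" using sorted_less_iff p unfolding partial_ls_def by blast
  then have s: "sorted_wrt (<) (bs @ [1])" using p by (simp add: sorted_wrt_append partial_ls_def)
  have len: "length bs = length \<sigma>s" "\<sigma>s \<noteq> []" using p by (auto simp: partial_ls_def)
  have nth: "(bs @ [1]) ! j = bs ! j" if "j < length \<sigma>s" for j using that len by (simp add: nth_append)
  show "(cs, \<sigma>s) \<in> ls_paths D lam"
    unfolding cs ls_paths_def mem_Collect_eq prod.case
  proof (intro conjI allI impI)
    show "length (bs @ [1]) = length \<sigma>s + 1" using len by simp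
    show "(bs @ [1]) ! 0 = 0" using nth[of 0] len p by (simp add: partial_ls_def)
    show "(bs @ [1]) ! length \<sigma>s = 1" using len(1)[symmetric] by simp
    show "sorted_wrt (<) (bs @ [1])" by (rule s)
    show "set \<sigma>s \<subseteq> coset D lam ` W" using p by (simp add: partial_ls_def)
    fix j assume "0 < j \<and> j < length \<sigma>s"
    then show "b_less D lam ((bs @ [1]) ! j) (\<sigma>s ! (j - 1)) (\<sigma>s ! j)"
      using p nth[of j] unfolding partial_ls_def by simp
  qed
qed

lemma partial_ls_single: "partial_ls [b] [\<sigma>] \<longleftrightarrow> b = 0 \<and> \<sigma> \<in> coset D lam ` W"
  by (auto simp: partial_ls_def)

lemma partial_ls_snoc:
  assumes "\<sigma>s \<noteq> []" "length bs = length \<sigma>s"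
  shows "partial_ls (bs @ [b]) (\<sigma>s @ [\<sigma>]) \<longleftrightarrow>
    partial_ls bs \<sigma>s \<and> last bs < b \<and> b < 1 \<and> \<sigma> \<in> coset D lam ` W \<and> b_less D lam b (last \<sigma>s) \<sigma>"
proof -
  have bs: "bs \<noteq> []" using assms by auto
  have s: "sorted_wrt (<) (bs @ [b]) \<longleftrightarrow> sorted_wrt (<) bs \<and> last bs < b"
    using sorted_less_iff[OF _ bs] by (auto simp: sorted_wrt_append)
  have n1: "(bs @ [b]) ! j = bs ! j" "(\<sigma>s @ [\<sigma>]) ! j = \<sigma>s ! j" "(\<sigma>s @ [\<sigma>]) ! (j - 1) = \<sigma>s ! (j - 1)"
    if "j < length \<sigma>s" for j using that assms(2) by (auto simp: nth_append)
  have n2: "(bs @ [b]) ! length \<sigma>s = b" "(\<sigma>s @ [\<sigma>]) ! length \<sigma>s = \<sigma>" "(\<sigma>s @ [\<sigma>]) ! (length \<sigma>s - 1) = last \<sigma>s"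
    using assms(1) by (simp_all add: nth_append last_conv_nth assms(2)[symmetric] del: nth_append_length)
      (simp_all add: assms(2))
  have j: "(\<forall>j. 0 < j \<and> j < length (\<sigma>s @ [\<sigma>]) \<longrightarrow> b_less D lam ((bs @ [b]) ! j) ((\<sigma>s @ [\<sigma>]) ! (j - 1)) ((\<sigma>s @ [\<sigma>]) ! j))
    \<longleftrightarrow> (\<forall>j. 0 < j \<and> j < length \<sigma>s \<longrightarrow> b_less D lam (bs ! j) (\<sigma>s ! (j - 1)) (\<sigma>s ! j)) \<and> b_less D lam b (last \<sigma>s) \<sigma>"
    (is "?L \<longleftrightarrow> ?R")
  proof
    assume L: ?L
    have "b_less D lam (bs ! j) (\<sigma>s ! (j - 1)) (\<sigma>s ! j)" if "0 < j" "j < length \<sigma>s" for j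
      using L[rule_format, of j] that n1[OF that(2)] by (simp only: length_append_singleton less_SucI simp_thms)
    moreover have "b_less D lam b (last \<sigma>s) \<sigma>"
      using L[rule_format, of "length \<sigma>s"] n2 assms(1)
      by (simp only: length_append_singleton lessI length_greater_0_conv simp_thms)
    ultimately show ?R by blast
  next
    assume R: ?R
    show ?L
    proof (intro allI impI)
      fix j assume *: "0 < j \<and> j < length (\<sigma>s @ [\<sigma>])"
      show "b_less D lam ((bs @ [b]) ! j) ((\<sigma>s @ [\<sigma>]) ! (j - 1)) ((\<sigma>s @ [\<sigma>]) ! j)"
      proof (cases "j < length \<sigma>s")
        case True
        then show ?thesis using R * n1[OF True] by metis
      next
        case False
        then have "j = length \<sigma>s" using * by simp
        then show ?thesis using R n2 by metis
      qed
    qed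
  qed
  have f: "(bs @ [b]) ! 0 = bs ! 0" "length (bs @ [b]) = length (\<sigma>s @ [\<sigma>])" "last (bs @ [b]) = b"
    "set (\<sigma>s @ [\<sigma>]) = insert \<sigma> (set \<sigma>s)"
    using bs assms by (auto simp: nth_append)
  define Q where "Q \<longleftrightarrow> (\<forall>j. 0 < j \<and> j < length \<sigma>s \<longrightarrow> b_less D lam (bs ! j) (\<sigma>s ! (j - 1)) (\<sigma>s ! j))"
  show ?thesis
    unfolding partial_ls_def j s f Q_def[symmetric] using assms by auto
qed

lemma b_less_iff:
  assumes "x \<in> W" "y \<in> W"
  shows "b_less D lam b (coset D lam x) (coset D lam y) \<longleftrightarrow> cle b x y \<and> x lam \<noteq> y lam"
proof -
  have "bch b (mr x) (mr y) \<Longrightarrow> mr x \<preceq> mr y" using bch_ble assms by simp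
  then show ?thesis
    using assms by (auto simp: b_less_def coset_le_def cle_def coset_eq_iff simp flip: bst_def)
qed

lemma coset_le_iff: "coset_le D (coset D lam x) (coset D lam y) \<longleftrightarrow> mr x \<preceq> mr y"
  by (simp add: coset_le_def)

lemma cle_mr_ble: "cle b x y \<Longrightarrow> mr x \<preceq> mr y"
  using bch_ble by (auto simp: cle_def)

lemma pre_path_partial_ls:
  assumes R: "\<And>b y p. R b y p \<Longrightarrow> cle b p y" and P: "\<And>y. P y \<Longrightarrow> y \<in> W"
  shows "pre_path R P bs \<sigma>s y \<Longrightarrow> y \<in> W \<and> partial_ls bs \<sigma>s"
proof (induction rule: pre_path.induct)
  case (step bs \<sigma>s p b y)
  have W: "p \<in> W" "y \<in> W" using R[OF step(4)] cle_weyl by blast+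
  have l: "length bs = length \<sigma>s" "bs \<noteq> []" using pre_path_length[OF step(1)] by auto
  then have "\<sigma>s \<noteq> []" by auto
  moreover have "b_less D lam b (last \<sigma>s) (coset D lam y)"
    using pre_path_last[OF step(1)] b_less_iff[OF W] R[OF step(4)] step(5) by simp
  ultimately show ?case using step W l by (simp add: partial_ls_snoc)
qed (auto simp: partial_ls_single P)

lemma up_pre_path_fold:
  "pre_path up_rel (is_up z) bs \<sigma>s y \<Longrightarrow>
    foldl (\<lambda>y \<sigma>. up D lam y \<sigma>) z \<sigma>s = y \<and> coset_le D (coset D lam z) (hd \<sigma>s)"
proof (induction rule: pre_path.induct)
  case (start y)
  then show ?case using up_eqI ble_mr is_up_le by (auto simp: coset_le_iff)
next
  case (step bs \<sigma>s p b y)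
  have "up D lam p (coset D lam y) = y" using up_eqI up_relD step by blast
  moreover have "\<sigma>s \<noteq> []" using pre_path_length[OF step(1)] by auto
  ultimately show ?case using step by simp
qed

text \<open>The converse of \<open>up_pre_path_fold\<close>. Each direction dominates the previous
  one, so \<open>is_up_exists\<close> supplies the lift, and the lift inherits the integral chain
  because it lies in the same coset.\<close>

lemma partial_ls_up:
  assumes z: "z \<in> W"
  shows "partial_ls bs \<sigma>s \<Longrightarrow> coset_le D (coset D lam z) (hd \<sigma>s) \<Longrightarrow>
    pre_path up_rel (is_up z) bs \<sigma>s (foldl (\<lambda>y \<sigma>. up D lam y \<sigma>) z \<sigma>s)"
proof (induction \<sigma>s arbitrary: bs rule: rev_induct)
  case (snoc \<sigma> \<sigma>s)
  then obtain bs' b where bs: "bs = bs' @ [b]" and l: "length bs' = length \<sigma>s"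
    unfolding partial_ls_def by (metis length_append_singleton length_0_conv nat.inject rev_exhaust old.nat.distinct(1))
  have "\<sigma> \<in> coset D lam ` W" using snoc(2) by (auto simp: partial_ls_def)
  then obtain x where x: "\<sigma> = coset D lam x" "x \<in> W" by blast
  show ?case
  proof (cases "\<sigma>s = []")
    case True
    then have "b = 0" "bs' = []" using snoc(2) l bs by (auto simp: partial_ls_def)
    have "mr z \<preceq> mr x" using snoc(3) True x by (simp add: coset_le_iff)
    then obtain q where q: "q lam = x lam" "is_up z q" using is_up_exists z x by blast
    have "coset D lam x = coset D lam q" using q x is_up_weyl coset_eq_iff by metis
    then show ?thesis using True bs \<open>b = 0\<close> \<open>bs' = []\<close> x up_eqI[OF q(2)] start[of "is_up z" q up_rel] q by simp
  next
    case False
    define p where "p = foldl (\<lambda>y \<sigma>. up D lam y \<sigma>) z \<sigma>s"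
    have pl: "partial_ls bs' \<sigma>s" "last bs' < b" "b < 1" "b_less D lam b (last \<sigma>s) \<sigma>"
      using snoc(2) partial_ls_snoc[OF False l] by (auto simp: bs)
    have pp: "pre_path up_rel (is_up z) bs' \<sigma>s p"
      using snoc(1)[OF pl(1)] snoc(3) False by (simp add: p_def)
    have pW: "p \<in> W" using pre_path_partial_ls[OF _ _ pp] up_relD is_up_weyl by blast
    have c: "cle b p x" "p lam \<noteq> x lam" using pl(4) pre_path_last[OF pp] b_less_iff[OF pW x(2)] x by simp_all
    obtain q where q: "q lam = x lam" "is_up p q" using is_up_exists[OF pW x(2) cle_mr_ble[OF c(1)]] by blast
    have qW: "q \<in> W" using q is_up_weyl by blast
    have cq: "coset D lam x = coset D lam q" using q x qW coset_eq_iff by metis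
    have "up_rel b q p" unfolding up_rel_def using q c(1) cle_cong[OF pW x(2) pW qW] by simp
    then have "pre_path up_rel (is_up z) (bs' @ [b]) (\<sigma>s @ [coset D lam q]) q"
      using step[OF pp pl(2,3)] c q by simp
    then show ?thesis using up_eqI[OF q(2)] by (simp add: bs x cq p_def)
  qed
qed (simp add: partial_ls_def)

lemma up_paths_eq:
  assumes z: "z \<in> W"
  shows "up_paths D lam w z = (\<lambda>(bs, \<sigma>s). (bs @ [1], \<sigma>s)) ` {(bs, \<sigma>s). pre_path up_rel (is_up z) bs \<sigma>s w}"
proof (intro equalityI subsetI)
  fix q assume "q \<in> up_paths D lam w z"
  moreover obtain cs \<sigma>s where q: "q = (cs, \<sigma>s)" by force
  ultimately have ls: "(cs, \<sigma>s) \<in> ls_paths D lam" "coset_le D (coset D lam z) (hd \<sigma>s)"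
    "foldl (\<lambda>y \<sigma>. up D lam y \<sigma>) z \<sigma>s = w"
    by (auto simp: up_paths_def final_dir_def up_path_def)
  obtain bs where bs: "cs = bs @ [1]" "partial_ls bs \<sigma>s" using ls(1) ls_paths_iff by blast
  then have "pre_path up_rel (is_up z) bs \<sigma>s w" using partial_ls_up[OF z bs(2) ls(2)] ls(3) by simp
  then show "q \<in> (\<lambda>(bs, \<sigma>s). (bs @ [1], \<sigma>s)) ` {(bs, \<sigma>s). pre_path up_rel (is_up z) bs \<sigma>s w}"
    using q bs by force
next
  fix q assume "q \<in> (\<lambda>(bs, \<sigma>s). (bs @ [1], \<sigma>s)) ` {(bs, \<sigma>s). pre_path up_rel (is_up z) bs \<sigma>s w}"
  then obtain bs \<sigma>s where q: "q = (bs @ [1], \<sigma>s)" and p: "pre_path up_rel (is_up z) bs \<sigma>s w" by auto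
  have "partial_ls bs \<sigma>s" using pre_path_partial_ls[OF _ _ p] up_relD is_up_weyl by blast
  then have "q \<in> ls_paths D lam" using q ls_paths_iff by blast
  then show "q \<in> up_paths D lam w z"
    using up_pre_path_fold[OF p] q by (simp add: up_paths_def final_dir_def up_path_def)
qed

lemma down_pre_path_fold:
  "pre_path down_rel (\<lambda>y. y = z) bs \<sigma>s y \<Longrightarrow> is_down w y \<Longrightarrow> foldr (\<lambda>\<sigma> y. down D lam y \<sigma>) \<sigma>s w = z"
proof (induction arbitrary: w rule: pre_path.induct)
  case (start y)
  then show ?case using down_eqI by simp
next
  case (step bs \<sigma>s p b y)
  have "down D lam w (coset D lam y) = y" using down_eqI step by blast
  then show ?case using step down_relD by simp
qed

text \<open>The fold starts at the last direction, so the induction removes that direction and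
  continues with the lift of w into it. This is why w varies.\<close>

lemma partial_ls_down:
  "w \<in> W \<Longrightarrow> partial_ls bs \<sigma>s \<Longrightarrow> coset_le D (last \<sigma>s) (coset D lam w) \<Longrightarrow>
    \<exists>y. is_down w y \<and> pre_path down_rel (\<lambda>y. y = foldr (\<lambda>\<sigma> y. down D lam y \<sigma>) \<sigma>s w) bs \<sigma>s y"
proof (induction \<sigma>s arbitrary: bs w rule: rev_induct)
  case (snoc \<sigma> \<sigma>s)
  then obtain bs' b where bs: "bs = bs' @ [b]" and l: "length bs' = length \<sigma>s"
    unfolding partial_ls_def by (metis length_append_singleton length_0_conv nat.inject rev_exhaust old.nat.distinct(1))
  have "\<sigma> \<in> coset D lam ` W" using snoc(3) by (auto simp: partial_ls_def)
  then obtain x where x: "\<sigma> = coset D lam x" "x \<in> W" by blast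
  have "mr x \<preceq> mr w" using snoc(4) x by (simp add: coset_le_iff)
  then obtain q where q: "q lam = x lam" "is_down w q" using is_down_exists snoc x by blast
  have qW: "q \<in> W" using q is_down_weyl by blast
  have cq: "coset D lam x = coset D lam q" using q x qW coset_eq_iff by metis
  have dq: "down D lam w \<sigma> = q" using down_eqI[OF q(2)] x cq by simp
  show ?case
  proof (cases "\<sigma>s = []")
    case True
    then have "b = 0" "bs' = []" using snoc(3) l bs by (auto simp: partial_ls_def)
    then show ?thesis using True bs x cq dq start[of "\<lambda>y. y = q" q down_rel] q by auto
  next
    case False
    have pl: "partial_ls bs' \<sigma>s" "last bs' < b" "b < 1" "b_less D lam b (last \<sigma>s) \<sigma>"
      using snoc(3) partial_ls_snoc[OF False l] by (auto simp: bs)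
    have "last \<sigma>s \<in> coset D lam ` W" using pl(1) False by (auto simp: partial_ls_def)
    then obtain u where u: "last \<sigma>s = coset D lam u" "u \<in> W" by blast
    have c: "cle b u q" "u lam \<noteq> q lam" using pl(4) b_less_iff[OF u(2) qW] u x cq by simp_all
    have "coset_le D (last \<sigma>s) (coset D lam q)" using cle_mr_ble[OF c(1)] u by (simp add: coset_le_iff)
    then obtain y where y: "is_down q y"
      "pre_path down_rel (\<lambda>y. y = foldr (\<lambda>\<sigma> y. down D lam y \<sigma>) \<sigma>s q) bs' \<sigma>s y"
      using snoc(1)[OF qW pl(1)] by blast
    have yW: "y \<in> W" using y is_down_weyl by blast
    have yu: "y lam = u lam" using pre_path_last[OF y(2)] u yW coset_eq_iff by metis
    have "cle b y q" using c(1) cle_cong[OF yW qW u(2) qW yu refl] by simp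
    then have "down_rel b q y" using y by (simp add: down_rel_def)
    then have "pre_path down_rel (\<lambda>y. y = foldr (\<lambda>\<sigma> y. down D lam y \<sigma>) \<sigma>s q) (bs' @ [b]) (\<sigma>s @ [coset D lam q]) q"
      using step[OF y(2) pl(2,3)] c yu by simp
    then show ?thesis using q x cq dq bs by auto
  qed
qed (simp add: partial_ls_def)

text \<open>The union accounts for the lift y of w into the last direction. \<open>pre_path\<close>
  does not record this passage, which plays the part of a jump at time 1.\<close>

lemma down_paths_eq:
  assumes w: "w \<in> W" and z: "z \<in> W"
  shows "{q \<in> down_paths D lam w. down_path D lam w q = z}
    = (\<lambda>(bs, \<sigma>s). (bs @ [1], \<sigma>s)) ` (\<Union>y\<in>{y. is_down w y}. {(bs, \<sigma>s). pre_path down_rel (\<lambda>y. y = z) bs \<sigma>s y})"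
    (is "?L = ?R")
proof (intro equalityI subsetI)
  fix q assume "q \<in> ?L"
  moreover obtain cs \<sigma>s where q: "q = (cs, \<sigma>s)" by force
  ultimately have ls: "(cs, \<sigma>s) \<in> ls_paths D lam" "coset_le D (last \<sigma>s) (coset D lam w)"
    "foldr (\<lambda>\<sigma> y. down D lam y \<sigma>) \<sigma>s w = z"
    by (auto simp: down_paths_def initial_dir_def down_path_def)
  obtain bs where bs: "cs = bs @ [1]" "partial_ls bs \<sigma>s" using ls(1) ls_paths_iff by blast
  obtain y where "is_down w y" "pre_path down_rel (\<lambda>y. y = z) bs \<sigma>s y"
    using partial_ls_down[OF w bs(2) ls(2)] ls(3) by auto
  then show "q \<in> ?R" using q bs by force
next
  fix q assume "q \<in> ?R"
  then obtain bs \<sigma>s y where q: "q = (bs @ [1], \<sigma>s)" and y: "is_down w y"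
    and p: "pre_path down_rel (\<lambda>y. y = z) bs \<sigma>s y" by auto
  have "partial_ls bs \<sigma>s" using pre_path_partial_ls[OF _ _ p] down_relD z by blast
  then have "q \<in> ls_paths D lam" using q ls_paths_iff by blast
  moreover have "coset_le D (last \<sigma>s) (coset D lam w)"
    using pre_path_last[OF p] ble_mr[OF is_down_le[OF y]] by (simp add: coset_le_iff)
  ultimately show "q \<in> ?L"
    using down_pre_path_fold[OF p y] q by (simp add: down_paths_def initial_dir_def down_path_def)
qed

lemma up_setting: assumes "good_scale v N" shows "path_setting D lam up_rel is_up 1 N v"
proof unfold_locales
  fix z bs \<sigma>s p p' b y
  assume "pre_path up_rel (is_up z) bs \<sigma>s p" "pre_path up_rel (is_up z) bs \<sigma>s p'"
  then show "p = p'" using up_pre_path_fold by metis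
next
  show "p = y" if "up_rel b y p" "p lam = y lam" for b y p
    using that ble_antisym is_up_le is_upD[of p y p] ble_refl is_up_weyl unfolding up_rel_def by metis
  show "up_rel b y y" if "y \<in> W" for b y
    using that is_up_self cle_same unfolding up_rel_def by blast
qed (use assms is_up_le in \<open>simp_all add: up_rel_def\<close>)

lemma down_setting: assumes "good_scale v N" shows "path_setting D lam down_rel (\<lambda>z y. y = z) (- 1) N v"
proof unfold_locales
  fix z bs \<sigma>s p p' b y
  assume p: "pre_path down_rel (\<lambda>y. y = z) bs \<sigma>s p" "pre_path down_rel (\<lambda>y. y = z) bs \<sigma>s p'"
    "down_rel b y p" "down_rel b y p'"
  have "coset D lam p = coset D lam p'" using pre_path_last p by metis
  moreover have "p \<in> W" "p' \<in> W" using p down_relD is_down_weyl by blast+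
  ultimately show "p = p'" using is_down_unique[of y p p'] p down_relD coset_eq_iff by metis
next
  show "p = y" if "down_rel b y p" "p lam = y lam" for b y p
    using that ble_antisym is_down_le is_downD[of y p y] ble_refl is_down_weyl unfolding down_rel_def by metis
  show "down_rel b y y" if "y \<in> W" for b y
    using that is_down_self cle_same unfolding down_rel_def by blast
qed (use assms is_down_le in \<open>simp_all add: down_rel_def\<close>)

end

section \<open>Integrality of endpoints and their scaled positions\<close>

context path_setting
begin

text \<open>Modulo N times the lattice, the scaled position depends only on the time and the last
  direction. A jump at time b changes it by N b times a difference of weights, which
  \<open>cle_lattice\<close> makes N times a lattice element.\<close>

lemma wsum_position:
  assumes z: "z \<in> W"
  shows "pre_path R (S0 z) bs \<sigma>s y \<Longrightarrow> y \<preceq> v \<Longrightarrow>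
    \<exists>\<mu>. \<forall>t. wsum N (bs @ [t]) \<sigma>s = frag_cmul N \<mu> + frag_cmul \<lfloor>of_int N * t\<rfloor> (y lam)"
proof (induction rule: pre_path.induct)
  case (start y)
  have "y \<in> W" using S0_le[OF z start(1)] ble_weyl by blast
  then show ?case by (intro exI[of _ 0]) auto
next
  case (step bs \<sigma>s p b y)
  have W: "p \<in> W" "y \<in> W" using R_cle[OF step(4)] cle_weyl by blast+
  have pv: "p \<preceq> v" using R_le step ble_trans by blast
  then obtain \<mu> where \<mu>: "\<And>t. wsum N (bs @ [t]) \<sigma>s = frag_cmul N \<mu> + frag_cmul \<lfloor>of_int N * t\<rfloor> (p lam)"
    using step by blast
  have "of_int N * b \<in> \<int>" using cle_scale_int[OF good R_cle[OF step(4)] step(5,7)] .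
  then obtain \<nu> where \<nu>: "frag_cmul \<lfloor>of_int N * b\<rfloor> (p lam - y lam) = frag_cmul N \<nu>"
    using in_root_lattice_scale cle_lattice[OF R_cle[OF step(4)]] by blast
  have "wsum N ((bs @ [b]) @ [t]) (\<sigma>s @ [coset D lam y]) = frag_cmul N (\<mu> + \<nu>) + frag_cmul \<lfloor>of_int N * t\<rfloor> (y lam)" for t
  proof -
    have "wsum N ((bs @ [b]) @ [t]) (\<sigma>s @ [coset D lam y])
      = frag_cmul N \<mu> + frag_cmul \<lfloor>of_int N * b\<rfloor> (p lam)
        + frag_cmul (\<lfloor>of_int N * t\<rfloor> - \<lfloor>of_int N * b\<rfloor>) (y lam)"
      using pre_path_length[OF step(1)] W by (simp add: wsum_snoc \<mu>)
    also have "\<dots> = frag_cmul N \<mu> + frag_cmul \<lfloor>of_int N * b\<rfloor> (p lam - y lam) + frag_cmul \<lfloor>of_int N * t\<rfloor> (y lam)"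
      by (simp add: poly_mapping_eq_iff fun_eq_iff lookup_add lookup_minus lookup_frag_cmul algebra_simps)
    finally show ?thesis unfolding \<nu> by (simp add: frag_cmul_distrib2)
  qed
  then show ?case by blast
qed

text \<open>At time 1 the scaled position is N times a lattice element. So the rational combination
  in \<open>endpoint\<close> is integral and its description denotes that element.\<close>

lemma endpoint_scaled:
  assumes z: "z \<in> W" and p: "pre_path R (S0 z) bs \<sigma>s y" and y: "y \<preceq> v"
  shows "frag_cmul N (endpoint D lam (bs @ [1], \<sigma>s)) = wsum N (bs @ [1]) \<sigma>s"
proof -
  obtain \<mu> where "wsum N (bs @ [1]) \<sigma>s = frag_cmul N \<mu> + frag_cmul N (y lam)"
    using wsum_position[OF z p y] by fastforce
  then have \<mu>: "wsum N (bs @ [1]) \<sigma>s = frag_cmul N (\<mu> + y lam)" by (simp add: frag_cmul_distrib2)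
  let ?s = "\<lambda>n. \<Sum>j<length \<sigma>s. ((bs @ [1]) ! (j + 1) - (bs @ [1]) ! j) *
    (of_int (Poly_Mapping.lookup (minrep D (\<sigma>s ! j) lam) n) :: rat)"
  have s: "of_int (Poly_Mapping.lookup (\<mu> + y lam) n) = ?s n" for n
  proof -
    have "of_int (Poly_Mapping.lookup (wsum N (bs @ [1]) \<sigma>s) n) = of_int N * ?s n"
      by (rule wsum_lookup) (use pre_path_length[OF p] pre_path_int[OF p y] in auto)
    then have "of_int N * of_int (Poly_Mapping.lookup (\<mu> + y lam) n) = of_int N * ?s n"
      unfolding \<mu> lookup_frag_cmul of_int_mult .
    then show ?thesis using N by simp
  qed
  have "endpoint D lam (bs @ [1], \<sigma>s) = \<mu> + y lam"
    unfolding endpoint_def prod.case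
  proof (rule the_equality)
    fix \<nu> assume "\<forall>n. of_int (Poly_Mapping.lookup \<nu> n) = ?s n"
    then show "\<nu> = \<mu> + y lam" unfolding s[symmetric] of_int_eq_iff by (intro poly_mapping_eqI) simp
  qed (use s in blast)
  then show ?thesis using \<mu> by simp
qed

lemma paths_upto_all:
  assumes "y \<preceq> v" "int k + 1 = N"
  shows "paths_upto k z y = {(bs, \<sigma>s). pre_path R (S0 z) bs \<sigma>s y}"
proof -
  have "last bs \<le> of_int (int k) / of_int N" if p: "pre_path R (S0 z) bs \<sigma>s y" for bs \<sigma>s
  proof -
    have l: "last bs \<in> set bs" using pre_path_length[OF p] by auto
    then have "last bs < 1" using pre_path_bounds[OF p] by blast
    moreover have "(of_int (int (Suc k)) / of_int N :: rat) = 1" using assms(2) N by simp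
    ultimately show ?thesis using grid_le[OF pre_path_int[OF p assms(1) l]] by simp
  qed
  then show ?thesis by (auto simp: paths_upto_def)
qed

lemma pos_endpoint:
  assumes z: "z \<in> W" and y: "y \<preceq> v" and k: "int k + 1 = N" and p: "pre_path R (S0 z) bs \<sigma>s y"
  shows "pos k (bs, \<sigma>s) + y lam = frag_cmul N (endpoint D lam (bs @ [1], \<sigma>s))"
proof -
  have one: "(of_int (int (Suc k)) / of_int N :: rat) = 1" using k N by simp
  have "(bs, \<sigma>s) \<in> paths_upto k z y" using paths_upto_all[OF y k] p by blast
  then have "pos (Suc k) (bs, \<sigma>s) = pos k (bs, \<sigma>s) + y lam" using pos_Suc y ble_weyl by blast
  moreover have "pos (Suc k) (bs, \<sigma>s) = wsum N (bs @ [1]) \<sigma>s" using one by (simp only: pos_def prod.case)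
  ultimately show ?thesis using endpoint_scaled[OF z p y] by simp
qed

end

context kac_moody_datum
begin

lemma intertwines_cong:
  assumes i: "i \<in> I" and y: "\<And>z. z \<in> W \<Longrightarrow> X y z = X' y z" "\<And>z. z \<in> W \<Longrightarrow> X (s i \<circ> y) z = X' (s i \<circ> y) z"
  shows "intertwines i N T X y \<longleftrightarrow> intertwines i N T X' y"
proof -
  have "S i N (X y) z = S i N (X' y) z" "S i N (X (s i \<circ> y)) z = S i N (X' (s i \<circ> y)) z" if "z \<in> W" for z
    using that i y by (simp_all add: S_def[OF i])
  then show ?thesis using y unfolding intertwines_def[OF i] by auto
qed

end

context dominant_datum
begin

subsection \<open>The coefficients\<close>

definition up_coef :: "('n weight \<Rightarrow> 'n weight) \<Rightarrow> ('n weight \<Rightarrow> 'n weight) \<Rightarrow> 'n RT" where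
  "up_coef w z = (\<Sum>p\<in>up_paths D lam w z. ex (endpoint D lam p))"

definition down_coef :: "('n weight \<Rightarrow> 'n weight) \<Rightarrow> ('n weight \<Rightarrow> 'n weight) \<Rightarrow> 'n RT" where
  "down_coef w z = (\<Sum>p\<in>{p \<in> down_paths D lam w. down_path D lam w p = z}.
     of_int ((- 1) ^ (\<ell> w - \<ell> z)) * ex (- endpoint D lam p))"

lemma act_RT_of_int_mult: "act_RT (frag_cmul N) (of_int m * f) = of_int m * act_RT (frag_cmul N) f"
proof (induction m rule: int_induct[where k = 0])
  case (step1 m)
  then show ?case by (simp add: distrib_right act_RT_add)
next
  case (step2 m)
  then show ?case by (simp add: left_diff_distrib act_RT_diff)
qed simp

abbreviation close_path :: "'n path \<Rightarrow> 'n path" where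
  "close_path \<equiv> \<lambda>(bs, \<sigma>s). (bs @ [1], \<sigma>s)"

lemma inj_close_path: "inj_on close_path A"
  by (auto simp: inj_on_def)

text \<open>The walk stops at the last grid time before 1. The remaining interval is spent in
  direction y and supplies the extra diagonal factor.\<close>

lemma up_coef_scaled:
  assumes good: "good_scale v N" and y: "y \<preceq> v" and z: "z \<in> W"
  shows "finite (up_paths D lam y z)"
    "act_RT (frag_cmul N) (up_coef y z) = ex (frag_cmul 1 (y lam)) * walk 1 up_rel is_up N (nat N - 1) y z"
proof -
  interpret P: path_setting D lam up_rel is_up 1 N v by (rule up_setting) fact
  define k where "k = nat N - 1"
  have k: "int k + 1 = N" "int k < N" using P.N by (auto simp: k_def)
  note PU = P.paths_upto_all[OF y k(1)]
  have up: "up_paths D lam y z = close_path ` P.paths_upto k z y"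
    unfolding PU by (rule up_paths_eq[OF z])
  show "finite (up_paths D lam y z)" unfolding up using P.finite_paths_upto[OF y k(2)] by blast
  have "act_RT (frag_cmul N) (up_coef y z)
      = (\<Sum>q\<in>P.paths_upto k z y. ex (frag_cmul N (endpoint D lam (close_path q))))"
    unfolding up_coef_def up act_RT_sum act_RT_ex by (simp add: sum.reindex[OF inj_close_path])
  also have "\<dots> = (\<Sum>q\<in>P.paths_upto k z y. ex (frag_cmul 1 (y lam)) * (of_int (1 ^ (\<ell> y - \<ell> z)) * ex (frag_cmul 1 (P.pos k q))))"
  proof (rule sum.cong[OF refl])
    fix q assume "q \<in> P.paths_upto k z y"
    moreover obtain bs \<sigma>s where q: "q = (bs, \<sigma>s)" by force
    ultimately have "frag_cmul N (endpoint D lam (close_path q)) = P.pos k q + y lam"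
      using P.pos_endpoint[OF z y k(1), of bs \<sigma>s] unfolding PU by simp
    then show "ex (frag_cmul N (endpoint D lam (close_path q)))
      = ex (frag_cmul 1 (y lam)) * (of_int (1 ^ (\<ell> y - \<ell> z)) * ex (frag_cmul 1 (P.pos k q)))"
      by (simp add: ex_add mult.commute)
  qed
  finally show "act_RT (frag_cmul N) (up_coef y z) = ex (frag_cmul 1 (y lam)) * walk 1 up_rel is_up N (nat N - 1) y z"
    using P.walk_paths[OF z y k(2)] by (simp add: sum_distrib_left k_def)
qed

text \<open>All pairings with \<open>lam\<close> are integers, so at time 1 the chain condition
  reduces to the Bruhat order, which the lift already provides.\<close>

lemma down_rel_1: "down_rel 1 w y \<longleftrightarrow> is_down w y"
proof -
  have "bst 0 \<subseteq> bst 1" by (auto simp: bst_def)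
  then have "cle 0 y w \<Longrightarrow> cle 1 y w" using rtrancl_mono unfolding cle_def by blast
  then show ?thesis using ble_cle_0 is_down_le by (auto simp: down_rel_def)
qed

text \<open>The lift of w into the last direction becomes the jump at time 1. This is why the walk
  has N steps here, against N - 1 steps and a diagonal factor in the dominant case.\<close>

lemma down_coef_scaled:
  assumes good: "good_scale v N" and w: "w \<preceq> v" and z: "z \<in> W"
  shows "finite {p \<in> down_paths D lam w. down_path D lam w p = z}"
    "act_RT (frag_cmul N) (down_coef w z) = walk (- 1) down_rel (\<lambda>z y. y = z) N (nat N) w z"
proof -
  interpret P: path_setting D lam down_rel "\<lambda>z y. y = z" "- 1" N v by (rule down_setting) fact
  define k where "k = nat N - 1"
  have k: "int k + 1 = N" "int k < N" "nat N = Suc k" using P.N by (auto simp: k_def)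
  have wW: "w \<in> W" using w ble_weyl by blast
  define Y where "Y = {y. is_down w y}"
  have yv: "y \<preceq> v" if "y \<in> Y" for y using that is_down_le w ble_trans unfolding Y_def by blast
  have finY: "finite Y"
    by (rule finite_subset[OF _ finite_below[of w]]) (use is_down_le is_down_weyl in \<open>auto simp: Y_def\<close>)
  note PU = P.paths_upto_all[OF _ k(1)]
  have fin: "finite (P.paths_upto k z y)" if "y \<in> Y" for y using P.finite_paths_upto[OF yv[OF that] k(2)] .
  have U: "(\<Union>y\<in>Y. P.paths_upto k z y) = (\<Union>y\<in>Y. {(bs, \<sigma>s). pre_path down_rel (\<lambda>y. y = z) bs \<sigma>s y})"
    using PU yv by (intro SUP_cong) auto
  have dn: "{p \<in> down_paths D lam w. down_path D lam w p = z} = close_path ` (\<Union>y\<in>Y. P.paths_upto k z y)"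
    unfolding U unfolding Y_def by (rule down_paths_eq[OF wW z])
  show "finite {p \<in> down_paths D lam w. down_path D lam w p = z}" unfolding dn using finY fin by blast
  let ?f = "\<lambda>q. of_int ((- 1) ^ (\<ell> w - \<ell> z)) * ex (frag_cmul N (- endpoint D lam (close_path q))) :: 'n RT"
  have "act_RT (frag_cmul N) (down_coef w z) = (\<Sum>q\<in>(\<Union>y\<in>Y. P.paths_upto k z y). ?f q)"
    unfolding down_coef_def dn act_RT_sum act_RT_of_int_mult act_RT_ex
    by (simp only: sum.reindex[OF inj_close_path] o_def)
  also have "\<dots> = (\<Sum>y\<in>Y. \<Sum>q\<in>P.paths_upto k z y. ?f q)"
  proof (rule sum.UNION_disjoint[OF finY])
    show "\<forall>y\<in>Y. finite (P.paths_upto k z y)" using fin by blast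
    show "\<forall>y\<in>Y. \<forall>y'\<in>Y. y \<noteq> y' \<longrightarrow> P.paths_upto k z y \<inter> P.paths_upto k z y' = {}"
    proof (intro ballI impI)
      fix y y' assume Y: "y \<in> Y" "y' \<in> Y" "y \<noteq> y'"
      have False if "(bs, \<sigma>s) \<in> P.paths_upto k z y" "(bs, \<sigma>s) \<in> P.paths_upto k z y'" for bs \<sigma>s
      proof -
        have "coset D lam y = coset D lam y'"
          using that pre_path_last unfolding P.paths_upto_def by (metis (mono_tags, lifting) case_prodD mem_Collect_eq)
        then have "y' lam = y lam" using Y is_down_weyl coset_eq_iff unfolding Y_def by blast
        then show False using is_down_unique[of w y y'] Y by (simp add: Y_def)
      qed
      then show "P.paths_upto k z y \<inter> P.paths_upto k z y' = {}" by auto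
    qed
  qed
  also have "\<dots> = (\<Sum>y\<in>Y. of_int ((- 1) ^ (\<ell> w - \<ell> y)) * (ex (frag_cmul (- 1) (y lam)) * walk (- 1) down_rel (\<lambda>z y. y = z) N k y z))"
  proof (rule sum.cong[OF refl])
    fix y assume y: "y \<in> Y"
    have yw: "y \<preceq> w" using y is_down_le unfolding Y_def by blast
    have "?f q = of_int ((- 1) ^ (\<ell> w - \<ell> y)) * (ex (frag_cmul (- 1) (y lam)) *
        (of_int ((- 1) ^ (\<ell> y - \<ell> z)) * ex (frag_cmul (- 1) (P.pos k q))))" if q: "q \<in> P.paths_upto k z y" for q
    proof -
      obtain bs \<sigma>s where qq: "q = (bs, \<sigma>s)" by force
      have "pre_path down_rel (\<lambda>y. y = z) bs \<sigma>s y" using q unfolding qq P.paths_upto_def by blast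
      then have e: "frag_cmul N (endpoint D lam (close_path q)) = P.pos k q + y lam"
        using P.pos_endpoint[OF z yv[OF y] k(1), of bs \<sigma>s] by (simp add: qq)
      have "frag_cmul N (- endpoint D lam (close_path q)) = frag_cmul (- 1) (y lam) + frag_cmul (- 1) (P.pos k q)"
        using e by (simp add: poly_mapping_eq_iff fun_eq_iff lookup_add lookup_frag_cmul lookup_minus)
      then have x: "ex (frag_cmul N (- endpoint D lam (close_path q))) = ex (frag_cmul (- 1) (y lam)) * ex (frag_cmul (- 1) (P.pos k q))"
        by (simp only: ex_add)
      have "z \<preceq> y" using P.paths_upto_ble[OF z q] .
      from P.sign_mult[OF yw this] show ?thesis unfolding x by (simp only: of_int_mult[symmetric] mult_ac flip: P.sign_mult)
    qed
    then show "(\<Sum>q\<in>P.paths_upto k z y. ?f q)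
      = of_int ((- 1) ^ (\<ell> w - \<ell> y)) * (ex (frag_cmul (- 1) (y lam)) * walk (- 1) down_rel (\<lambda>z y. y = z) N k y z)"
      unfolding P.walk_paths[OF z yv[OF y] k(2)] sum_distrib_left by (rule sum.cong[OF refl])
  qed
  also have "\<dots> = walk (- 1) down_rel (\<lambda>z y. y = z) N (Suc k) w z"
  proof -
    have one: "(of_int (int (Suc k)) / of_int N :: rat) = 1" using k P.N by simp
    show ?thesis
      unfolding walk.simps one
      by (rule sum.mono_neutral_cong_left[OF finite_below])
        (use is_down_le is_down_weyl in \<open>auto simp: Y_def step_coef_def down_rel_1\<close>)
  qed
  finally show "act_RT (frag_cmul N) (down_coef w z) = walk (- 1) down_rel (\<lambda>z y. y = z) N (nat N) w z"
    by (simp only: k(3))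
qed

lemma frac_left_full: "frac_left N (N * m) = N"
  by (simp add: frac_left_def)

lemma up_coef_intertwines:
  assumes i: "i \<in> I" and y: "y \<in> W" "asc i y"
  shows "intertwines i 1 1 up_coef y"
proof -
  \<comment> \<open>One N has to serve the rows of both y and \<open>s i \<circ> y\<close>, and all
    elements involved lie below the latter.\<close>
  let ?v = "s i \<circ> y"
  obtain N where good: "good_scale ?v N" using good_scale_exists by blast
  then have N: "N > 0" by (simp add: good_scale_def)
  have v: "?v \<preceq> ?v" "y \<preceq> ?v" using i y ble_asc by auto
  define k where "k = nat N - 1"
  have k: "int k + 1 = N" using N by (simp add: k_def)
  have hd: "h_divides ?v N" using good_scale_h[OF good] .
  then have "h i y = 0 \<or> h i y dvd N" using i y v unfolding h_divides_def by blast
  \<comment> \<open>The last interval brings the argument of \<open>frac_left\<close> to a multiple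
    of N, and there its value is N, the untwisted case.\<close>
  then have "frac_right N (int k * h i y) (h i y) + 1 * h i y = N"
    using frac_right_step[OF N, of "h i y" "int k"] h_asc[OF y(1) i y(2)] frac_left_full unfolding k by simp
  then have "intertwines i N N (\<lambda>y z. ex (frag_cmul 1 (y lam)) * walk 1 up_rel is_up N k y z) y"
    using diag_scaled[OF N hd i intertwines_up_walk[OF N hd i y v(1), of k], of 1] by simp
  then have "intertwines i N N (\<lambda>y z. act_RT (frag_cmul N) (up_coef y z)) y"
    using intertwines_cong[OF i, of "\<lambda>y z. act_RT (frag_cmul N) (up_coef y z)" y] up_coef_scaled(2)[OF good] v
    unfolding k_def by (metis (no_types, lifting))
  then show ?thesis by (rule intertwines_scale[OF i N])
qed

lemma down_coef_intertwines:
  assumes i: "i \<in> I" and y: "y \<in> W" "asc i y"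
  shows "intertwines i 1 1 down_coef y"
proof -
  let ?v = "s i \<circ> y"
  obtain N where good: "good_scale ?v N" using good_scale_exists by blast
  then have N: "N > 0" by (simp add: good_scale_def)
  have v: "?v \<preceq> ?v" "y \<preceq> ?v" using i y ble_asc by auto
  have hd: "h_divides ?v N" using good_scale_h[OF good] .
  have "frac_left N (- int (nat N) * h i y) = N" using N by (simp add: frac_left_def)
  then have "intertwines i N N (walk (- 1) down_rel (\<lambda>z y. y = z) N (nat N)) y"
    using intertwines_down_walk[OF N hd i y v(1), of "nat N"] by simp
  then have "intertwines i N N (\<lambda>y z. act_RT (frag_cmul N) (down_coef y z)) y"
    using intertwines_cong[OF i, of "\<lambda>y z. act_RT (frag_cmul N) (down_coef y z)" y] down_coef_scaled(2)[OF good] v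
    by (metis (no_types, lifting))
  then show ?thesis by (rule intertwines_scale[OF i N])
qed

lemma finite_up_paths: "w \<in> W \<Longrightarrow> z \<in> W \<Longrightarrow> finite (up_paths D lam w z)"
  using up_coef_scaled(1) good_scale_exists[of w] ble_refl by blast

lemma up_paths_ble: assumes "z \<in> W" "p \<in> up_paths D lam w z" shows "z \<preceq> w"
proof -
  obtain bs \<sigma>s where "pre_path up_rel (is_up z) bs \<sigma>s w" using assms by (auto simp: up_paths_eq)
  then show ?thesis
  proof (induction rule: pre_path.induct)
    case (step bs \<sigma>s p b y)
    then show ?case using up_relD is_up_le ble_trans by blast
  qed (use is_up_le in blast)
qed

lemma down_path_ble:
  assumes "w \<in> W" "z \<in> W" "p \<in> down_paths D lam w" "down_path D lam w p = z" shows "z \<preceq> w"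
proof -
  obtain bs \<sigma>s y where y: "is_down w y" and "pre_path down_rel (\<lambda>y. y = z) bs \<sigma>s y"
    using down_paths_eq[OF assms(1,2)] assms(3,4) by blast
  from this(2) have "z \<preceq> y"
  proof (induction rule: pre_path.induct)
    case (step bs \<sigma>s p b y)
    then show ?case using down_relD is_down_le ble_trans by blast
  qed (use assms in simp)
  then show ?thesis using is_down_le[OF y] ble_trans by blast
qed

lemma down_path_weyl:
  assumes "w \<in> W" "p \<in> down_paths D lam w" shows "down_path D lam w p \<in> W"
proof -
  obtain cs \<sigma>s where p: "p = (cs, \<sigma>s)" by force
  then obtain bs where bs: "partial_ls bs \<sigma>s" and c: "coset_le D (last \<sigma>s) (coset D lam w)"
    using assms ls_paths_iff by (auto simp: down_paths_def initial_dir_def)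
  obtain y where y: "is_down w y" and q: "pre_path down_rel (\<lambda>y. y = foldr (\<lambda>\<sigma> y. down D lam y \<sigma>) \<sigma>s w) bs \<sigma>s y"
    using partial_ls_down[OF assms(1) bs c] by blast
  define z where "z = foldr (\<lambda>\<sigma> y. down D lam y \<sigma>) \<sigma>s w"
  from q have "y \<in> W \<longrightarrow> z \<in> W" unfolding z_def[symmetric]
  proof (induction rule: pre_path.induct)
    case (step bs \<sigma>s' p b y)
    then show ?case using down_relD is_down_weyl by blast
  qed simp
  then show ?thesis using is_down_weyl y p by (simp add: down_path_def z_def)
qed

lemma finite_down_paths: assumes w: "w \<in> W" shows "finite (down_paths D lam w)"
proof -
  have "down_paths D lam w = (\<Union>z\<in>{z \<in> W. z \<preceq> w}. {p \<in> down_paths D lam w. down_path D lam w p = z})"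
    using down_path_ble[OF w] down_path_weyl[OF w] by auto
  moreover have "finite {p \<in> down_paths D lam w. down_path D lam w p = z}" if "z \<in> W" for z
    using down_coef_scaled(1) good_scale_exists[of w] w that ble_refl by blast
  ultimately show ?thesis using finite_below[of w] by (metis (no_types, lifting) finite_UN_I mem_Collect_eq)
qed

lemma endpoint_straight: "endpoint D lam ([0, 1], [coset D lam id]) = lam"
proof -
  have m: "minrep D (coset D lam id) lam = lam" using mr_lam[of id] by simp
  show ?thesis unfolding endpoint_def prod.case
  proof (rule the_equality)
    fix \<mu> assume "\<forall>n. of_int (Poly_Mapping.lookup \<mu> n) = (\<Sum>j<length [coset D lam id].
      ([0, 1] ! (j + 1) - [0, 1] ! j) * (of_int (Poly_Mapping.lookup (minrep D ([coset D lam id] ! j) lam) n) :: rat))"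
    then have "of_int (Poly_Mapping.lookup \<mu> n) = (of_int (Poly_Mapping.lookup lam n) :: rat)" for n
      by (simp add: m)
    then show "\<mu> = lam" by (intro poly_mapping_eqI) simp
  qed (simp add: m)
qed

lemma pre_path_id:
  assumes R: "\<And>b y p. R b y p \<Longrightarrow> p \<preceq> y" and p: "pre_path R P bs \<sigma>s id"
  shows "bs = [0] \<and> \<sigma>s = [coset D lam id] \<and> P id"
  using p
proof cases
  case (step bs' \<sigma>s' p b)
  then have "p = id" using R[of b id p] ble_len[of p id] by auto
  then show ?thesis using step by simp
qed simp

lemma up_coef_id: assumes z: "z \<in> W" shows "up_coef id z = (if z = id then ex lam else 0)"
proof -
  have "pre_path up_rel (is_up z) bs \<sigma>s id \<longleftrightarrow> z = id \<and> bs = [0] \<and> \<sigma>s = [coset D lam id]" for bs \<sigma>s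
  proof
    assume "pre_path up_rel (is_up z) bs \<sigma>s id"
    from pre_path_id[OF _ this] have "bs = [0] \<and> \<sigma>s = [coset D lam id] \<and> is_up z id"
      using up_relD is_up_le by blast
    moreover from this have "z = id" using ble_len[of z id] is_up_le[of z id] by auto
    ultimately show "z = id \<and> bs = [0] \<and> \<sigma>s = [coset D lam id]" by blast
  qed (use is_up_self[of id] start[of "is_up id" id up_rel] in auto)
  then have "up_paths D lam id z = (if z = id then {([0, 1], [coset D lam id])} else {})"
    by (auto simp: up_paths_eq[OF z])
  then show ?thesis by (simp add: up_coef_def endpoint_straight)
qed

lemma down_coef_id: assumes z: "z \<in> W" shows "down_coef id z = (if z = id then ex (- lam) else 0)"
proof -
  have d: "is_down id y \<longleftrightarrow> y = id" for y
    using is_down_self[of id] is_down_le[of id y] ble_len[of y id] by auto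
  have "pre_path down_rel (\<lambda>y. y = z) bs \<sigma>s id \<longleftrightarrow> z = id \<and> bs = [0] \<and> \<sigma>s = [coset D lam id]" for bs \<sigma>s
  proof
    assume "pre_path down_rel (\<lambda>y. y = z) bs \<sigma>s id"
    from pre_path_id[OF _ this] show "z = id \<and> bs = [0] \<and> \<sigma>s = [coset D lam id]"
      using down_relD is_down_le by blast
  qed (use start[of "\<lambda>y. y = id" id down_rel] in auto)
  then have "{p \<in> down_paths D lam id. down_path D lam id p = z} = (if z = id then {([0, 1], [coset D lam id])} else {})"
    unfolding down_paths_eq[OF id_weyl z] d by auto
  then show ?thesis by (simp add: down_coef_def endpoint_straight)
qed

end

abbreviation fr :: "'n::{finite,linorder} RT \<Rightarrow> 'n FT" where "fr f \<equiv> Fract f 1"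

lemma fr_add: "fr (f + g) = fr f + fr g" and fr_mult: "fr (f * g) = fr f * fr g"
  and fr_0: "fr 0 = 0" and fr_1: "fr 1 = 1" and fr_diff: "fr (f - g) = fr f - fr g"
  by (simp_all add: Zero_fract_def One_fract_def)

lemma fr_sum: "fr (\<Sum>i\<in>A. f i) = (\<Sum>i\<in>A. fr (f i))"
  by (induction A rule: infinite_finite_induct) (auto simp: fr_add fr_0 simp del: add_fract)

lemma fr_eq_iff: "fr f = fr g \<longleftrightarrow> f = g"
  by (simp add: eq_fract)

subsection \<open>A finite linearly independent set of functionals\<close>

text \<open>Linear algebra over the integers, hence the multiplier n. If \<open>f k\<close> does not
  vanish on the common kernel of the others, a point of that kernel is used to subtract the
  \<open>f k\<close> part from g.\<close>

lemma functional_in_span: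
  fixes f :: "'i \<Rightarrow> 'v::ab_group_add \<Rightarrow> int" and sc :: "int \<Rightarrow> 'v \<Rightarrow> 'v"
  assumes "finite A"
    and f: "\<And>i \<mu> \<nu>. i \<in> A \<Longrightarrow> f i (\<mu> - \<nu>) = f i \<mu> - f i \<nu>" "\<And>i c \<mu>. i \<in> A \<Longrightarrow> f i (sc c \<mu>) = c * f i \<mu>"
    and g: "\<And>\<mu> \<nu>. g (\<mu> - \<nu>) = g \<mu> - g \<nu>" "\<And>c \<mu>. g (sc c \<mu>) = c * g \<mu>"
    and ker: "\<And>\<mu>. (\<And>i. i \<in> A \<Longrightarrow> f i \<mu> = 0) \<Longrightarrow> g \<mu> = 0"
  shows "\<exists>n c. n \<noteq> 0 \<and> (\<forall>\<mu>. n * g \<mu> = (\<Sum>i\<in>A. c i * f i \<mu>))"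
  using assms
proof (induction A arbitrary: g rule: finite_induct)
  case empty
  then show ?case by (intro exI[of _ 1]) auto
next
  case (insert k A)
  show ?case
  proof (cases "\<forall>\<mu>. (\<forall>i\<in>A. f i \<mu> = 0) \<longrightarrow> f k \<mu> = 0")
    case True
    have "\<exists>n c. n \<noteq> 0 \<and> (\<forall>\<mu>. n * g \<mu> = (\<Sum>i\<in>A. c i * f i \<mu>))"
    proof (rule insert.IH)
      fix \<mu> assume "\<And>i. i \<in> A \<Longrightarrow> f i \<mu> = 0"
      then show "g \<mu> = 0" by (intro insert.prems(5)) (use True in auto)
    qed (use insert.prems(1-4) in auto)
    then obtain n c where c: "n \<noteq> 0" "\<And>\<mu>. n * g \<mu> = (\<Sum>i\<in>A. c i * f i \<mu>)" by blast
    have "(\<Sum>i\<in>A. c i * f i \<mu>) = (\<Sum>i\<in>insert k A. (c(k := 0)) i * f i \<mu>)" for \<mu>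
      using insert.hyps by (auto intro!: sum.cong)
    then show ?thesis using c by (intro exI[of _ n] exI[of _ "c(k := 0)"]) simp
  next
    case False
    then obtain \<mu>0 where \<mu>0: "\<And>i. i \<in> A \<Longrightarrow> f i \<mu>0 = 0" "f k \<mu>0 \<noteq> 0" by blast
    let ?g = "\<lambda>\<mu>. f k \<mu>0 * g \<mu> - g \<mu>0 * f k \<mu>"
    have "\<exists>n c. n \<noteq> 0 \<and> (\<forall>\<mu>. n * ?g \<mu> = (\<Sum>i\<in>A. c i * f i \<mu>))"
    proof (rule insert.IH)
      fix \<mu> assume z: "\<And>i. i \<in> A \<Longrightarrow> f i \<mu> = 0"
      have "g (sc (f k \<mu>0) \<mu> - sc (f k \<mu>) \<mu>0) = 0"
        by (rule insert.prems(5)) (use insert.prems(1,2) z \<mu>0 in \<open>auto simp: mult.commute\<close>)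
      then show "?g \<mu> = 0" by (simp add: insert.prems(3,4) mult.commute)
    next
      show "?g (\<mu> - \<nu>) = ?g \<mu> - ?g \<nu>" for \<mu> \<nu>
        unfolding insert.prems(1)[OF insertI1] insert.prems(3) by (simp add: algebra_simps)
      show "?g (sc a \<mu>) = a * ?g \<mu>" for a \<mu>
        unfolding insert.prems(2)[OF insertI1] insert.prems(4) by (simp add: algebra_simps)
    qed (use insert.prems(1,2) in auto)
    then obtain n c where c: "n \<noteq> 0" "\<And>\<mu>. n * ?g \<mu> = (\<Sum>i\<in>A. c i * f i \<mu>)" by blast
    have "(n * f k \<mu>0) * g \<mu> = (\<Sum>i\<in>insert k A. (c(k := n * g \<mu>0)) i * f i \<mu>)" for \<mu>
    proof -
      have "(\<Sum>i\<in>insert k A. (c(k := n * g \<mu>0)) i * f i \<mu>) = n * g \<mu>0 * f k \<mu> + (\<Sum>i\<in>A. c i * f i \<mu>)"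
        using insert.hyps by (auto intro!: sum.cong)
      then show ?thesis using c(2)[of \<mu>] by (simp add: algebra_simps)
    qed
    then show ?thesis using c(1) \<mu>0(2)
      by (intro exI[of _ "n * f k \<mu>0"] exI[of _ "c(k := n * g \<mu>0)"]) simp
  qed
qed

section \<open>Dominant weights separate Weyl group elements\<close>

context kac_moody_datum
begin

text \<open>A simple coroot vanishing on the common kernel of the others would have a nonzero
  multiple in their span, against independence. So each is nonzero on some weight that the others
  kill, and these weights, with suitable signs, are added.\<close>

lemma regular_dominant: "\<exists>\<rho>. \<forall>i\<in>I. cr i \<rho> > 0"
proof -
  have "\<exists>\<mu>. cr i \<mu> > 0 \<and> (\<forall>j\<in>I - {i}. cr j \<mu> = 0)" if i: "i \<in> I" for i
  proof -
    have "\<exists>\<mu>. cr i \<mu> \<noteq> 0 \<and> (\<forall>j\<in>I - {i}. cr j \<mu> = 0)"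
    proof (rule ccontr)
      assume n: "\<not> ?thesis"
      have "\<exists>n c. n \<noteq> 0 \<and> (\<forall>\<mu>. n * cr i \<mu> = (\<Sum>j\<in>I - {i}. c j * cr j \<mu>))"
        by (rule functional_in_span[where sc = frag_cmul]) (use i n finite_nodes in \<open>auto simp: cr_simps\<close>)
      then obtain n c where c: "n \<noteq> 0" "\<And>\<mu>. n * cr i \<mu> = (\<Sum>j\<in>I - {i}. c j * cr j \<mu>)" by blast
      let ?d = "\<lambda>j. if j = i then n else - c j"
      have "(\<Sum>j\<in>I. ?d j * cr j \<mu>) = 0" for \<mu>
      proof -
        have "(\<Sum>j\<in>I. ?d j * cr j \<mu>) = n * cr i \<mu> + (\<Sum>j\<in>I - {i}. ?d j * cr j \<mu>)"
          using i finite_nodes by (subst sum.remove[of _ i]) auto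
        also have "(\<Sum>j\<in>I - {i}. ?d j * cr j \<mu>) = - (\<Sum>j\<in>I - {i}. c j * cr j \<mu>)"
          by (simp add: sum_negf[symmetric] cong: sum.cong_simp)
        finally show ?thesis using c(2) by simp
      qed
      then have "?d i = 0" using coroots_independent[of ?d i] i by blast
      then show False using c by simp
    qed
    then obtain \<mu> where \<mu>: "cr i \<mu> \<noteq> 0" "\<And>j. j \<in> I - {i} \<Longrightarrow> cr j \<mu> = 0" by blast
    show ?thesis
    proof (cases "cr i \<mu> > 0")
      case False
      then have "cr i (- \<mu>) > 0" using \<mu> i by (simp add: cr_simps)
      then show ?thesis using \<mu>(2) by (intro exI[of _ "- \<mu>"]) (auto simp: cr_simps)
    qed (use \<mu> in blast)
  qed
  then obtain \<mu> where \<mu>: "\<And>i. i \<in> I \<Longrightarrow> cr i (\<mu> i) > 0" "\<And>i j. i \<in> I \<Longrightarrow> j \<in> I - {i} \<Longrightarrow> cr j (\<mu> i) = 0" by metis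
  have "cr i (\<Sum>j\<in>I. \<mu> j) > 0" if i: "i \<in> I" for i
  proof -
    have "(\<Sum>j\<in>I. cr i (\<mu> j)) = cr i (\<mu> i) + (\<Sum>j\<in>I - {i}. cr i (\<mu> j))"
      using i finite_nodes by (subst sum.remove[of _ i]) auto
    also have "(\<Sum>j\<in>I - {i}. cr i (\<mu> j)) = 0" using \<mu>(2) i by (intro sum.neutral) auto
    finally show ?thesis using \<mu>(1) i by (simp add: cr_sum)
  qed
  then show ?thesis by blast
qed

text \<open>A weight on which v and w differ becomes a difference of two dominant ones after adding
  a large multiple of a regular dominant weight.\<close>

lemma dominant_separates:
  assumes "v \<in> W" "w \<in> W" "v \<noteq> w"
  obtains \<nu> where "dominant D \<nu>" "v \<nu> \<noteq> w \<nu>"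
proof -
  obtain \<mu> where \<mu>: "v \<mu> \<noteq> w \<mu>" using assms by fastforce
  obtain \<rho> where \<rho>: "\<And>i. i \<in> I \<Longrightarrow> cr i \<rho> > 0" using regular_dominant by blast
  define n where "n = (\<Sum>i\<in>I. \<bar>cr i \<mu>\<bar>)"
  have n: "\<bar>cr i \<mu>\<bar> \<le> n" if "i \<in> I" for i
    unfolding n_def using that finite_nodes by (intro member_le_sum) auto
  have n0: "n \<ge> 0" unfolding n_def by (rule sum_nonneg) simp
  have d: "dominant D (frag_cmul n \<rho>)"
    unfolding dominant_def
  proof
    fix i assume "i \<in> I"
    then show "0 \<le> cr i (frag_cmul n \<rho>)" using mult_nonneg_nonneg[OF n0 less_imp_le[OF \<rho>]] by (simp add: cr_cmul)
  qed
  have "cr i (\<mu> + frag_cmul n \<rho>) \<ge> 0" if i: "i \<in> I" for i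
  proof -
    have "n * 1 \<le> n * cr i \<rho>" using \<rho>[OF i] n0 by (intro mult_left_mono) auto
    then show ?thesis using n[OF i] i by (simp add: cr_simps)
  qed
  then have d': "dominant D (\<mu> + frag_cmul n \<rho>)" by (simp add: dominant_def)
  have "v (frag_cmul n \<rho>) \<noteq> w (frag_cmul n \<rho>) \<or> v (\<mu> + frag_cmul n \<rho>) \<noteq> w (\<mu> + frag_cmul n \<rho>)"
    using \<mu> assms by (auto simp: weyl_add)
  then show ?thesis using that d d' by blast
qed

lemma dominant_add: "dominant D \<mu> \<Longrightarrow> dominant D \<nu> \<Longrightarrow> dominant D (\<mu> + \<nu>)"
  by (simp add: dominant_def coroot_additive)

lemma dominant_0: "dominant D 0"
  by (simp add: dominant_def cr_0)

text \<open>Dedekind's independence of characters, for the dominant weights.\<close>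

lemma dedekind:
  assumes "finite V" "V \<subseteq> W" "\<And>\<mu>. dominant D \<mu> \<Longrightarrow> (\<Sum>v\<in>V. c v * fr (ex (v \<mu>))) = 0" "v \<in> V"
  shows "c v = 0"
  using assms
proof (induction V arbitrary: c v rule: finite_induct)
  case (insert w V)
  have z: "c u = 0" if u: "u \<in> V" for u
  proof -
    have ne: "u \<noteq> w" "u \<in> W" "w \<in> W" using u insert by auto
    obtain \<nu> where \<nu>: "dominant D \<nu>" "u \<nu> \<noteq> w \<nu>" using dominant_separates[OF ne(2,3,1)] by blast
    \<comment> \<open>Subtracting \<open>ex (w \<nu>)\<close> times the relation at \<mu> from the
      relation at \<mu> + \<nu> removes the term of w, while the coefficient of u is multiplied by a
      nonzero factor.\<close>
    let ?c = "\<lambda>v. c v * (fr (ex (v \<nu>)) - fr (ex (w \<nu>)))"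
    have "(\<Sum>v\<in>V. ?c v * fr (ex (v \<mu>))) = 0" if \<mu>: "dominant D \<mu>" for \<mu>
    proof -
      have "(\<Sum>v\<in>insert w V. c v * fr (ex (v (\<mu> + \<nu>)))) - fr (ex (w \<nu>)) * (\<Sum>v\<in>insert w V. c v * fr (ex (v \<mu>))) = 0"
        using insert.prems(2)[OF \<mu>] insert.prems(2)[OF dominant_add[OF \<mu> \<nu>(1)]] by simp
      moreover have "(\<Sum>v\<in>insert w V. c v * fr (ex (v (\<mu> + \<nu>)))) - fr (ex (w \<nu>)) * (\<Sum>v\<in>insert w V. c v * fr (ex (v \<mu>)))
        = (\<Sum>v\<in>insert w V. ?c v * fr (ex (v \<mu>)))"
        unfolding sum_distrib_left sum_subtractf[symmetric]
      proof (rule sum.cong[OF refl])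
        fix v assume "v \<in> insert w V"
        then have "v \<in> W" using insert.prems by blast
        then have "fr (ex (v (\<mu> + \<nu>))) = fr (ex (v \<mu>)) * fr (ex (v \<nu>))" by (simp only: weyl_add ex_add fr_mult)
        then show "c v * fr (ex (v (\<mu> + \<nu>))) - fr (ex (w \<nu>)) * (c v * fr (ex (v \<mu>))) = ?c v * fr (ex (v \<mu>))"
          by (simp only: right_diff_distrib left_diff_distrib mult_ac)
      qed
      moreover have "(\<Sum>v\<in>insert w V. ?c v * fr (ex (v \<mu>))) = (\<Sum>v\<in>V. ?c v * fr (ex (v \<mu>)))"
        using insert.hyps by (simp add: fr_0)
      ultimately show ?thesis by simp
    qed
    then have "?c u = 0" using insert.IH[of ?c u] insert.prems u by simp
    moreover have "fr (ex (u \<nu>)) \<noteq> fr (ex (w \<nu>))" using \<nu> by (simp add: fr_eq_iff)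
    ultimately show ?thesis unfolding mult_eq_0_iff right_minus_eq by blast
  qed
  have "(\<Sum>v\<in>insert w V. c v * fr (ex (v 0))) = 0" using insert.prems(2) dominant_0 by blast
  then have "c w * fr (ex (w 0)) = 0" using insert.hyps z by simp
  moreover have "w 0 = 0" using insert.prems by simp
  ultimately have "c w = 0" by (simp only: ex_0 fr_1 mult_1_right)
  then show ?case using z insert.prems by blast
qed simp

subsection \<open>The action on fractions\<close>

lemma weyl_inj: "w \<in> W \<Longrightarrow> inj w"
  by (simp add: bij_is_inj)

lemma act_RT_weyl_mult: "w \<in> W \<Longrightarrow> act_RT w (f * g) = act_RT w f * act_RT w g"
  by (rule act_RT_mult) (rule weyl_add)

lemma act_RT_weyl_1: "w \<in> W \<Longrightarrow> act_RT w 1 = 1"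
  by (rule act_RT_1) simp

lemma act_RT_weyl_0_iff: "w \<in> W \<Longrightarrow> act_RT w f = 0 \<longleftrightarrow> f = 0"
  using act_RT_eq_iff[OF weyl_inj, of w f 0] by simp

lemma act_FT_Fract:
  assumes w: "w \<in> W" and b: "b \<noteq> 0"
  shows "act_FT w (Fract a b) = Fract (act_RT w a) (act_RT w b)"
  unfolding act_FT_def
proof (rule the_equality)
  fix r assume "\<exists>a' b'. b' \<noteq> 0 \<and> Fract a b = Fract a' b' \<and> r = Fract (act_RT w a') (act_RT w b')"
  then obtain a' b' where *: "b' \<noteq> 0" "Fract a b = Fract a' b'" "r = Fract (act_RT w a') (act_RT w b')" by blast
  then have "a * b' = a' * b" using b by (simp add: eq_fract)
  then have "act_RT w a' * act_RT w b = act_RT w a * act_RT w b'"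
    using w by (simp only: act_RT_weyl_mult[symmetric])
  then show "r = Fract (act_RT w a) (act_RT w b)"
    using * b w by (simp add: eq_fract act_RT_weyl_0_iff)
qed (use b in blast)

lemma act_FT_fr: "w \<in> W \<Longrightarrow> act_FT w (fr f) = fr (act_RT w f)"
  by (simp add: act_FT_Fract act_RT_weyl_1)

lemma act_FT_add: assumes w: "w \<in> W" shows "act_FT w (p + q) = act_FT w p + act_FT w q"
proof -
  obtain a b where p: "p = Fract a b" "b \<noteq> 0" by (rule Fract_cases)
  obtain c d where q: "q = Fract c d" "d \<noteq> 0" by (rule Fract_cases)
  have nz: "b * d \<noteq> 0" "act_RT w b \<noteq> 0" "act_RT w d \<noteq> 0"
    using p q w by (simp_all add: act_RT_weyl_0_iff)
  show ?thesis
    unfolding p(1) q(1) add_fract[OF p(2) q(2)] act_FT_Fract[OF w nz(1)] act_FT_Fract[OF w p(2)]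
      act_FT_Fract[OF w q(2)] add_fract[OF nz(2,3)] act_RT_add act_RT_weyl_mult[OF w] ..
qed

lemma act_FT_mult: assumes w: "w \<in> W" shows "act_FT w (p * q) = act_FT w p * act_FT w q"
proof (cases p, cases q)
  fix a b c d assume "p = Fract a b" "b \<noteq> 0" "q = Fract c d" "d \<noteq> 0"
  then show ?thesis using w by (simp add: act_FT_Fract act_RT_weyl_mult)
qed

lemma act_FT_0: "w \<in> W \<Longrightarrow> act_FT w 0 = 0"
  using act_FT_fr[of w 0] by (simp only: fr_0 act_RT_0)

lemma act_FT_sum: "w \<in> W \<Longrightarrow> act_FT w (\<Sum>i\<in>A. f i) = (\<Sum>i\<in>A. act_FT w (f i))"
  by (induction A rule: infinite_finite_induct) (auto simp: act_FT_0 act_FT_add)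

lemma act_FT_comp: assumes "v \<in> W" "w \<in> W" shows "act_FT v (act_FT w q) = act_FT (v \<circ> w) q"
proof (cases q)
  case (Fract a b)
  then show ?thesis using assms by (simp add: act_FT_Fract act_RT_weyl_0_iff act_RT_comp)
qed

lemma act_FT_id: "act_FT id (q :: 'n FT) = q"
  by (cases q) (simp add: act_FT_Fract[OF id_weyl])

subsection \<open>The smash product as a ring of operators\<close>

definition opr :: "'n smash \<Rightarrow> 'n FT \<Rightarrow> 'n FT" where
  "opr x q = (\<Sum>v\<in>Poly_Mapping.keys x. Poly_Mapping.lookup x v * act_FT v q)"

definition supp :: "'n smash \<Rightarrow> bool" where
  "supp x \<longleftrightarrow> Poly_Mapping.keys x \<subseteq> W"

lemma opr_superset:
  assumes "finite A" "Poly_Mapping.keys x \<subseteq> A"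
  shows "opr x q = (\<Sum>v\<in>A. Poly_Mapping.lookup x v * act_FT v q)"
  unfolding opr_def using assms by (intro sum.mono_neutral_left) (auto simp: in_keys_iff)

lemma opr_add: "opr (x + y) q = opr x q + opr y q"
proof -
  let ?A = "Poly_Mapping.keys x \<union> Poly_Mapping.keys y"
  have "opr (x + y) q = (\<Sum>v\<in>?A. Poly_Mapping.lookup (x + y) v * act_FT v q)"
    by (rule opr_superset) (use Poly_Mapping.keys_add[of x y] in auto)
  then show ?thesis
    by (simp add: opr_superset[of ?A x] opr_superset[of ?A y] lookup_add distrib_right sum.distrib)
qed

lemma opr_0: "opr 0 q = 0"
  by (simp add: opr_def)

lemma opr_diff: "opr (x - y) q = opr x q - opr y q"
  using opr_add[of "x - y" y q] by simp

lemma opr_sum: "opr (\<Sum>i\<in>A. f i) q = (\<Sum>i\<in>A. opr (f i) q)"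
  by (induction A rule: infinite_finite_induct) (auto simp: opr_0 opr_add)

lemma opr_single: "opr (Poly_Mapping.single v c) q = c * act_FT v q"
  by (simp add: opr_def)

lemma opr_mult:
  assumes "supp x" "supp y" shows "opr (smash_mult x y) q = opr x (opr y q)"
proof -
  have "opr x (opr y q) = (\<Sum>v\<in>Poly_Mapping.keys x. \<Sum>w\<in>Poly_Mapping.keys y.
      Poly_Mapping.lookup x v * (act_FT v (Poly_Mapping.lookup y w) * act_FT (v \<circ> w) q))"
    unfolding opr_def[of x] opr_def[of y] sum_distrib_left[symmetric]
  proof (rule sum.cong[OF refl])
    fix v assume "v \<in> Poly_Mapping.keys x"
    then have v: "v \<in> W" using assms by (auto simp: supp_def)
    have "act_FT v (\<Sum>w\<in>Poly_Mapping.keys y. Poly_Mapping.lookup y w * act_FT w q)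
      = (\<Sum>w\<in>Poly_Mapping.keys y. act_FT v (Poly_Mapping.lookup y w) * act_FT (v \<circ> w) q)"
      unfolding act_FT_sum[OF v]
      by (rule sum.cong[OF refl]) (use v assms in \<open>auto simp: act_FT_mult act_FT_comp supp_def\<close>)
    then show "Poly_Mapping.lookup x v * act_FT v (\<Sum>w\<in>Poly_Mapping.keys y. Poly_Mapping.lookup y w * act_FT w q)
      = Poly_Mapping.lookup x v * (\<Sum>w\<in>Poly_Mapping.keys y. act_FT v (Poly_Mapping.lookup y w) * act_FT (v \<circ> w) q)"
      by simp
  qed
  then show ?thesis unfolding smash_mult_def opr_sum opr_single by (simp add: mult.assoc)
qed

lemma supp_add: "supp x \<Longrightarrow> supp y \<Longrightarrow> supp (x + y)"
  using Poly_Mapping.keys_add[of x y] by (auto simp: supp_def)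

lemma supp_0 [simp]: "supp 0"
  by (simp add: supp_def)

lemma supp_sum: "(\<And>i. i \<in> A \<Longrightarrow> supp (f i)) \<Longrightarrow> supp (\<Sum>i\<in>A. f i)"
  by (induction A rule: infinite_finite_induct) (auto simp: supp_add)

lemma supp_single: "v \<in> W \<Longrightarrow> supp (Poly_Mapping.single v c)"
  by (simp add: supp_def)

lemma supp_diff: "supp x \<Longrightarrow> supp y \<Longrightarrow> supp (x - y)"
  using keys_diff[of x y] by (auto simp: supp_def)

lemma supp_mult: "supp x \<Longrightarrow> supp y \<Longrightarrow> supp (smash_mult x y)"
  unfolding smash_mult_def by (intro supp_sum supp_single comp_weyl) (auto simp: supp_def)

text \<open>By \<open>dedekind\<close>, dominant exponentials are enough as test elements.
  \<open>T_word_unique\<close> depends on this restriction, since path sums give the action on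
  dominant exponentials only.\<close>

lemma opr_faithful:
  assumes x: "supp x" and y: "supp y" and eq: "\<And>\<mu>. dominant D \<mu> \<Longrightarrow> opr x (fr (ex \<mu>)) = opr y (fr (ex \<mu>))"
  shows "x = y"
proof -
  have d: "supp (x - y)" using x y supp_diff by blast
  have "Poly_Mapping.lookup (x - y) v = 0" if "v \<in> Poly_Mapping.keys (x - y)" for v
  proof (rule dedekind[OF finite_keys _ _ that])
    show K: "Poly_Mapping.keys (x - y) \<subseteq> W" using d by (simp add: supp_def)
    fix \<mu> assume "dominant D \<mu>"
    then have "opr (x - y) (fr (ex \<mu>)) = 0" using eq by (simp add: opr_diff)
    moreover have "opr (x - y) (fr (ex \<mu>))
      = (\<Sum>v\<in>Poly_Mapping.keys (x - y). Poly_Mapping.lookup (x - y) v * fr (ex (v \<mu>)))"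
      unfolding opr_def by (rule sum.cong[OF refl]) (use K act_FT_fr in auto)
    ultimately show "(\<Sum>v\<in>Poly_Mapping.keys (x - y). Poly_Mapping.lookup (x - y) v * fr (ex (v \<mu>))) = 0" by simp
  qed
  then have "Poly_Mapping.lookup (x - y) v = 0" for v by (cases "v \<in> Poly_Mapping.keys (x - y)") (auto simp: in_keys_iff)
  then have "x - y = 0" by (intro poly_mapping_eqI) simp
  then show ?thesis by simp
qed

lemma supp_one: "supp smash_one" and opr_one: "opr smash_one q = q"
  by (simp_all add: smash_one_def supp_single opr_single act_FT_id)

lemma supp_of_RT: "supp (of_RT f)" and opr_of_RT: "opr (of_RT f) q = fr f * q"
  by (simp_all add: of_RT_def supp_single opr_single act_FT_id)

definition den :: "'i \<Rightarrow> 'n FT" where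
  "den i = fr (1 - ex (rt i))"

lemma den_nonzero: assumes "i \<in> I" shows "den i \<noteq> 0"
proof -
  have "rt i \<noteq> 0" using rt_nonzero[of id i] assms by simp
  then have "1 - ex (rt i) \<noteq> 0" using ex_eq_iff[of "rt i" 0] by simp
  then show ?thesis unfolding den_def fr_0[symmetric] fr_eq_iff .
qed

definition tau :: "'i \<Rightarrow> 'n FT \<Rightarrow> 'n FT" where
  "tau i q = (act_FT (s i) q - q) / den i"

lemma supp_T_simple: "i \<in> I \<Longrightarrow> supp (T_simple D i)"
  unfolding T_simple_def by (intro supp_mult supp_single supp_diff supp_one) auto

lemma opr_T_simple: assumes i: "i \<in> I" shows "opr (T_simple D i) q = tau i q"
proof -
  have "supp (Poly_Mapping.single (s i) 1 - smash_one)" "supp (Poly_Mapping.single id (inverse (Fract (1 - ex (rt i)) 1)))"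
    using i by (simp_all add: supp_single supp_diff supp_one)
  then show ?thesis
    unfolding T_simple_def
    by (simp only: opr_mult opr_single opr_diff opr_one act_FT_id mult_1_left)
       (simp only: tau_def den_def divide_inverse mult.commute)
qed

lemma act_FT_srefl: "i \<in> I \<Longrightarrow> act_FT (s i) q = q + den i * tau i q"
  by (simp add: tau_def den_nonzero)

lemma act_den: assumes "i \<in> I" shows "act_FT (s i) (den i) = - den i / fr (ex (rt i))"
proof -
  have "ex (- rt i) * ex (rt i) = (1 :: 'n RT)" by (simp flip: ex_add)
  then have "fr (ex (- rt i)) * fr (ex (rt i)) = 1" by (simp only: fr_mult[symmetric] fr_1)
  moreover have "fr (ex (rt i)) \<noteq> 0" unfolding fr_0[symmetric] fr_eq_iff by simp
  ultimately have e: "fr (ex (- rt i)) = 1 / fr (ex (rt i))" by (simp add: field_simps)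
  have "act_FT (s i) (den i) = fr (act_RT (s i) (1 - ex (rt i)))"
    using assms by (simp only: den_def act_FT_fr srefl_weyl)
  also have "\<dots> = 1 - fr (ex (- rt i))"
    using assms by (simp only: srefl_weyl act_RT_diff act_RT_weyl_1 act_RT_ex srefl_rt fr_diff fr_1)
  finally have "act_FT (s i) (den i) = 1 - fr (ex (- rt i))" .
  then show ?thesis using \<open>fr (ex (rt i)) \<noteq> 0\<close> unfolding e den_def fr_diff fr_1 by (simp add: field_simps)
qed

lemma tau_tau: assumes i: "i \<in> I" shows "tau i (tau i q) = - tau i q"
proof -
  let ?x = "fr (ex (rt i)) :: 'n FT"
  have x: "?x \<noteq> 0" unfolding fr_0[symmetric] fr_eq_iff by simp
  have dx: "den i = 1 - ?x" by (simp only: den_def fr_diff fr_1)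
  have "act_FT (s i) (den i * tau i q) = act_FT (s i) (act_FT (s i) q - q)"
    using den_nonzero[OF i] by (simp add: tau_def)
  also have "\<dots> = q - act_FT (s i) q"
    using i act_FT_add[of "s i" "act_FT (s i) q - q" q] by (simp add: act_FT_comp act_FT_id eq_diff_eq)
  also have "\<dots> = - (den i * tau i q)" using den_nonzero[OF i] by (simp add: tau_def)
  finally have "(- den i / ?x) * act_FT (s i) (tau i q) = - (den i * tau i q)"
    using i by (simp only: act_FT_mult srefl_weyl act_den)
  then have "act_FT (s i) (tau i q) = ?x * tau i q" using x den_nonzero[OF i] by (simp add: field_simps)
  then have "tau i (tau i q) = (?x * tau i q - tau i q) / den i" by (simp add: tau_def)
  also have "\<dots> = - tau i q" using den_nonzero[OF i] unfolding dx by (simp add: field_simps)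
  finally show ?thesis .
qed

section \<open>Products along reduced words and their expansion\<close>

definition T_word :: "'i list \<Rightarrow> 'n smash" where
  "T_word u = foldr (\<lambda>i x. smash_mult (T_simple D i) x) u smash_one"

lemma supp_T_word: "set u \<subseteq> I \<Longrightarrow> supp (T_word u)"
  by (induction u) (auto simp: T_word_def supp_one supp_mult supp_T_simple)

lemma opr_T_word_Cons: "set (i # u) \<subseteq> I \<Longrightarrow> opr (T_word (i # u)) q = tau i (opr (T_word u) q)"
  using supp_T_word[of u] by (simp add: T_word_def opr_mult supp_T_simple opr_T_simple)

lemma reduced_word_exists: "w \<in> W \<Longrightarrow> \<exists>u. reduced_word D u w"
  unfolding reduced_word_def using reduced_exists by metis

lemma reduced_word_Cons:
  assumes "reduced_word D (i # u) w"
  shows "i \<in> I" "reduced_word D u (s i \<circ> w)" "asc i (s i \<circ> w)" "s i \<circ> w \<in> W"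
proof -
  have u: "i \<in> I" "set u \<subseteq> I" "w = s i \<circ> word_prod D u" "length u + 1 = \<ell> w"
    using assms by (auto simp: reduced_word_def)
  then have p: "word_prod D u = s i \<circ> w" by simp
  have W: "word_prod D u \<in> W" using weyl_word u by blast
  show "i \<in> I" "s i \<circ> w \<in> W" using u W p by auto
  have "\<ell> (s i \<circ> w) \<le> length u" using len_le[OF u(2) p] .
  moreover have "\<ell> w \<le> \<ell> (s i \<circ> w) + 1" using len_lmult_le[of "s i \<circ> w" i] \<open>s i \<circ> w \<in> W\<close> u(1) by simp
  ultimately have l: "\<ell> (s i \<circ> w) = length u" using u by simp
  then show "reduced_word D u (s i \<circ> w)" using u(2) p by (simp only: reduced_word_def simp_thms)
  show "asc i (s i \<circ> w)" using l u(1,4) by simp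
qed

lemma intertwines_unscaled:
  assumes "i \<in> I" "intertwines i 1 1 X y" "z \<in> W"
  shows "S i 1 (X y) z = X y z + (1 - ex (rt i)) * X (s i \<circ> y) z"
  using assms(2,3) unfolding intertwines_def[OF assms(1)]
  by (simp add: E_0[OF assms(1)]) (simp add: E_def[OF assms(1)])

lemma asc_id: "i \<in> I \<Longrightarrow> asc i id"
proof -
  assume i: "i \<in> I"
  have "s i \<noteq> id"
  proof
    assume "s i = id"
    then have "- rt i = rt i" using srefl_rt[OF i] by simp
    then have "rt i = 0" by (simp add: poly_mapping_eq_iff fun_eq_iff)
    then show False using rt_nonzero[of id i] i by simp
  qed
  then have "\<ell> (s i) \<noteq> 0" using len_0_iff i by simp
  then show "asc i id" by simp
qed

text \<open>At z = id the operator \<open>S\<close> is the plain action of \<open>s i\<close>,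
  because the identity ascends. So the column of the identity satisfies the divided difference
  recursion on its own.\<close>

lemma opr_T_word_1:
  assumes X: "\<And>i y. i \<in> I \<Longrightarrow> y \<in> W \<Longrightarrow> asc i y \<Longrightarrow> intertwines i 1 1 X y"
  shows "reduced_word D u w \<Longrightarrow> opr (T_word u) (fr (X id id)) = fr (X w id)"
proof (induction u arbitrary: w)
  case Nil
  then show ?case by (simp add: reduced_word_def T_word_def opr_one)
next
  case (Cons i u)
  note r = reduced_word_Cons[OF Cons(2)]
  have uI: "set (i # u) \<subseteq> I" using Cons(2) by (simp add: reduced_word_def)
  let ?y = "s i \<circ> w"
  have IH: "opr (T_word u) (fr (X id id)) = fr (X ?y id)" using Cons(1) r(2) .
  have "act_RT (s i) (X ?y id) = X ?y id + (1 - ex (rt i)) * X (s i \<circ> ?y) id"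
    using intertwines_unscaled[OF r(1) X[OF r(1,4,3)] id_weyl] asc_id[OF r(1)] by (simp add: S_def[OF r(1)])
  then have "act_RT (s i) (X ?y id) = X ?y id + (1 - ex (rt i)) * X w id" using r(1) by simp
  then have "act_FT (s i) (fr (X ?y id)) - fr (X ?y id) = den i * fr (X w id)"
    using r(1) by (simp only: act_FT_fr srefl_weyl fr_add fr_mult den_def) (simp only: add_diff_cancel_left')
  then have "tau i (fr (X ?y id)) = fr (X w id)" unfolding tau_def using den_nonzero[OF r(1)] by simp
  then show ?case by (simp only: opr_T_word_Cons[OF uI] IH)
qed

text \<open>The value of \<open>T_word u\<close> on a dominant \<open>e\<^bsup>\<lambda>\<^esup>\<close> is a sum over LS paths that depends only on the
  product of \<open>u\<close>; this replaces the braid relations.\<close>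

lemma T_word_unique:
  assumes "reduced_word D u w" "reduced_word D u' w" shows "T_word u = T_word u'"
proof (rule opr_faithful)
  show "supp (T_word u)" "supp (T_word u')" using assms supp_T_word by (auto simp: reduced_word_def)
  fix \<mu> assume "dominant D \<mu>"
  then interpret dominant_datum D \<mu> by unfold_locales
  have "up_coef id id = ex \<mu>" using up_coef_id[OF id_weyl] by simp
  then show "opr (T_word u) (fr (ex \<mu>)) = opr (T_word u') (fr (ex \<mu>))"
    using opr_T_word_1[OF up_coef_intertwines assms(1)] opr_T_word_1[OF up_coef_intertwines assms(2)] by simp
qed

lemma T_elt_eq: assumes "reduced_word D u w" shows "T_elt D w = T_word u"
proof -
  have "reduced_word D (SOME u. reduced_word D u w) w" using assms by (rule someI)
  then show ?thesis unfolding T_elt_def T_word_def[symmetric] using T_word_unique assms by blast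
qed

lemma supp_T_elt: assumes "w \<in> W" shows "supp (T_elt D w)"
  using reduced_word_exists[OF assms] T_elt_eq supp_T_word unfolding reduced_word_def by metis

lemma opr_T_elt_id: "opr (T_elt D id) q = q"
  using T_elt_eq[of "[]" id] by (simp add: reduced_word_def T_word_def opr_one)

lemma tau_asc:
  assumes i: "i \<in> I" and z: "z \<in> W" "asc i z"
  shows "tau i (opr (T_elt D z) q) = opr (T_elt D (s i \<circ> z)) q"
proof -
  obtain u where u: "reduced_word D u z" using reduced_word_exists z by blast
  have r: "reduced_word D (i # u) (s i \<circ> z)"
    using u i len_asc[OF z(1) i z(2)] by (simp add: reduced_word_def)
  then have "set (i # u) \<subseteq> I" by (simp add: reduced_word_def)
  then show ?thesis using T_elt_eq[OF u] T_elt_eq[OF r] opr_T_word_Cons by simp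
qed

lemma tau_desc:
  assumes i: "i \<in> I" and z: "z \<in> W" "\<not> asc i z"
  shows "tau i (opr (T_elt D z) q) = - opr (T_elt D z) q"
proof -
  have "opr (T_elt D z) q = tau i (opr (T_elt D (s i \<circ> z)) q)"
    using tau_asc[OF i, of "s i \<circ> z"] i z not_asc by simp
  then show ?thesis using tau_tau[OF i] by simp
qed

text \<open>The origin of \<open>S\<close>: applying \<open>s i\<close> to a combination of the
  operators of \<open>T_elt\<close> and collecting coefficients by these two rules gives its two
  cases at N = 1.\<close>

lemma srefl_opr:
  assumes i: "i \<in> I" and z: "z \<in> W"
  shows "asc i z \<Longrightarrow> act_FT (s i) (opr (T_elt D z) q) = opr (T_elt D z) q + fr (1 - ex (rt i)) * opr (T_elt D (s i \<circ> z)) q"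
    "\<not> asc i z \<Longrightarrow> act_FT (s i) (opr (T_elt D z) q) = fr (ex (rt i)) * opr (T_elt D z) q"
proof -
  show "asc i z \<Longrightarrow> act_FT (s i) (opr (T_elt D z) q) = opr (T_elt D z) q + fr (1 - ex (rt i)) * opr (T_elt D (s i \<circ> z)) q"
    by (simp only: act_FT_srefl[OF i] tau_asc[OF i z] den_def)
  have "fr (1 - ex (rt i)) = 1 - fr (ex (rt i))" by (simp only: fr_diff fr_1)
  then have "act_FT (s i) q' = fr (ex (rt i)) * q'" if "tau i q' = - q'" for q'
    unfolding act_FT_srefl[OF i] that den_def by (simp add: left_diff_distrib)
  then show "\<not> asc i z \<Longrightarrow> act_FT (s i) (opr (T_elt D z) q) = fr (ex (rt i)) * opr (T_elt D z) q"
    using tau_desc[OF i z] by blast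
qed

text \<open>Induction through y = \<open>s i \<circ> w\<close> below w. The elements below w come in
  pairs z, \<open>s i \<circ> z\<close>, on which \<open>s i\<close> acts on coefficients as
  \<open>S\<close>. The intertwining relation then identifies the change under \<open>s i\<close> as
  \<open>den i\<close> times the row of w, and division by \<open>den i\<close> is the operator
  \<open>tau i\<close>.\<close>

lemma opr_T_elt_expansion:
  assumes X: "\<And>i y. i \<in> I \<Longrightarrow> y \<in> W \<Longrightarrow> asc i y \<Longrightarrow> intertwines i 1 1 X y"
    and X_le: "\<And>y z. y \<in> W \<Longrightarrow> z \<in> W \<Longrightarrow> X y z \<noteq> 0 \<Longrightarrow> z \<preceq> y"
    and X_id: "\<And>z. z \<in> W \<Longrightarrow> X id z = (if z = id then f else 0)"
  shows "w \<in> W \<Longrightarrow> opr (T_elt D w) (fr f * q) = (\<Sum>z\<in>{z \<in> W. z \<preceq> w}. fr (X w z) * opr (T_elt D z) q)"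
proof (induction "\<ell> w" arbitrary: w rule: less_induct)
  case less
  let ?t = "\<lambda>z. opr (T_elt D z) q"
  show ?case
  proof (cases "w = id")
    case True
    have "z = id" if "z \<preceq> id" for z using ble_len[OF that] by auto
    then have "{z \<in> W. z \<preceq> w} = {id}" using True by auto
    then show ?thesis using X_id[OF id_weyl] True opr_T_elt_id by simp
  next
    case False
    then obtain i where i: "i \<in> I" "\<not> asc i w" using first_descent less by blast
    let ?y = "s i \<circ> w"
    define Z where "Z = {z \<in> W. z \<preceq> w}"
    define A where "A = {z \<in> Z. asc i z}"
    have yW: "?y \<in> W" and ay: "asc i ?y" and sy: "s i \<circ> ?y = w" using i less not_asc by auto
    have yw: "?y \<preceq> w" using ble_desc less i by blast
    have Z: "finite Z" "\<And>p. p \<in> Z \<Longrightarrow> s i \<circ> p \<in> Z" "\<And>p. p \<in> Z \<Longrightarrow> p \<in> W"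
      unfolding Z_def using finite_below lift_desc[OF _ i] i by auto
    have split: "(\<Sum>p\<in>Z. g p) = (\<Sum>p\<in>A. g p + g (s i \<circ> p))" for g :: "_ \<Rightarrow> 'n FT"
      unfolding A_def using Z i not_asc by (intro sum_two_index) auto
    have IH: "opr (T_elt D ?y) (fr f * q) = (\<Sum>z\<in>Z. fr (X ?y z) * ?t z)"
    proof -
      have "\<ell> ?y < \<ell> w" using ay sy by simp
      then have "opr (T_elt D ?y) (fr f * q) = (\<Sum>z\<in>{z \<in> W. z \<preceq> ?y}. fr (X ?y z) * ?t z)" using less yW by blast
      also have "\<dots> = (\<Sum>z\<in>Z. fr (X ?y z) * ?t z)"
      proof (rule sum.mono_neutral_left[OF Z(1)])
        show "{z \<in> W. z \<preceq> ?y} \<subseteq> Z" using yw ble_trans by (auto simp: Z_def)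
        show "\<forall>z\<in>Z - {z \<in> W. z \<preceq> ?y}. fr (X ?y z) * ?t z = 0"
        proof
          fix z assume "z \<in> Z - {z \<in> W. z \<preceq> ?y}"
          then have "X ?y z = 0" using X_le[OF yW, of z] Z(3) by blast
          then show "fr (X ?y z) * ?t z = 0" by (simp only: fr_0 mult_zero_left)
        qed
      qed
      finally show ?thesis .
    qed
    have pair: "act_FT (s i) (fr (X ?y z) * ?t z) + act_FT (s i) (fr (X ?y (s i \<circ> z)) * ?t (s i \<circ> z))
      = fr (S i 1 (X ?y) z) * ?t z + fr (S i 1 (X ?y) (s i \<circ> z)) * ?t (s i \<circ> z)" if "z \<in> A" for z
    proof -
      have z: "z \<in> W" "asc i z" and sz: "s i \<circ> z \<in> W" "\<not> asc i (s i \<circ> z)"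
        using that Z not_asc[of z i] i unfolding A_def by auto
      have S1: "S i 1 (X ?y) z = act_RT (s i) (X ?y z)" using z by (simp add: S_def[OF i(1)])
      have S2: "S i 1 (X ?y) (s i \<circ> z) = (1 - ex (rt i)) * act_RT (s i) (X ?y z) + ex (rt i) * act_RT (s i) (X ?y (s i \<circ> z))"
        using sz i unfolding S_def[OF i(1)] by (simp add: E_def[OF i(1)])
      show ?thesis
        unfolding S1 S2 act_FT_mult[OF srefl_weyl[OF i(1)]] act_FT_fr[OF srefl_weyl[OF i(1)]]
          srefl_opr(1)[OF i(1) z] srefl_opr(2)[OF i(1) sz] fr_add fr_mult
        by (simp only: distrib_left distrib_right mult_ac add_ac)
    qed
    have "act_FT (s i) (opr (T_elt D ?y) (fr f * q)) = (\<Sum>z\<in>Z. act_FT (s i) (fr (X ?y z) * ?t z))"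
      unfolding IH by (rule act_FT_sum[OF srefl_weyl[OF i(1)]])
    also have "\<dots> = (\<Sum>z\<in>Z. fr (S i 1 (X ?y) z) * ?t z)"
      unfolding split using pair by (rule sum.cong[OF refl])
    also have "\<dots> = (\<Sum>z\<in>Z. fr (X ?y z) * ?t z + den i * (fr (X w z) * ?t z))"
    proof (rule sum.cong[OF refl])
      fix z assume "z \<in> Z"
      then have "S i 1 (X ?y) z = X ?y z + (1 - ex (rt i)) * X w z"
        using intertwines_unscaled[OF i(1) X[OF i(1) yW ay] Z(3)] sy by simp
      then show "fr (S i 1 (X ?y) z) * ?t z = fr (X ?y z) * ?t z + den i * (fr (X w z) * ?t z)"
        by (simp only: fr_add fr_mult den_def distrib_right mult.assoc)
    qed
    also have "\<dots> = opr (T_elt D ?y) (fr f * q) + den i * (\<Sum>z\<in>Z. fr (X w z) * ?t z)"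
      by (simp only: IH sum.distrib sum_distrib_left)
    finally have "tau i (opr (T_elt D ?y) (fr f * q)) = (\<Sum>z\<in>Z. fr (X w z) * ?t z)"
      unfolding tau_def using den_nonzero[OF i(1)] by simp
    then show ?thesis using tau_asc[OF i(1) yW ay] sy by (simp only: Z_def)
  qed
qed

subsection \<open>Finite sums in the nilHecke ring\<close>

lemma smash_mult_superset:
  assumes "finite A" "Poly_Mapping.keys x \<subseteq> A"
  shows "smash_mult x y = (\<Sum>v\<in>A. \<Sum>w\<in>Poly_Mapping.keys y.
     Poly_Mapping.single (v \<circ> w) (Poly_Mapping.lookup x v * act_FT v (Poly_Mapping.lookup y w)))"
  unfolding smash_mult_def using assms
  by (intro sum.mono_neutral_left) (auto simp: in_keys_iff)

lemma smash_mult_add_left: "smash_mult (x + x') y = smash_mult x y + smash_mult x' y"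
proof -
  let ?A = "Poly_Mapping.keys x \<union> Poly_Mapping.keys x'"
  have "smash_mult (x + x') y = (\<Sum>v\<in>?A. \<Sum>w\<in>Poly_Mapping.keys y.
     Poly_Mapping.single (v \<circ> w) (Poly_Mapping.lookup (x + x') v * act_FT v (Poly_Mapping.lookup y w)))"
    by (rule smash_mult_superset) (use Poly_Mapping.keys_add[of x x'] in auto)
  then show ?thesis
    by (simp add: smash_mult_superset[of ?A x] smash_mult_superset[of ?A x'] lookup_add distrib_right
        single_add sum.distrib)
qed

lemma of_RT_add: "of_RT (f + g) = of_RT f + of_RT g"
  by (simp only: of_RT_def fr_add single_add)

lemma smash_mult_of_RT_0: "smash_mult (of_RT 0) y = 0"
  by (simp add: of_RT_def smash_mult_def fr_0)

lemma nilhecke_simps [simp]: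
  "carrier (nilhecke D) = {\<Sum>w\<in>F. smash_mult (of_RT (f w)) (T_elt D w) |F f. finite F \<and> F \<subseteq> W}"
  "mult (nilhecke D) = smash_mult" "zero (nilhecke D) = 0" "add (nilhecke D) = (+)"
  by (simp_all add: nilhecke_def)

lemma nilhecke_closed:
  assumes "x \<in> carrier (nilhecke D)" "y \<in> carrier (nilhecke D)" shows "x + y \<in> carrier (nilhecke D)"
proof -
  obtain F f where F: "finite F" "F \<subseteq> W" "x = (\<Sum>w\<in>F. smash_mult (of_RT (f w)) (T_elt D w))" using assms(1) by auto
  obtain G g where G: "finite G" "G \<subseteq> W" "y = (\<Sum>w\<in>G. smash_mult (of_RT (g w)) (T_elt D w))" using assms(2) by auto
  let ?f = "\<lambda>w. if w \<in> F then f w else 0" and ?g = "\<lambda>w. if w \<in> G then g w else 0"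
  have "x = (\<Sum>w\<in>F \<union> G. smash_mult (of_RT (?f w)) (T_elt D w))"
    unfolding F(3) using F G by (intro sum.mono_neutral_cong_left) (auto simp: smash_mult_of_RT_0)
  moreover have "y = (\<Sum>w\<in>F \<union> G. smash_mult (of_RT (?g w)) (T_elt D w))"
    unfolding G(3) using F G by (intro sum.mono_neutral_cong_left) (auto simp: smash_mult_of_RT_0)
  ultimately have "x + y = (\<Sum>w\<in>F \<union> G. smash_mult (of_RT (?f w + ?g w)) (T_elt D w))"
    by (simp only: of_RT_add smash_mult_add_left sum.distrib)
  then show ?thesis using F G by auto
qed

lemma nilhecke_0: "0 \<in> carrier (nilhecke D)"
  by (auto intro!: exI[of _ "{}"])

lemma nilhecke_term: assumes "z \<in> W" shows "smash_mult (of_RT f) (T_elt D z) \<in> carrier (nilhecke D)"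
  using assms by (auto intro!: exI[of _ "{z}"] exI[of _ "\<lambda>_. f"])

lemma abelian_monoid_nilhecke: "abelian_monoid (nilhecke D)"
  by (rule abelian_monoidI) (use nilhecke_closed nilhecke_0 in \<open>auto simp: add_ac simp del: nilhecke_simps(1)\<close>)

text \<open>The membership half serves the double sum of the dominant formula, whose inner sums have
  to lie in the carrier.\<close>

lemma finsum_nilhecke:
  assumes "finite A" "\<And>a. a \<in> A \<Longrightarrow> f a \<in> carrier (nilhecke D)"
  shows "finsum (nilhecke D) f A = (\<Sum>a\<in>A. f a) \<and> (\<Sum>a\<in>A. f a) \<in> carrier (nilhecke D)"
proof -
  interpret abelian_monoid "nilhecke D" by (rule abelian_monoid_nilhecke)
  show ?thesis using assms
  proof (induction A rule: finite_induct)
    case empty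
    then show ?case using nilhecke_0 by simp
  next
    case (insert a A)
    then have "finsum (nilhecke D) f (insert a A) = f a \<oplus>\<^bsub>nilhecke D\<^esub> finsum (nilhecke D) f A"
      by (intro finsum_insert) auto
    then show ?case using insert nilhecke_closed[of "f a" "\<Sum>a\<in>A. f a"] by (simp del: nilhecke_simps(1))
  qed
qed

lemma opr_term: "z \<in> W \<Longrightarrow> opr (smash_mult (of_RT f) (T_elt D z)) q = fr f * opr (T_elt D z) q"
  by (simp only: opr_mult supp_of_RT supp_T_elt opr_of_RT)

lemma supp_term: "z \<in> W \<Longrightarrow> supp (smash_mult (of_RT f) (T_elt D z))"
  by (intro supp_mult supp_of_RT supp_T_elt)

end

section \<open>The two formulas in the smash product\<close>

context dominant_datum
begin

lemma up_coef_ble: "w \<in> W \<Longrightarrow> z \<in> W \<Longrightarrow> up_coef w z \<noteq> 0 \<Longrightarrow> z \<preceq> w"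
proof (rule ccontr)
  assume "z \<in> W" "up_coef w z \<noteq> 0" "\<not> z \<preceq> w"
  then have "up_paths D lam w z = {}" using up_paths_ble by blast
  then show False using \<open>up_coef w z \<noteq> 0\<close> unfolding up_coef_def by (simp only: sum.empty)
qed

lemma down_coef_ble: "w \<in> W \<Longrightarrow> z \<in> W \<Longrightarrow> down_coef w z \<noteq> 0 \<Longrightarrow> z \<preceq> w"
proof (rule ccontr)
  assume "w \<in> W" "z \<in> W" "down_coef w z \<noteq> 0" "\<not> z \<preceq> w"
  then have "{p \<in> down_paths D lam w. down_path D lam w p = z} = {}" using down_path_ble by blast
  then show False using \<open>down_coef w z \<noteq> 0\<close> unfolding down_coef_def by (simp only: sum.empty)
qed

lemma chevalley_dominant:
  assumes w: "w \<in> W"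
  shows "smash_mult (T_elt D w) (of_RT (ex lam)) = (\<Sum>z\<in>{z \<in> W. z \<preceq> w}. \<Sum>p\<in>up_paths D lam w z.
    smash_mult (of_RT (ex (endpoint D lam p))) (T_elt D z))" (is "?L = ?R")
proof (rule opr_faithful)
  show "supp ?L" by (intro supp_mult supp_T_elt w supp_of_RT)
  show "supp ?R" by (intro supp_sum supp_term) simp
  fix \<mu> :: "'n weight"
  let ?q = "fr (ex \<mu>)"
  have "opr ?L ?q = opr (T_elt D w) (fr (ex lam) * ?q)"
    by (simp only: opr_mult supp_T_elt[OF w] supp_of_RT opr_of_RT)
  also have "\<dots> = (\<Sum>z\<in>{z \<in> W. z \<preceq> w}. fr (up_coef w z) * opr (T_elt D z) ?q)"
    by (rule opr_T_elt_expansion[OF up_coef_intertwines up_coef_ble up_coef_id w])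
  also have "\<dots> = opr ?R ?q"
    unfolding opr_sum up_coef_def fr_sum sum_distrib_right
    by (intro sum.cong refl) (simp only: mem_Collect_eq opr_term)
  finally show "opr ?L ?q = opr ?R ?q" .
qed

lemma chevalley_antidominant:
  assumes w: "w \<in> W"
  shows "smash_mult (T_elt D w) (of_RT (ex (- lam))) = (\<Sum>p\<in>down_paths D lam w.
    smash_mult (of_RT ((- 1) ^ (\<ell> w - \<ell> (down_path D lam w p)) * ex (- endpoint D lam p)))
      (T_elt D (down_path D lam w p)))" (is "?L = ?R")
proof (rule opr_faithful)
  show "supp ?L" by (intro supp_mult supp_T_elt w supp_of_RT)
  show "supp ?R" by (intro supp_sum supp_term down_path_weyl[OF w])
  fix \<mu> :: "'n weight"
  let ?q = "fr (ex \<mu>)"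
  let ?Z = "{z \<in> W. z \<preceq> w}"
  let ?f = "\<lambda>z p. fr ((- 1) ^ (\<ell> w - \<ell> z) * ex (- endpoint D lam p)) * opr (T_elt D z) ?q"
  have "opr ?L ?q = opr (T_elt D w) (fr (ex (- lam)) * ?q)"
    by (simp only: opr_mult supp_T_elt[OF w] supp_of_RT opr_of_RT)
  also have "\<dots> = (\<Sum>z\<in>?Z. fr (down_coef w z) * opr (T_elt D z) ?q)"
    by (rule opr_T_elt_expansion[OF down_coef_intertwines down_coef_ble down_coef_id w])
  also have "\<dots> = (\<Sum>z\<in>?Z. \<Sum>p\<in>{p \<in> down_paths D lam w. down_path D lam w p = z}. ?f (down_path D lam w p) p)"
    unfolding down_coef_def fr_sum sum_distrib_right
    by (intro sum.cong refl) (simp only: mem_Collect_eq of_int_power of_int_minus of_int_1)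
  also have "\<dots> = (\<Sum>p\<in>down_paths D lam w. ?f (down_path D lam w p) p)"
    by (rule sum.group[OF finite_down_paths[OF w] finite_below])
       (use down_path_weyl[OF w] down_path_ble[OF w] in auto)
  also have "\<dots> = opr ?R ?q"
    unfolding opr_sum by (intro sum.cong refl) (simp only: opr_term[OF down_path_weyl[OF w]])
  finally show "opr ?L ?q = opr ?R ?q" .
qed

end

theorem theorem3p2:
  fixes D :: "('i, 'n::{finite,linorder}) root_datum"
    and lam :: "'n weight"
    and w :: "'n weight \<Rightarrow> 'n weight"
  assumes "kac_moody_datum D"
    and "dominant D lam"
    and "w \<in> weyl D"
  shows "finite {z \<in> weyl D. bruhat_le D z w} \<and>
    (\<forall>z\<in>weyl D. bruhat_le D z w \<longrightarrow> finite (up_paths D lam w z)) \<and>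
    T_elt D w \<otimes>\<^bsub>nilhecke D\<^esub> of_RT (ex lam) =
      (\<Oplus>\<^bsub>nilhecke D\<^esub>z\<in>{z \<in> weyl D. bruhat_le D z w}.
        \<Oplus>\<^bsub>nilhecke D\<^esub>p\<in>up_paths D lam w z.
          of_RT (ex (endpoint D lam p)) \<otimes>\<^bsub>nilhecke D\<^esub> T_elt D z) \<and>
    finite (down_paths D lam w) \<and>
    T_elt D w \<otimes>\<^bsub>nilhecke D\<^esub> of_RT (ex (- lam)) =
      (\<Oplus>\<^bsub>nilhecke D\<^esub>p\<in>down_paths D lam w.
        of_RT ((- 1) ^ (len D w - len D (down_path D lam w p)) * ex (- endpoint D lam p))
          \<otimes>\<^bsub>nilhecke D\<^esub> T_elt D (down_path D lam w p))"
proof -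
  interpret kac_moody_datum D by fact
  interpret dominant_datum D lam by unfold_locales fact
  note w = assms(3)
  let ?Z = "{z \<in> W. z \<preceq> w}"
  let ?t = "\<lambda>z p. smash_mult (of_RT (ex (endpoint D lam p))) (T_elt D z)"
  have inner: "finsum (nilhecke D) (?t z) (up_paths D lam w z) = (\<Sum>p\<in>up_paths D lam w z. ?t z p)
      \<and> (\<Sum>p\<in>up_paths D lam w z. ?t z p) \<in> carrier (nilhecke D)" if "z \<in> ?Z" for z
    using that w by (intro finsum_nilhecke finite_up_paths nilhecke_term) auto
  have "finsum (nilhecke D) (\<lambda>z. finsum (nilhecke D) (?t z) (up_paths D lam w z)) ?Z
      = (\<Sum>z\<in>?Z. finsum (nilhecke D) (?t z) (up_paths D lam w z))"
    using inner by (intro finsum_nilhecke[THEN conjunct1] finite_below) (simp del: nilhecke_simps(1))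
  also have "\<dots> = (\<Sum>z\<in>?Z. \<Sum>p\<in>up_paths D lam w z. ?t z p)"
    using inner by (intro sum.cong refl) blast
  also have "\<dots> = smash_mult (T_elt D w) (of_RT (ex lam))" using chevalley_dominant[OF w] by simp
  finally have up: "finsum (nilhecke D) (\<lambda>z. finsum (nilhecke D) (?t z) (up_paths D lam w z)) ?Z
    = smash_mult (T_elt D w) (of_RT (ex lam))" .
  let ?d = "\<lambda>p. smash_mult (of_RT ((- 1) ^ (\<ell> w - \<ell> (down_path D lam w p)) * ex (- endpoint D lam p)))
    (T_elt D (down_path D lam w p))"
  have "finsum (nilhecke D) ?d (down_paths D lam w) = (\<Sum>p\<in>down_paths D lam w. ?d p)"
    by (intro finsum_nilhecke[THEN conjunct1] finite_down_paths[OF w] nilhecke_term down_path_weyl[OF w])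
  then have down: "finsum (nilhecke D) ?d (down_paths D lam w) = smash_mult (T_elt D w) (of_RT (ex (- lam)))"
    using chevalley_antidominant[OF w] by simp
  show ?thesis
    using finite_below finite_up_paths[OF w] finite_down_paths[OF w] up down
    by (simp only: nilhecke_simps(2)) blast
qed

end
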